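(* Let $l\ge1$ and $k>2$ be integers. Let $V$ be the $\mathbb{C}$-vector space freely spanned by the symbols $x^ry^s(u,v)$ with $r,s\ge0$, $r+s=k-2$, $(u,v)\in E_l$, and let $\mu$ be the linear map on $V$ given by $$\mu\bigl(x^ry^s(u,v)\bigr)=(-1)^s\,\tilde s^{(s+1)}_{u/l}\,\tilde s^{(r+1)}_{v/l}.$$ Then for all $r,s\ge 0$ with $r+s=k-2$ and all $(a,b)\in E_l$, the map $\mu$ takes the element $$x^ry^s(a,b)+(-1)^r\,y^r(x-y)^s(b,-a-b)+(-1)^s\,(y-x)^rx^s(-a-b,a)$$ into the $\mathbb{C}$-linear span of the forms $\tilde s^{(k)}_{c/l}$ and the derivatives $\partial_\tau\tilde s^{(k-2)}_{c/l}$, $c\in\mathbb{Z}/l\mathbb{Z}$.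
   Context: $E_l\subset(\mathbb{Z}/l\mathbb{Z})^2$ is the set of pairs $(u,v)$ with $\mathbb{Z}u+\mathbb{Z}v=\mathbb{Z}/l\mathbb{Z}$. For a homogeneous polynomial $P(x,y)=\sum_{r+s=k-2} p_{r,s}x^ry^s$, the symbol $P(x,y)(u,v)$ means $\sum p_{r,s}\,x^ry^s(u,v)$. Let $q=e^{2\pi i\tau}$. For integers $a,d$ put $\delta_d^{a \bmod l}=1$ if $d\equiv a \pmod l$ and $0$ otherwise. For $j\ge 1$ and $a\in\mathbb{Z}/l\mathbb{Z}$ put $$\tilde s^{(j)}_{a/l}=C+\sum_{n>0}q^n\sum_{d\mid n}d^{j-1}\bigl(\delta_d^{a\bmod l}+(-1)^j\delta_d^{-a\bmod l}\bigr),$$ where for $(a,j)\neq(0,2)$ the constant $C$ is the unique one making $\tilde s^{(j)}_{a/l}$ a modular form of weight $j$ on $\Gamma_1(l)$ (for $j=1$ and $1\le a\le l-1$, $C=\frac12-\frac al$; $\tilde s^{(1)}_{0/l}=0$), and for $(a,j)=(0,2)$ it is $C=-l/12$, so that $\tilde s^{(2)}_{0/l}(\tau)=2l\,E_2(l\tau)$ with $E_2=-\frac1{24}+\sum_{n>0}q^n\sum_{d\mid n}d$ is quasimodular. *)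

theory Defs
  imports
    "HOL-Analysis.Analysis"
    "HOL-Library.Poly_Mapping"
    "HOL-Library.Function_Algebras"
    "HOL-Number_Theory.Cong"
begin

section \<open>Modular forms on $\Gamma_1(l)$\<close>

definition upper_half :: "complex set" where
  "upper_half = {\<tau>. Im \<tau> > 0}"

definition moebius :: "int \<Rightarrow> int \<Rightarrow> int \<Rightarrow> int \<Rightarrow> complex \<Rightarrow> complex" where
  "moebius a b c d \<tau> = (of_int a * \<tau> + of_int b) / (of_int c * \<tau> + of_int d)"

definition slash :: "nat \<Rightarrow> int \<Rightarrow> int \<Rightarrow> int \<Rightarrow> int \<Rightarrow> (complex \<Rightarrow> complex) \<Rightarrow> complex \<Rightarrow> complex" where
  "slash j a b c d f \<tau> = f (moebius a b c d \<tau>) / (of_int c * \<tau> + of_int d) ^ j"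

text \<open>
  Holomorphy at the cusps is the condition that \<open>f\<close> slashed with any matrix in $SL_2(\mathbb{Z})$
  stays bounded as $\mathrm{Im}\,\tau \to \infty$; the slashed function is periodic, so this says
  that its Fourier expansion has no negative exponents.
\<close>
definition modular_form :: "nat \<Rightarrow> nat \<Rightarrow> (complex \<Rightarrow> complex) \<Rightarrow> bool" where
  "modular_form l j f \<longleftrightarrow>
     f holomorphic_on upper_half \<and>
     (\<forall>a b c d :: int. a * d - b * c = 1 \<longrightarrow> [a = 1] (mod int l) \<longrightarrow> [d = 1] (mod int l) \<longrightarrow>
        [c = 0] (mod int l) \<longrightarrow> (\<forall>\<tau>\<in>upper_half. slash j a b c d f \<tau> = f \<tau>)) \<and>
     (\<forall>a b c d :: int. a * d - b * c = 1 \<longrightarrow>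
        (\<exists>B R. \<forall>\<tau>\<in>upper_half. Im \<tau> \<ge> R \<longrightarrow> norm (slash j a b c d f \<tau>) \<le> B))"


section \<open>The forms $\tilde s^{(j)}_{a/l}$\<close>

text \<open>
  Functions on the upper half-plane are represented by their extension by zero to the whole
  plane, so that equality and linear combinations in \<^typ>\<open>complex \<Rightarrow> complex\<close> are those
  of functions on the upper half-plane. The summand with index \<open>n\<close> belongs to
  $q^{n+1}$. Residue classes modulo \<open>l\<close> are given by arbitrary integer
  representatives \<open>a\<close>.
\<close>
definition s_series :: "nat \<Rightarrow> nat \<Rightarrow> int \<Rightarrow> complex \<Rightarrow> complex \<Rightarrow> complex" where
  "s_series l j a C \<tau> =
     (if \<tau> \<in> upper_half then
        C + suminf (\<lambda>n. exp (2 * of_real pi * \<i> * \<tau>) ^ Suc n *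
               (\<Sum>d | d dvd Suc n. of_nat d ^ (j - 1) *
                  (of_bool ([int d = a] (mod int l)) + (-1) ^ j * of_bool ([int d = - a] (mod int l)))))
      else 0)"

text \<open>
  In weight one the constants $\frac12-\frac al$ for $1\le a\le l-1$, and $0$ for $a=0$, are also
  the unique ones that give modular forms; their standard explicit values are used here.
  The case $j=2$, $a=0$ is the quasimodular one.
\<close>
definition s_const :: "nat \<Rightarrow> nat \<Rightarrow> int \<Rightarrow> complex" where
  "s_const l j a =
     (if j = 1 then (if int l dvd a then 0 else 1 / 2 - of_int (a mod int l) / of_nat l)
      else if j = 2 \<and> int l dvd a then - of_nat l / 12
      else (THE C. modular_form l j (s_series l j a C)))"

definition s_tilde :: "nat \<Rightarrow> nat \<Rightarrow> int \<Rightarrow> complex \<Rightarrow> complex" where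
  "s_tilde l j a = s_series l j a (s_const l j a)"

definition deriv_upper :: "(complex \<Rightarrow> complex) \<Rightarrow> complex \<Rightarrow> complex" where
  "deriv_upper f \<tau> = (if \<tau> \<in> upper_half then deriv f \<tau> else 0)"

definition fscale :: "complex \<Rightarrow> (complex \<Rightarrow> complex) \<Rightarrow> complex \<Rightarrow> complex" where
  "fscale c f = (\<lambda>\<tau>. c * f \<tau>)"

lemma vector_space_fscale: "vector_space fscale"
  by unfold_locales (auto simp: fscale_def fun_eq_iff algebra_simps)


section \<open>Modular symbols\<close>

text \<open>
  $\mathbb{Z}/l\mathbb{Z}$ is represented by the residues \<open>0, \<dots>, l - 1\<close>.
\<close>
definition E_set :: "nat \<Rightarrow> (int \<times> int) set" where
  "E_set l = {(u, v). u \<in> {0..<int l} \<and> v \<in> {0..<int l} \<and>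
                (\<forall>w. \<exists>m n. [m * u + n * v = w] (mod int l))}"

text \<open>
  Polynomials in \<open>x, y\<close> are finitely supported functions on exponent pairs, with the
  convolution product of \<open>Poly_Mapping\<close>. The free vector space on the symbols
  $x^r y^s (u,v)$ consists of the finitely supported functions on the quadruples
  \<open>((r, s), (u, v))\<close>.
\<close>
type_synonym poly2 = "(nat \<times> nat) \<Rightarrow>\<^sub>0 complex"
type_synonym symbols = "((nat \<times> nat) \<times> (int \<times> int)) \<Rightarrow>\<^sub>0 complex"

definition X :: poly2 where "X = Poly_Mapping.single (1, 0) 1"
definition Y :: poly2 where "Y = Poly_Mapping.single (0, 1) 1"

definition V_space :: "nat \<Rightarrow> nat \<Rightarrow> symbols set" where
  "V_space l k = {f. Poly_Mapping.keys f \<subseteq> {(r, s). r + s = k - 2} \<times> E_set l}"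

definition symbol :: "nat \<Rightarrow> poly2 \<Rightarrow> int \<times> int \<Rightarrow> symbols" where
  "symbol l P = (\<lambda>(u, v). \<Sum>m\<in>Poly_Mapping.keys P.
     Poly_Mapping.single (m, (u mod int l, v mod int l)) (Poly_Mapping.lookup P m))"

definition mu_basis :: "nat \<Rightarrow> (nat \<times> nat) \<times> (int \<times> int) \<Rightarrow> complex \<Rightarrow> complex" where
  "mu_basis l = (\<lambda>((r, s), (u, v)) \<tau>. (-1) ^ s * s_tilde l (s + 1) u \<tau> * s_tilde l (r + 1) v \<tau>)"

definition mu :: "nat \<Rightarrow> symbols \<Rightarrow> complex \<Rightarrow> complex" where
  "mu l f = (\<Sum>p\<in>Poly_Mapping.keys f. fscale (Poly_Mapping.lookup f p) (mu_basis l p))"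

lemma mu_superset:
  assumes "finite S" "Poly_Mapping.keys f \<subseteq> S"
  shows "mu l f = (\<Sum>p\<in>S. fscale (Poly_Mapping.lookup f p) (mu_basis l p))"
  unfolding mu_def using assms
  by (intro sum.mono_neutral_left) (auto simp: in_keys_iff fscale_def fun_eq_iff)

lemma mu_add: "mu l (f + g) = mu l f + mu l g"
proof -
  let ?S = "Poly_Mapping.keys f \<union> Poly_Mapping.keys g"
  have "mu l h = (\<Sum>p\<in>?S. fscale (Poly_Mapping.lookup h p) (mu_basis l p))"
    if "h \<in> {f, g, f + g}" for h
    using that keys_add[of f g] by (intro mu_superset) auto
  hence *: "mu l f = (\<Sum>p\<in>?S. fscale (Poly_Mapping.lookup f p) (mu_basis l p))"
           "mu l g = (\<Sum>p\<in>?S. fscale (Poly_Mapping.lookup g p) (mu_basis l p))"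
           "mu l (f + g) = (\<Sum>p\<in>?S. fscale (Poly_Mapping.lookup (f + g) p) (mu_basis l p))"
    by blast+
  interpret vector_space fscale by (rule vector_space_fscale)
  show ?thesis
    unfolding * by (simp only: lookup_add scale_left_distrib sum.distrib)
qed

lemma mu_scale: "mu l (Poly_Mapping.map ((*) c) f) = fscale c (mu l f)"
proof -
  have "Poly_Mapping.keys (Poly_Mapping.map ((*) c) f) \<subseteq> Poly_Mapping.keys f"
    by (auto simp: in_keys_iff map.rep_eq when_def)
  hence "mu l (Poly_Mapping.map ((*) c) f) =
         (\<Sum>p\<in>Poly_Mapping.keys f. fscale (Poly_Mapping.lookup (Poly_Mapping.map ((*) c) f) p) (mu_basis l p))"
    by (intro mu_superset) auto
  also have "\<dots> = (\<Sum>p\<in>Poly_Mapping.keys f. fscale c (fscale (Poly_Mapping.lookup f p) (mu_basis l p)))"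
    by (intro sum.cong refl) (auto simp: map.rep_eq when_def in_keys_iff fscale_def fun_eq_iff)
  also have "\<dots> = fscale c (mu l f)"
  proof -
    interpret vector_space fscale by (rule vector_space_fscale)
    show ?thesis by (simp only: mu_def scale_sum_right)
  qed
  finally show ?thesis .
qed

lemma mu_single: "mu l (Poly_Mapping.single p 1) = mu_basis l p"
  by (simp add: mu_def fscale_def)

lemma V_space_add: "f \<in> V_space l k \<Longrightarrow> g \<in> V_space l k \<Longrightarrow> f + g \<in> V_space l k"
  unfolding V_space_def using keys_add[of f g] by blast

text \<open>The three-term elements lie in the space $V$.\<close>

definition homog :: "nat \<Rightarrow> poly2 \<Rightarrow> bool" where
  "homog n P \<longleftrightarrow> (\<forall>m\<in>Poly_Mapping.keys P. fst m + snd m = n)"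

lemma homog_mult: "homog m P \<Longrightarrow> homog n Q \<Longrightarrow> homog (m + n) (P * Q)"
  unfolding homog_def using keys_mult[of P Q] by fastforce

lemma homog_1: "homog 0 1"
  by (auto simp: homog_def)

lemma homog_power: "homog m P \<Longrightarrow> homog (m * n) (P ^ n)"
  by (induction n) (auto simp: homog_1 dest: homog_mult)

lemma homog_uminus: "homog m P \<Longrightarrow> homog m (- P)"
  by (auto simp: homog_def in_keys_iff)

lemma homog_add: "homog m P \<Longrightarrow> homog m Q \<Longrightarrow> homog m (P + Q)"
  unfolding homog_def using keys_add[of P Q] by blast

lemma homog_diff: "homog m P \<Longrightarrow> homog m Q \<Longrightarrow> homog m (P - Q)"
  using homog_add[of m P "- Q"] homog_uminus[of m Q] by simp

lemma homog_XY: "homog 1 X" "homog 1 Y"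
  by (auto simp: homog_def X_def Y_def)

lemma homog_sign: "homog 0 ((-1) ^ n)"
  using homog_power[OF homog_uminus[OF homog_1], of n] by simp

lemma symbol_in_V_space:
  assumes "homog (k - 2) P" "(u mod int l, v mod int l) \<in> E_set l"
  shows "symbol l P (u, v) \<in> V_space l k"
proof -
  have "Poly_Mapping.keys (symbol l P (u, v)) \<subseteq>
        Poly_Mapping.keys P \<times> {(u mod int l, v mod int l)}"
    by (auto simp: symbol_def in_keys_iff lookup_sum lookup_single when_def
             elim!: sum.not_neutral_contains_not_neutral split: if_splits)
  thus ?thesis using assms by (fastforce simp: V_space_def homog_def)
qed

lemma E_set_rotate:
  assumes "(a, b) \<in> E_set l"
  shows "(b mod int l, (- a - b) mod int l) \<in> E_set l"
        "((- a - b) mod int l, a mod int l) \<in> E_set l"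
        "(a mod int l, b mod int l) \<in> E_set l"
proof -
  have l: "int l > 0" using assms by (auto simp: E_set_def)
  have gen: "\<exists>m n. [m * a + n * b = w] (mod int l)" for w
    using assms by (auto simp: E_set_def)
  have *: "(u mod int l, v mod int l) \<in> E_set l"
    if gen': "\<And>m n. \<exists>m' n'. m' * u + n' * v = m * a + n * b" for u v
  proof -
    have "\<exists>m n. [m * (u mod int l) + n * (v mod int l) = w] (mod int l)" for w
    proof -
      obtain m n where 1: "[m * a + n * b = w] (mod int l)" using gen by blast
      obtain m' n' where 2: "m' * u + n' * v = m * a + n * b" using gen' by blast
      have "[m' * (u mod int l) + n' * (v mod int l) = m' * u + n' * v] (mod int l)"
        by (intro cong_add cong_mult) (auto simp: cong_def)
      thus ?thesis using 1 2 cong_trans by metis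
    qed
    thus ?thesis using l by (auto simp: E_set_def)
  qed
  have "\<exists>m' n'. m' * b + n' * (- a - b) = m * a + n * b" for m n
    by (rule exI[of _ "n - m"], rule exI[of _ "- m"]) (simp add: algebra_simps)
  thus "(b mod int l, (- a - b) mod int l) \<in> E_set l" by (rule *)
  have "\<exists>m' n'. m' * (- a - b) + n' * a = m * a + n * b" for m n
    by (rule exI[of _ "- n"], rule exI[of _ "m - n"]) (simp add: algebra_simps)
  thus "((- a - b) mod int l, a mod int l) \<in> E_set l" by (rule *)
  show "(a mod int l, b mod int l) \<in> E_set l" by (rule *) auto
qed

lemma three_term_in_V_space:
  assumes "r + s = k - 2" "(a, b) \<in> E_set l"
  shows "symbol l (X ^ r * Y ^ s) (a, b)
         + symbol l ((-1) ^ r * Y ^ r * (X - Y) ^ s) (b, - a - b)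
         + symbol l ((-1) ^ s * (Y - X) ^ r * X ^ s) (- a - b, a) \<in> V_space l k"
proof -
  have XY: "homog 1 (X - Y)" "homog 1 (Y - X)"
    by (intro homog_diff homog_XY)+
  have p: "homog n (P ^ n)" if "homog 1 P" for P n
    using homog_power[OF that, of n] by simp
  have "homog (k - 2) (X ^ r * Y ^ s)"
    using homog_mult[OF p p] homog_XY assms by metis
  moreover have "homog (0 + r + s) ((-1) ^ r * Y ^ r * (X - Y) ^ s)"
    by (intro homog_mult homog_sign p homog_XY XY)
  moreover have "homog (0 + r + s) ((-1) ^ s * (Y - X) ^ r * X ^ s)"
    by (intro homog_mult homog_sign p homog_XY XY)
  ultimately show ?thesis
    using E_set_rotate[OF assms(2)] assms(1)
    by (intro V_space_add symbol_in_V_space) auto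
qed

end

theory Submission
  imports Defs "HOL-Complex_Analysis.Complex_Analysis"
begin

text \<open>
  Fix \<open>\<tau>\<close> and write \<open>q = exp (2\<pi>i\<tau>)\<close>. The generating function of
  $\tilde s^{(j)}_{a/l} z^{j-1}/(j-1)!$ over \<open>j \<ge> 1\<close> is \<open>K\<^sub>a(z) = F\<^sub>a(z) + 1/(l z)\<close>, where
  for \<open>-2\<pi> Im \<tau> < Re z < 0\<close>
  \[ F_a(z) = \sum_{d \equiv a \,(l)} \varphi(d) e^{dz}, \qquad
     \varphi(d) = \frac1{1-q^d} \ (d \ne 0), \quad \varphi(0) = \frac12 . \]

  The function $F_a'$ extends to a meromorphic function with double poles on the lattice
  \<open>2\<pi>i(\<int>\<tau> + \<int>/l)\<close> that is invariant under \<open>2\<pi>i\<tau>\<close> and is multiplied by \<open>exp (2\<pi>ia/l)\<close> under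
  \<open>2\<pi>i/l\<close>. A matrix of $\Gamma_1(l)$ only rescales the lattice and keeps this character, so by
  Liouville the rescaled function for the transformed \<open>\<tau>\<close> differs from the original one by a
  constant, which vanishes if the character is nontrivial. Hence the Taylor coefficients are modular,
  which identifies the constant terms of the $\tilde s^{(j)}_{a/l}$ as Taylor coefficients of
  an elementary function.

  With \<open>x = q\<^sup>d\<close>, \<open>y = q\<^sup>e\<close>, the identity
  \[ \frac1{(1-y)(1-x/y)} + \frac1{(1-x)(1-y/x)} = \frac1{(1-x)(1-y)} \]
  holds termwise in $F_b(\xi+\eta)F_{A-b}(\eta) + F_A(\xi+\eta)F_{b-A}(\xi) - F_A(\eta)F_b(\xi)$,
  except on the lines \<open>d = e\<close>, \<open>e = 0\<close>, \<open>d = 0\<close>, whose contribution is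
  \<open>-q\<^sup>d/(1-q\<^sup>d)\<^sup>2\<close>, a derivative in \<open>\<tau>\<close>. Replacing \<open>F\<close> by \<open>K - 1/(l z)\<close> leaves single values of \<open>K\<close>.
  With \<open>A = -a\<close> the homogeneous part of degree \<open>k - 2\<close> is the generating function over \<open>r + s = k - 2\<close> of
  the images under $\mu$ of the three-term elements.
\<close>

section \<open>Two-sided exponential sums\<close>

text \<open>The series for \<open>F\<close> converges only to the left of the imaginary axis, so the
  product identity is first known for \<open>\<xi>\<close>, \<open>\<eta>\<close>,
  \<open>\<xi> + \<eta>\<close> of negative real part. To reach Taylor coefficients at 0 in a single
  variable, put \<open>\<xi> = t\<close> and \<open>\<eta> = y t\<close> with a fixed real y > 0:
  the identity is checked for small negative t and continued to an identity of power series in t.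
  Its coefficient of degree k - 2 is a polynomial in y. As its values for all y > 0 lie in the
  required span, which is a subspace, so do its coefficients, and these are the images of the
  three-term elements up to factorials.

  Differentiating \<open>F\<close> removes a jump by 1 that occurs under 2 pi i
  \<open>\<tau>\<close> when l divides a. The price is weight 1, where the constant is compared
  directly with the prescribed value. Liouville leaves a constant undetermined, which only affects
  weight 2; this is where the quasimodular exception arises, and -l/12 is then read off from the
  expansion. The three-term relation itself holds for the Taylor coefficients in every weight;
  modularity, including boundedness at the cusps, serves only to identify the constant
  terms.\<close>

lemma summable_on_power_abs_int:
  fixes \<rho> :: real
  assumes "0 \<le> \<rho>" "\<rho> < 1"
  shows "(\<lambda>d::int. \<rho> ^ nat \<bar>d\<bar>) summable_on UNIV"
proof -
  have *: "(\<lambda>n::nat. \<rho> ^ n) summable_on UNIV"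
    using assms by (intro summable_nonneg_imp_summable_on summable_geometric) auto
  have 1: "(\<lambda>d::int. \<rho> ^ nat \<bar>d\<bar>) summable_on {0..}"
    using * by (subst summable_on_reindex_bij_witness[where S = "{0..}" and T = UNIV
        and i = int and j = nat and h = "\<lambda>n. \<rho> ^ n"]) auto
  have 2: "(\<lambda>d::int. \<rho> ^ nat \<bar>d\<bar>) summable_on {..0}"
    using * by (subst summable_on_reindex_bij_witness[where S = "{..0}" and T = UNIV
        and i = "\<lambda>n. - int n" and j = "\<lambda>d. nat (-d)" and h = "\<lambda>n. \<rho> ^ n"]) auto
  have "({0..} :: int set) \<union> {..0} = UNIV" by auto
  with summable_on_union[OF 1 2] show ?thesis by simp
qed

text \<open>Only the rate \<open>\<rho>\<close> is a parameter, because it alone determines the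
  strip |Re z| < - ln \<open>\<rho>\<close> on which \<open>expsum c\<close> converges. For
  \<open>nu\<close> and \<open>psi\<close> the rate is |q|, so the strip is |Re z| < 2 pi Im
  \<open>\<tau>\<close>.\<close>

definition geom_bounded :: "real \<Rightarrow> (int \<Rightarrow> complex) \<Rightarrow> bool" where
  "geom_bounded \<rho> c \<longleftrightarrow> 0 < \<rho> \<and> \<rho> < 1 \<and> (\<exists>C. \<forall>d. norm (c d) \<le> C * \<rho> ^ nat \<bar>d\<bar>)"

definition expsum :: "(int \<Rightarrow> complex) \<Rightarrow> complex \<Rightarrow> complex" where
  "expsum c z = (\<Sum>\<^sub>\<infinity>d. c d * exp (of_int d * z))"

lemma geom_bounded_abs_summable:
  assumes "geom_bounded \<rho> c"
  shows "(\<lambda>d. norm (c d)) summable_on UNIV"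
proof -
  obtain C where C: "\<And>d. norm (c d) \<le> C * \<rho> ^ nat \<bar>d\<bar>" and \<rho>: "0 < \<rho>" "\<rho> < 1"
    using assms by (auto simp: geom_bounded_def)
  show ?thesis
    by (rule Infinite_Sum.abs_summable_on_comparison_test'[OF summable_on_cmult_right[OF summable_on_power_abs_int]])
       (use C \<rho> in auto)
qed

lemma norm_exp_of_int_mult_le:
  fixes z :: complex
  assumes "\<bar>Re z\<bar> \<le> R"
  shows "norm (exp (of_int d * z)) \<le> exp R ^ nat \<bar>d\<bar>"
proof -
  have "of_int d * Re z \<le> of_int \<bar>d\<bar> * \<bar>Re z\<bar>"
    by (metis abs_ge_self abs_mult of_int_abs)
  also have "\<dots> \<le> of_int \<bar>d\<bar> * R"
    using assms by (intro mult_left_mono) auto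
  finally have "exp (of_int d * Re z) \<le> exp (real (nat \<bar>d\<bar>) * R)"
    by simp
  thus ?thesis
    by (simp add: norm_exp_eq_Re exp_of_nat_mult[symmetric] del: exp_le_cancel_iff)
qed

lemma geom_bounded_exp:
  assumes "geom_bounded \<rho> c" and "\<bar>Re z\<bar> < - ln \<rho>"
  shows "geom_bounded (\<rho> * exp \<bar>Re z\<bar>) (\<lambda>d. c d * exp (of_int d * z))"
proof -
  obtain C where C: "\<And>d. norm (c d) \<le> C * \<rho> ^ nat \<bar>d\<bar>" and \<rho>: "0 < \<rho>" "\<rho> < 1"
    using assms by (auto simp: geom_bounded_def)
  have "norm (c d * exp (of_int d * z)) \<le> C * (\<rho> * exp \<bar>Re z\<bar>) ^ nat \<bar>d\<bar>" for d
  proof -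
    have "norm (c d * exp (of_int d * z)) \<le> C * \<rho> ^ nat \<bar>d\<bar> * exp \<bar>Re z\<bar> ^ nat \<bar>d\<bar>"
      unfolding norm_mult using norm_exp_of_int_mult_le[of z "\<bar>Re z\<bar>" d] C[of d] 
      by (intro mult_mono) (auto intro: order_trans[OF norm_ge_zero C])
    thus ?thesis by (simp add: power_mult_distrib mult.assoc)
  qed
  moreover have "\<rho> * exp \<bar>Re z\<bar> < 1"
  proof -
    have "\<rho> * exp \<bar>Re z\<bar> < \<rho> * exp (- ln \<rho>)" using \<rho> assms by simp
    also have "\<dots> = 1" using \<rho> by (simp add: exp_minus)
    finally show ?thesis .
  qed
  ultimately show ?thesis using \<rho> by (auto simp: geom_bounded_def)
qed

lemma expsum_abs_summable:
  assumes "geom_bounded \<rho> c" and "\<bar>Re z\<bar> < - ln \<rho>"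
  shows "(\<lambda>d. norm (c d * exp (of_int d * z))) summable_on UNIV"
  by (rule geom_bounded_abs_summable[OF geom_bounded_exp[OF assms]])

lemma expsum_has_sum:
  assumes "geom_bounded \<rho> c" and "\<bar>Re z\<bar> < - ln \<rho>"
  shows "((\<lambda>d. c d * exp (of_int d * z)) has_sum expsum c z) UNIV"
  unfolding expsum_def
  by (rule has_sum_infsum[OF abs_summable_summable[OF expsum_abs_summable[OF assms]]])

text \<open>Each exponential is expanded and the sums over d and i are exchanged. The pairs (d, i)
  are absolutely summable for |z| < - ln \<open>\<rho>\<close>, since the sum of |d z|^i / i! over i
  is exp (|d| |z|).\<close>

lemma expsum_has_fps_expansion:
  assumes c: "geom_bounded \<rho> c"
  shows "expsum c has_fps_expansion Abs_fps (\<lambda>i. (\<Sum>\<^sub>\<infinity>d. c d * of_int d ^ i) / fact i)"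
proof (rule has_fps_expansionI)
  have \<rho>: "0 < \<rho>" "\<rho> < 1" using c by (auto simp: geom_bounded_def)
  have *: "(\<lambda>i. (\<Sum>\<^sub>\<infinity>d. c d * of_int d ^ i) / fact i * z ^ i) sums expsum c z"
    if z: "norm z < - ln \<rho>" for z
  proof -
    define f where "f = (\<lambda>(d::int, i::nat). c d * (of_int d * z) ^ i / fact i)"
    have exp_sum: "((\<lambda>i. x ^ i / fact i) has_sum exp x) UNIV" for x :: real
    proof -
      have "(\<lambda>i. x ^ i / fact i) sums exp x" using exp_converges[of x] by (simp add: field_simps scaleR_conv_of_real)
      moreover have "summable (\<lambda>i. norm (x ^ i / fact i))"
        using summable_norm_exp[of x] by (simp add: field_simps scaleR_conv_of_real)
      ultimately show ?thesis by (rule norm_summable_imp_has_sum[rotated])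
    qed
    have exp_csum: "((\<lambda>i. x ^ i / fact i) has_sum exp x) UNIV" for x :: complex
    proof -
      have "(\<lambda>i. x ^ i / fact i) sums exp x" using exp_converges[of x] by (simp add: field_simps scaleR_conv_of_real)
      moreover have "summable (\<lambda>i. norm (x ^ i / fact i))"
        using summable_norm_exp[of x] by (simp add: field_simps scaleR_conv_of_real norm_mult norm_divide norm_power)
      ultimately show ?thesis by (rule norm_summable_imp_has_sum[rotated])
    qed
    have "(\<lambda>x. norm (f x)) summable_on UNIV \<times> UNIV"
    proof (rule summable_on_SigmaI)
      show "((\<lambda>i. norm (f (d, i))) has_sum norm (c d) * exp (\<bar>of_int d\<bar> * norm z)) UNIV" for d
        using has_sum_cmult_right[OF exp_sum[of "\<bar>of_int d\<bar> * norm z"], of "norm (c d)"]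
        by (simp add: f_def norm_mult norm_power norm_divide)
      \<comment> \<open>The exponent is |d| |z|, written with \<open>sgn\<close> so that the family
        is again of the form handled by \<open>geom_bounded_abs_summable\<close>, now with rate
        \<open>\<rho> * exp (norm z)\<close>.\<close>
      have "(\<lambda>d. norm (c d * exp (of_int (sgn d) * of_int d * of_real (norm z)))) summable_on UNIV"
      proof -
        obtain C where C: "\<And>d. norm (c d) \<le> C * \<rho> ^ nat \<bar>d\<bar>" using c by (auto simp: geom_bounded_def)
        have "(\<lambda>d. norm (c d * exp (of_int (sgn d) * of_int d * of_real (norm z)))) summable_on UNIV"
        proof (rule geom_bounded_abs_summable)
          have 1: "geom_bounded (\<rho> * exp (norm z)) (\<lambda>d. of_real (norm (c d)) * exp (of_int d * of_real (norm z)))"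
            using geom_bounded_exp[of \<rho> "\<lambda>d. of_real (norm (c d))" "of_real (norm z)"] c z
            by (auto simp: geom_bounded_def)
          have "norm (c d * exp (of_int (sgn d) * of_int d * of_real (norm z))) \<le> C * (\<rho> * exp (norm z)) ^ nat \<bar>d\<bar>" for d
          proof -
            have "norm (exp (of_int (sgn d) * of_int d * of_real (norm z) :: complex)) = exp (norm z) ^ nat \<bar>d\<bar>"
              by (simp add: norm_exp_eq_Re exp_of_nat_mult[symmetric] sgn_if)
            thus ?thesis using C[of d] by (simp add: norm_mult power_mult_distrib mult_right_mono mult.assoc[symmetric])
          qed
          thus "geom_bounded (\<rho> * exp (norm z)) (\<lambda>d. c d * exp (of_int (sgn d) * of_int d * of_real (norm z)))"
            using 1 by (auto simp: geom_bounded_def)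
        qed
        thus ?thesis .
      qed
      also have "(\<lambda>d. norm (c d * exp (of_int (sgn d) * of_int d * of_real (norm z)))) = 
                 (\<lambda>d. norm (c d) * exp (\<bar>of_int d\<bar> * norm z))"
        by (auto simp: fun_eq_iff norm_mult norm_exp_eq_Re sgn_if abs_if)
      finally show "(\<lambda>d. norm (c d) * exp (\<bar>of_int d\<bar> * norm z)) summable_on UNIV" .
    qed auto
    hence summ: "f summable_on UNIV \<times> UNIV" by (rule abs_summable_summable)
    have inner: "((\<lambda>i. f (d, i)) has_sum c d * exp (of_int d * z)) UNIV" for d
      using has_sum_cmult_right[OF exp_csum[of "of_int d * z"], of "c d"] by (simp add: f_def)
    have "((\<lambda>d. c d * exp (of_int d * z)) has_sum expsum c z) UNIV"
      by (rule expsum_has_sum[OF c]) (use z abs_Re_le_cmod[of z] in linarith)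
    from has_sum_SigmaI[OF inner this summ] have tot: "(f has_sum expsum c z) (UNIV \<times> UNIV)" .
    hence tot': "((\<lambda>(i, d). f (d, i)) has_sum expsum c z) (UNIV \<times> UNIV)"
      by (subst (asm) has_sum_swap)
    have "((\<lambda>i. \<Sum>\<^sub>\<infinity>d. f (d, i)) has_sum expsum c z) UNIV"
    proof (rule has_sum_SigmaD[OF tot'])
      show "((\<lambda>d. case (i, d) of (i, d) \<Rightarrow> f (d, i)) has_sum (\<Sum>\<^sub>\<infinity>d. f (d, i))) UNIV" for i
        using summable_on_SigmaD1[of "\<lambda>i d. f (d, i)" UNIV "\<lambda>_. UNIV" i] has_sum_imp_summable[OF tot']
        by simp
    qed
    also have "(\<lambda>i. \<Sum>\<^sub>\<infinity>d. f (d, i)) = (\<lambda>i. (\<Sum>\<^sub>\<infinity>d. c d * of_int d ^ i) / fact i * z ^ i)"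
    proof
      fix i
      have "(\<Sum>\<^sub>\<infinity>d. f (d, i)) = (\<Sum>\<^sub>\<infinity>d. (z ^ i / fact i) * (c d * of_int d ^ i))"
        by (intro infsum_cong) (auto simp: f_def power_mult_distrib)
      also have "\<dots> = (z ^ i / fact i) * (\<Sum>\<^sub>\<infinity>d. c d * of_int d ^ i)"
        by (rule infsum_cmult_right')
      finally show "(\<Sum>\<^sub>\<infinity>d. f (d, i)) = (\<Sum>\<^sub>\<infinity>d. c d * of_int d ^ i) / fact i * z ^ i"
        by simp
    qed
    finally show ?thesis by (rule has_sum_imp_sums)
  qed
  have "eventually (\<lambda>z::complex. z \<in> ball 0 (- ln \<rho>)) (nhds 0)"
    using \<rho> by (intro eventually_nhds_in_open) auto
  thus "\<forall>\<^sub>F u in nhds 0. (\<lambda>n. fps_nth (Abs_fps (\<lambda>i. (\<Sum>\<^sub>\<infinity>d. c d * of_int d ^ i) / fact i)) n * u ^ n) sums expsum c u"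
    by eventually_elim (use * in auto)
qed

text \<open>The expansion at 0 serves at every point of the strip: recentring at z replaces c d by c
  d exp (d z), which is again geometrically bounded.\<close>

lemma expsum_analytic:
  assumes c: "geom_bounded \<rho> c" and z: "\<bar>Re z\<bar> < - ln \<rho>"
  shows "expsum c analytic_on {z}"
proof -
  have "expsum (\<lambda>d. c d * exp (of_int d * z)) analytic_on {0}"
    by (rule has_fps_expansion_imp_analytic_0[OF expsum_has_fps_expansion[OF geom_bounded_exp[OF assms]]])
  hence "expsum (\<lambda>d. c d * exp (of_int d * z)) \<circ> (\<lambda>w. w - z) analytic_on {z}"
    by (intro analytic_on_compose) (auto intro!: analytic_intros)
  also have "expsum (\<lambda>d. c d * exp (of_int d * z)) \<circ> (\<lambda>w. w - z) = expsum c"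
  proof
    fix w
    have "exp (of_int d * z) * exp (of_int d * (w - z)) = exp (of_int d * w)" for d
      by (simp add: exp_add[symmetric] algebra_simps)
    thus "(expsum (\<lambda>d. c d * exp (of_int d * z)) \<circ> (\<lambda>w. w - z)) w = expsum c w"
      by (simp add: expsum_def mult.assoc)
  qed
  finally show ?thesis .
qed

section \<open>The Kronecker series $F_a$\<close>

definition res_ind :: "nat \<Rightarrow> int \<Rightarrow> int \<Rightarrow> complex" where
  "res_ind l a d = of_bool ([d = a] (mod int l))"

text \<open>\<open>\<phi>(d) = \<nu>(d) + half_step(d)\<close>, where \<open>\<nu>\<close> decays on both sides and \<open>half_step\<close> sums to the rational function \<open>Rfun\<close> of \<open>e\<^sup>z\<close>.\<close>
definition nu :: "complex \<Rightarrow> int \<Rightarrow> complex" where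
  "nu q d = (if d = 0 then 0 else if d > 0 then q powi d / (1 - q powi d) else 1 / (1 - q powi d))"

text \<open>With the value 1/2 at 0, the relation phi(d) + phi(-d) = 1 holds for all d; this
  symmetry is behind the parity in \<open>Kfps_uminus\<close>.\<close>

definition phi :: "complex \<Rightarrow> int \<Rightarrow> complex" where
  "phi q d = (if d = 0 then 1 / 2 else 1 / (1 - q powi d))"

text \<open>The value at 0 is chosen such that \<open>3 \<psi>(0) = \<phi>(0)\<^sup>2\<close>, as needed at \<open>d = e = 0\<close> in \<open>phi_three_term\<close>.\<close>
definition psi :: "complex \<Rightarrow> int \<Rightarrow> complex" where
  "psi q d = (if d = 0 then 1 / 12 else phi q d * phi q (- d))"

definition half_step :: "int \<Rightarrow> complex" where
  "half_step d = (if d > 0 then 1 else if d = 0 then 1 / 2 else 0)"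

text \<open>For Re z < 0 the quotient is the geometric series over the d >= 0 congruent to a,
  starting at \<open>a mod int l\<close>; the last term lowers the weight of d = 0 from 1 to
  1/2.\<close>

definition Rfun :: "nat \<Rightarrow> int \<Rightarrow> complex \<Rightarrow> complex" where
  "Rfun l a z = - exp (of_int (a mod int l) * z) / (exp (of_nat l * z) - 1) - of_bool (int l dvd a) / 2"

definition Ffun :: "nat \<Rightarrow> complex \<Rightarrow> int \<Rightarrow> complex \<Rightarrow> complex" where
  "Ffun l q a z = Rfun l a z + expsum (\<lambda>d. res_ind l a d * nu q d) z"

definition Pfun :: "nat \<Rightarrow> complex \<Rightarrow> int \<Rightarrow> complex \<Rightarrow> complex" where
  "Pfun l q a = expsum (\<lambda>d. res_ind l a d * psi q d)"

section \<open>Size of the coefficients nu and psi\<close>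

lemma norm_res_ind_le: "norm (res_ind l a d) \<le> 1"
  by (auto simp: res_ind_def)

lemma powi_neq_1:
  fixes q :: complex
  assumes "0 < norm q" "norm q < 1" "d \<noteq> 0"
  shows "q powi d \<noteq> 1"
proof
  assume "q powi d = 1"
  hence "norm q powi d = 1" by (metis norm_one norm_power_int)
  moreover have "norm q powi d < 1" if "d > 0"
    using that assms by (simp add: power_int_def power_less_one_iff)
  moreover have "norm q powi d > 1" if "d < 0"
    using that assms by (simp add: power_int_def one_less_inverse_iff power_less_one_iff power_inverse field_simps)
  ultimately show False using assms(3) by linarith
qed

lemma one_minus_norm_le_norm:
  fixes q :: complex
  assumes "norm q < 1" "n > 0"
  shows "1 - norm q \<le> norm (1 - q ^ n)"
proof -
  have "norm q ^ n \<le> norm q ^ 1" using assms by (intro power_decreasing) auto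
  moreover have "1 - norm (q ^ n) \<le> norm (1 - q ^ n)" by (metis norm_one norm_triangle_ineq2)
  ultimately show ?thesis by (simp add: norm_power)
qed

lemma phi_uminus:
  assumes "0 < norm q" "norm q < 1" "d \<noteq> 0"
  shows "phi q (- d) = 1 - phi q d"
  using powi_neq_1[OF assms] assms by (auto simp: phi_def power_int_minus field_simps)

lemma norm_nu_le:
  assumes "0 < norm q" "norm q < 1"
  shows "norm (nu q d) \<le> 1 / (1 - norm q) * norm q ^ nat \<bar>d\<bar>"
proof (cases d "0 :: int" rule: linorder_cases)
  case greater
  have "norm (nu q d) = norm q ^ nat d / norm (1 - q ^ nat d)"
    using greater by (simp add: nu_def norm_divide norm_power power_int_def)
  also have "\<dots> \<le> norm q ^ nat d / (1 - norm q)"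
    using one_minus_norm_le_norm[of q "nat d"] greater assms by (intro divide_left_mono mult_pos_pos) auto
  finally show ?thesis using greater by simp
next
  case less
  have "q ^ nat (- d) \<noteq> 1" using powi_neq_1[of q "-d"] less assms by (simp add: power_int_def)
  hence "nu q d = - (q ^ nat (- d)) / (1 - q ^ nat (- d))"
    using less assms by (auto simp: nu_def power_int_def power_inverse field_simps)
  hence "norm (nu q d) = norm q ^ nat (- d) / norm (1 - q ^ nat (- d))"
    by (simp add: norm_divide norm_power)
  also have "\<dots> \<le> norm q ^ nat (- d) / (1 - norm q)"
    using one_minus_norm_le_norm[of q "nat (- d)"] less assms by (intro divide_left_mono mult_pos_pos) auto
  finally show ?thesis using less by simp
qed (use assms in \<open>auto simp: nu_def\<close>)

text \<open>Since phi(-d) = 1 - phi(d), this is phi (1 - phi). Up to sign it is the sum of m x^m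
  with x = q^|d|, and the factor m is the one that differentiation in \<open>\<tau>\<close>
  produces. In particular \<open>psi\<close> is even.\<close>

lemma psi_eq:
  assumes "0 < norm q" "norm q < 1" "d \<noteq> 0"
  shows "psi q d = - (q ^ nat \<bar>d\<bar>) / (1 - q ^ nat \<bar>d\<bar>) ^ 2"
proof -
  have *: "q ^ nat \<bar>d\<bar> \<noteq> 1" using powi_neq_1[of q "\<bar>d\<bar>"] assms by (simp add: power_int_def)
  have "psi q d = phi q \<bar>d\<bar> * phi q (- \<bar>d\<bar>)"
    using assms by (auto simp: psi_def abs_if)
  also have "\<dots> = phi q \<bar>d\<bar> * (1 - phi q \<bar>d\<bar>)"
    using phi_uminus[of q "\<bar>d\<bar>"] assms by simp
  also have "\<dots> = - (q ^ nat \<bar>d\<bar>) / (1 - q ^ nat \<bar>d\<bar>) ^ 2"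
    using * assms by (simp add: phi_def power_int_def power2_eq_square field_simps)
  finally show ?thesis .
qed

lemma norm_psi_le:
  assumes "0 < norm q" "norm q < 1"
  shows "norm (psi q d) \<le> 1 / (1 - norm q)\<^sup>2 * norm q ^ nat \<bar>d\<bar>"
proof (cases "d = 0")
  case True
  have "(1 - norm q)\<^sup>2 \<le> 1" using assms by (intro power_le_one) auto
  hence "1 \<le> 1 / (1 - norm q)\<^sup>2" using assms by simp
  thus ?thesis using True by (simp add: psi_def del: le_divide_eq_1)
next
  case False
  have "norm (psi q d) = norm q ^ nat \<bar>d\<bar> / (norm (1 - q ^ nat \<bar>d\<bar>)) ^ 2"
    using psi_eq[OF assms False] by (simp add: norm_divide norm_power)
  also have "\<dots> \<le> norm q ^ nat \<bar>d\<bar> / (1 - norm q)\<^sup>2"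
    using one_minus_norm_le_norm[of q "nat \<bar>d\<bar>"] False assms
    by (intro divide_left_mono mult_pos_pos power_mono) auto
  finally show ?thesis by simp
qed

lemma geom_boundedI:
  assumes "0 < \<rho>" "\<rho> < 1" "\<And>d. norm (c d) \<le> C * \<rho> ^ nat \<bar>d\<bar>"
  shows "geom_bounded \<rho> (\<lambda>d. res_ind l a d * c d)"
proof -
  have "norm (res_ind l a d * c d) \<le> C * \<rho> ^ nat \<bar>d\<bar>" for d
    unfolding norm_mult using mult_mono[OF norm_res_ind_le[of l a d] assms(3)[of d]] by auto
  thus ?thesis using assms by (auto simp: geom_bounded_def)
qed

lemma geom_bounded_nu:
  assumes "0 < norm q" "norm q < 1"
  shows "geom_bounded (norm q) (\<lambda>d. res_ind l a d * nu q d)"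
  by (rule geom_boundedI[OF assms norm_nu_le[OF assms]])

lemma geom_bounded_psi:
  assumes "0 < norm q" "norm q < 1"
  shows "geom_bounded (norm q) (\<lambda>d. res_ind l a d * psi q d)"
  by (rule geom_boundedI[OF assms norm_psi_le[OF assms]])

lemma Rfun_has_sum_neg:
  assumes l: "l > 0" and z: "Re z < 0"
  shows "((\<lambda>d. res_ind l a d * half_step d * exp (of_int d * z)) has_sum Rfun l a z) UNIV"
proof -
  define a' where "a' = a mod int l"
  have a': "0 \<le> a'" "a' < int l" using l by (auto simp: a'_def)
  have "norm (exp (of_nat l * z)) < 1" using l z by (simp add: norm_exp_eq_Re mult_pos_neg)
  note geo = this
  have "((\<lambda>i. exp (of_nat l * z) ^ i) has_sum (1 / (1 - exp (of_nat l * z)))) UNIV"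
    using geo by (intro norm_summable_imp_has_sum geometric_sums) (auto simp: norm_power intro!: summable_geometric)
  from has_sum_cmult_right[OF this, of "exp (of_int a' * z)"]
  have 1: "((\<lambda>i. exp (of_int (a' + int l * int i) * z)) has_sum 
              (exp (of_int a' * z) / (1 - exp (of_nat l * z)))) (UNIV::nat set)"
    by (simp add: exp_of_nat_mult[symmetric] exp_add[symmetric] algebra_simps)
  have *: "\<exists>n. d = a' + int l * int n" if "d \<ge> 0" "[d = a] (mod int l)" for d
  proof -
    have "d mod int l = a'" using that by (simp add: cong_def a'_def)
    hence "d = a' + int l * int (nat (d div int l))"
      using that l by (metis div_mult_mod_eq add.commute mult.commute nat_0_le pos_imp_zdiv_nonneg_iff of_nat_0_less_iff)
    thus ?thesis by blast
  qed
  have "((\<lambda>d. exp (of_int d * z)) has_sum 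
              (exp (of_int a' * z) / (1 - exp (of_nat l * z)))) ((\<lambda>i. a' + int l * int i) ` UNIV)"
    using 1 l by (subst has_sum_reindex) (auto simp: o_def inj_on_def)
  also have "range (\<lambda>i. a' + int l * int i) = {d. d \<ge> 0 \<and> [d = a] (mod int l)}"
    using * a' by (auto simp: a'_def cong_def)
  finally have 2: "((\<lambda>d. exp (of_int d * z)) has_sum 
              (exp (of_int a' * z) / (1 - exp (of_nat l * z)))) {d. d \<ge> 0 \<and> [d = a] (mod int l)}" .
  have 3: "((\<lambda>d. res_ind l a d * of_bool (d \<ge> 0) * exp (of_int d * z)) has_sum 
              (exp (of_int a' * z) / (1 - exp (of_nat l * z)))) UNIV"
    using 2 by (subst has_sum_cong_neutral[where T = "{d. d \<ge> 0 \<and> [d = a] (mod int l)}"]) (auto simp: res_ind_def)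
  have "((\<lambda>d. - res_ind l a d * of_bool (d = 0) / 2) has_sum (- of_bool (int l dvd a) / 2)) UNIV"
    by (rule has_sum_finite_neutralI[of "{0}"])
       (auto simp: res_ind_def cong_def dvd_eq_mod_eq_0)
  from has_sum_add[OF 3 this]
  have "((\<lambda>d. res_ind l a d * of_bool (d \<ge> 0) * exp (of_int d * z) + (- res_ind l a d * of_bool (d = 0) / 2)) has_sum
     (exp (of_int a' * z) / (1 - exp (of_nat l * z)) + (- of_bool (int l dvd a) / 2))) UNIV" .
  also have "(\<lambda>d. res_ind l a d * of_bool (d \<ge> 0) * exp (of_int d * z) + (- res_ind l a d * of_bool (d = 0) / 2)) =
             (\<lambda>d. res_ind l a d * half_step d * exp (of_int d * z))"
    by (auto simp: fun_eq_iff half_step_def)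
  also have "exp (of_int a' * z) / (1 - exp (of_nat l * z)) + (- of_bool (int l dvd a) / 2) = Rfun l a z"
    using minus_divide_right[of "exp (of_int a' * z)" "exp (of_nat l * z) - 1"]
    by (simp add: Rfun_def a'_def)
  finally show ?thesis .
qed

text \<open>If l divides a, subtracting 1/2 is what makes the quotient odd. Otherwise the residue of
  -a is l minus that of a, and the extra factor exp (l z) is absorbed by the denominator.\<close>

lemma Rfun_uminus:
  assumes l: "l > 0" and z: "exp (of_nat l * z) \<noteq> 1"
  shows "Rfun l (- a) (- z) = - Rfun l a z"
proof (cases "int l dvd a")
  case True
  thus ?thesis using z
    by (simp add: Rfun_def exp_minus field_simps dvd_eq_mod_eq_0 zmod_zminus1_eq_if)
next
  case False
  hence "(- a) mod int l = int l - a mod int l" using l by (simp add: zmod_zminus1_eq_if dvd_eq_mod_eq_0)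
  hence "of_int ((- a) mod int l) = (of_nat l - of_int (a mod int l) :: complex)"
    by (simp only: of_int_diff of_int_of_nat_eq)
  hence *: "exp (of_int ((- a) mod int l) * (- z)) = exp (of_int (a mod int l) * z) / exp (of_nat l * z)"
    by (simp only: exp_diff[symmetric]) (simp add: algebra_simps)
  show ?thesis unfolding Rfun_def * using z False
    by (simp add: exp_minus field_simps)
qed

text \<open>The expansion on the other side of the imaginary axis follows by d -> -d and oddness of
  \<open>Rfun\<close>, because half_step(-d) = 1 - half_step(d).\<close>

lemma Rfun_has_sum_pos:
  assumes l: "l > 0" and z: "Re z > 0"
  shows "((\<lambda>d. res_ind l a d * (half_step d - 1) * exp (of_int d * z)) has_sum Rfun l a z) UNIV"
proof -
  have "exp (of_nat l * z) \<noteq> 1"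
  proof
    assume "exp (of_nat l * z) = 1"
    hence "norm (exp (of_nat l * z)) = 1" by simp
    thus False using l z by (simp add: norm_exp_eq_Re)
  qed
  hence R: "Rfun l a z = - Rfun l (- a) (- z)" using Rfun_uminus[OF l, of z a] by simp
  have "((\<lambda>d. res_ind l (- a) d * half_step d * exp (of_int d * (- z))) has_sum Rfun l (- a) (- z)) UNIV"
    by (rule Rfun_has_sum_neg) (use l z in auto)
  also have "?this \<longleftrightarrow> ((\<lambda>d. res_ind l (- a) (- d) * half_step (- d) * exp (of_int d * z)) has_sum Rfun l (- a) (- z)) UNIV"
    by (rule has_sum_reindex_bij_witness[of _ uminus uminus]) auto
  finally have "((\<lambda>d. - (res_ind l (- a) (- d) * half_step (- d) * exp (of_int d * z))) has_sum - Rfun l (- a) (- z)) UNIV"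
    by (subst has_sum_uminus) simp
  also have "(\<lambda>d. - (res_ind l (- a) (- d) * half_step (- d) * exp (of_int d * z))) = 
             (\<lambda>d. res_ind l a d * (half_step d - 1) * exp (of_int d * z))"
    by (auto simp: fun_eq_iff res_ind_def half_step_def cong_minus_minus_iff)
  finally show ?thesis by (simp only: R)
qed

lemma phi_eq_nu_half_step:
  "phi q d = nu q d + half_step d" if "0 < norm q" "norm q < 1"
  using powi_neq_1[OF that, of d] by (auto simp: phi_def nu_def half_step_def field_simps)

lemma Ffun_has_sum:
  assumes l: "l > 0" and q: "0 < norm q" "norm q < 1" and z: "ln (norm q) < Re z" "Re z < 0"
  shows "((\<lambda>d. res_ind l a d * phi q d * exp (of_int d * z)) has_sum Ffun l q a z) UNIV"
proof -
  have "((\<lambda>d. res_ind l a d * half_step d * exp (of_int d * z) + (res_ind l a d * nu q d) * exp (of_int d * z)) 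
          has_sum Ffun l q a z) UNIV"
    unfolding Ffun_def
    by (intro has_sum_add Rfun_has_sum_neg expsum_has_sum[OF geom_bounded_nu] assms) (use z in auto)
  thus ?thesis by (simp add: phi_eq_nu_half_step[OF q] algebra_simps)
qed

text \<open>For d ~= 0 one has phi(d) q^d = phi(d) - 1, so the expansion valid for Re z > 0 agrees
  term by term with the left-hand expansion taken at z + w. At d = 0 the terms are -1/2 and 1/2,
  hence the jump by 1 when l divides a.\<close>

lemma Ffun_shift:
  assumes l: "l > 0" and q: "exp w = q" "norm q < 1" and z: "0 < Re z" "Re z < - ln (norm q)"
  shows "Ffun l q a (z + w) = Ffun l q a z + of_bool (int l dvd a)"
proof -
  have q0: "0 < norm q" using q by auto
  have Rew: "Re w = ln (norm q)" using q by (auto simp: norm_exp_eq_Re)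
  have w: "exp (of_int d * w) = q powi d" for d
    using q by (metis exp_power_int mult.commute)
  have 1: "((\<lambda>d. res_ind l a d * phi q d * exp (of_int d * (z + w))) has_sum Ffun l q a (z + w)) UNIV"
    by (intro Ffun_has_sum l q0 q) (use z Rew in auto)
  have 2: "((\<lambda>d. res_ind l a d * (half_step d - 1) * exp (of_int d * z) + (res_ind l a d * nu q d) * exp (of_int d * z)) 
          has_sum Ffun l q a z) UNIV"
    unfolding Ffun_def
    by (intro has_sum_add Rfun_has_sum_pos expsum_has_sum[OF geom_bounded_nu] l q0 q z) (use z in auto)
  have 3: "((\<lambda>d. res_ind l a d * of_bool (d = 0)) has_sum (of_bool (int l dvd a))) UNIV"
    by (rule has_sum_finite_neutralI[of "{0}"])
       (auto simp: res_ind_def cong_def dvd_eq_mod_eq_0)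
  have "res_ind l a d * (half_step d - 1) * exp (of_int d * z) + (res_ind l a d * nu q d) * exp (of_int d * z) + 
          res_ind l a d * of_bool (d = 0) = res_ind l a d * phi q d * exp (of_int d * (z + w))" for d
  proof (cases "d = 0")
    case False
    have "phi q d * q powi d = phi q d - 1"
      using powi_neq_1[OF q0 q(2) False] False by (simp add: phi_def field_simps)
    moreover have "exp (of_int d * (z + w)) = q powi d * exp (of_int d * z)"
      using w[of d] by (simp add: exp_add distrib_left)
    ultimately have "phi q d * exp (of_int d * (z + w)) = (phi q d - 1) * exp (of_int d * z)"
      by simp
    hence "res_ind l a d * phi q d * exp (of_int d * (z + w)) = res_ind l a d * ((phi q d - 1) * exp (of_int d * z))"
      by (simp only: mult.assoc)
    thus ?thesis using False by (simp add: phi_eq_nu_half_step[OF q0 q(2)] algebra_simps)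
  qed (auto simp: half_step_def phi_def nu_def)
  with has_sum_add[OF 2 3] have "((\<lambda>d. res_ind l a d * phi q d * exp (of_int d * (z + w))) has_sum 
       (Ffun l q a z + of_bool (int l dvd a))) UNIV" by simp
  with 1 show ?thesis by (rule has_sum_unique)
qed

text \<open>All exponents are congruent to a modulo l, so a shift by 2 pi i n / l multiplies every
  term by the same root of unity. The added constant isolates the exponential quotient inside
  \<open>Rfun\<close>.\<close>

lemma Rfun_period:
  assumes l: "l > 0"
  shows "Rfun l a (z + 2 * of_real pi * \<i> * of_int n / of_nat l) + of_bool (int l dvd a) / 2 = 
     exp (2 * of_real pi * \<i> * of_int (a * n) / of_nat l) * (Rfun l a z + of_bool (int l dvd a) / 2)"
proof -
  have "exp (of_nat l * (z + 2 * of_real pi * \<i> * of_int n / of_nat l)) = exp (of_nat l * z)"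
  proof -
    have "of_nat l * (z + 2 * of_real pi * \<i> * of_int n / of_nat l) = of_nat l * z + of_int n * (2 * of_real pi * \<i>)"
      using l by (simp add: field_simps)
    thus ?thesis using exp_integer_2pi[of "of_int n"] by (simp add: exp_add mult_ac)
  qed
  moreover have "exp (of_int (a mod int l) * (z + 2 * of_real pi * \<i> * of_int n / of_nat l)) =
        exp (2 * of_real pi * \<i> * of_int (a * n) / of_nat l) * exp (of_int (a mod int l) * z)"
  proof -
    have a: "(of_int a :: complex) = of_int (a mod int l) + of_nat l * of_int (a div int l)"
      by (metis mod_mult_div_eq of_int_add of_int_mult of_int_of_nat_eq)
    have "2 * of_real pi * \<i> * of_int (a * n) / of_nat l = 
       of_int (a mod int l) * (2 * of_real pi * \<i> * of_int n / of_nat l) + of_int (a div int l * n) * (2 * of_real pi * \<i>)"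
      unfolding of_int_mult[of a n] by (subst a) (use l in \<open>simp add: field_simps\<close>)
    thus ?thesis using exp_integer_2pi[of "of_int (a div int l * n)"] 
      by (simp add: exp_add distrib_left mult_ac)
  qed
  ultimately show ?thesis by (simp add: Rfun_def)
qed

lemma Ffun_period:
  assumes l: "l > 0"
  shows "Ffun l q a (z + 2 * of_real pi * \<i> * of_int n / of_nat l) + of_bool (int l dvd a) / 2 = 
     exp (2 * of_real pi * \<i> * of_int (a * n) / of_nat l) * (Ffun l q a z + of_bool (int l dvd a) / 2)"
proof -
  let ?e = "exp (2 * of_real pi * \<i> * of_int (a * n) / of_nat l)"
  have *: "res_ind l a d * nu q d * exp (of_int d * (z + 2 * of_real pi * \<i> * of_int n / of_nat l)) =
          ?e * (res_ind l a d * nu q d * exp (of_int d * z))" for d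
  proof (cases "[d = a] (mod int l)")
    case True
    then obtain k where k: "d = a + int l * k" by (metis cong_iff_lin cong_sym)
    have "of_int d * (z + 2 * of_real pi * \<i> * of_int n / of_nat l) = 
        of_int d * z + 2 * of_real pi * \<i> * of_int (a * n) / of_nat l + of_int (k * n) * (2 * of_real pi * \<i>)"
      unfolding k using l by (simp add: field_simps)
    thus ?thesis using exp_integer_2pi[of "of_int (k * n)"]
      by (simp add: exp_add mult_ac)
  qed (auto simp: res_ind_def)
  have "expsum (\<lambda>d. res_ind l a d * nu q d) (z + 2 * of_real pi * \<i> * of_int n / of_nat l) = 
     ?e * expsum (\<lambda>d. res_ind l a d * nu q d) z"
    unfolding expsum_def * by (rule infsum_cmult_right')
  thus ?thesis using Rfun_period[OF l, of a z n] by (simp add: Ffun_def algebra_simps)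
qed

section \<open>Taylor expansions at the origin\<close>

text \<open>The expansion of \<open>Rfun l a z + 1 / (l z)\<close>, where the numerator and the denominator are both divided by \<open>z\<close>.\<close>
definition Gfps :: "nat \<Rightarrow> int \<Rightarrow> complex fps" where
  "Gfps l a = fps_shift 1 (fps_const (1 / of_nat l) * fps_shift 1 (fps_exp (of_nat l) - 1) - fps_exp (of_int (a mod int l)))
       * inverse (fps_shift 1 (fps_exp (of_nat l) - 1)) - fps_const (of_bool (int l dvd a) / 2)"

definition Kfps :: "nat \<Rightarrow> complex \<Rightarrow> int \<Rightarrow> complex fps" where
  "Kfps l q a = Gfps l a + Abs_fps (\<lambda>i. (\<Sum>\<^sub>\<infinity>d. res_ind l a d * nu q d * of_int d ^ i) / fact i)"

definition Pfps :: "nat \<Rightarrow> complex \<Rightarrow> int \<Rightarrow> complex fps" where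
  "Pfps l q a = Abs_fps (\<lambda>i. (\<Sum>\<^sub>\<infinity>d. res_ind l a d * psi q d * of_int d ^ i) / fact i)"

lemma has_fps_expansion_shift_1:
  fixes f :: "complex \<Rightarrow> complex"
  assumes f: "f has_fps_expansion F" and F: "fps_nth F 0 = 0"
  shows "(\<lambda>z. if z = 0 then fps_nth F 1 else f z / z) has_fps_expansion fps_shift 1 F"
\<comment> \<open>The zero series has subdegree 0 by convention, so the subdegree bound needed for
  dividing by z fails for it.\<close>
proof (cases "F = 0")
  case True
  hence "f has_fps_expansion 0" using f by simp
  hence "eventually (\<lambda>z. f z = 0) (nhds 0)" by (auto simp: has_fps_expansion_def)
  hence "eventually (\<lambda>z. (if z = 0 then fps_nth F 1 else f z / z) = 0) (nhds 0)"
    by eventually_elim (use True in auto)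
  thus ?thesis using True by (simp add: has_fps_expansion_0_iff)
next
  case False
  hence "1 \<le> subdegree F" using F
    by (intro subdegree_geI) (auto simp: Suc_le_eq)
  from has_fps_expansion_shift[OF f this refl] show ?thesis by (simp only: power_one_right)
qed

lemma fps_nth_shift_exp_minus_1: "fps_nth (fps_shift 1 (fps_exp (c::complex) - 1)) n = c ^ Suc n / fact (Suc n)"
  by (simp del: fact_Suc)

text \<open>With u = (exp (l z) - 1) / z the pole is removed by 1 / (l z) - exp (a' z) / (exp (l z)
  - 1) = (u / l - exp (a' z)) / (z u): the numerator on the right vanishes at 0 and u(0) = l is
  nonzero.\<close>

lemma Gfps_has_expansion:
  assumes l: "l > 0"
  shows "(\<lambda>z. if z = 0 then fps_nth (Gfps l a) 0 else Rfun l a z + 1 / (of_nat l * z)) has_fps_expansion Gfps l a"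
proof -
  define a' where "a' = (of_int (a mod int l) :: complex)"
  define L where "L = (of_nat l :: complex)"
  have L: "L \<noteq> 0" using l by (simp add: L_def)
  define U where "U = fps_shift 1 (fps_exp L - 1)"
  define u where "u = (\<lambda>z. if z = 0 then L else (exp (L * z) - 1) / z)"
  have u: "u has_fps_expansion U"
  proof -
    have "(\<lambda>z. exp (L * z) - 1) has_fps_expansion (fps_exp L - 1)"
      by (intro fps_expansion_intros)
    moreover have "fps_nth (fps_exp L - 1) 1 = L" "fps_nth (fps_exp L - 1) 0 = 0" by simp_all
    ultimately show ?thesis
      using has_fps_expansion_shift_1[of "\<lambda>z. exp (L * z) - 1" "fps_exp L - 1"] by (simp only: u_def U_def)
  qed
  have U0: "fps_nth U 0 = L" by (simp add: U_def)
  define N where "N = fps_const (1 / L) * U - fps_exp a'"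
  have N0: "fps_nth N 0 = 0" using L by (simp add: N_def U0)
  have n: "(\<lambda>z. 1 / L * u z - exp (a' * z)) has_fps_expansion N"
    unfolding N_def by (intro fps_expansion_intros u)
  define v where "v = (\<lambda>z. if z = 0 then fps_nth N 1 else (1 / L * u z - exp (a' * z)) / z)"
  have v: "v has_fps_expansion fps_shift 1 N"
    unfolding v_def by (rule has_fps_expansion_shift_1[OF n N0])
  define b where "b = (of_bool (int l dvd a) / 2 :: complex)"
  have tot: "(\<lambda>z. v z * inverse (u z) - b) has_fps_expansion (fps_shift 1 N * inverse U - fps_const b)"
    by (intro fps_expansion_intros u v) (use U0 L in auto)
  have G: "Gfps l a = fps_shift 1 N * inverse U - fps_const b"
    by (simp add: Gfps_def N_def U_def L_def a'_def b_def)
  have ev: "eventually (\<lambda>z. u z \<noteq> 0) (nhds 0)"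
  proof -
    have "isCont u 0" using has_fps_expansion_imp_continuous[OF u, of UNIV] by simp
    hence "(u \<longlongrightarrow> u 0) (nhds 0)" by (simp add: isCont_def tendsto_at_iff_tendsto_nhds)
    moreover have "u 0 \<noteq> 0" using L by (simp add: u_def)
    ultimately show ?thesis by (rule tendsto_imp_eventually_ne)
  qed
  have 0: "v 0 * inverse (u 0) - b = fps_nth (Gfps l a) 0"
    using has_fps_expansion_imp_0_eq_fps_nth_0[OF tot] by (simp add: G)
  have "eventually (\<lambda>z. v z * inverse (u z) - b = 
          (if z = 0 then fps_nth (Gfps l a) 0 else Rfun l a z + 1 / (of_nat l * z))) (nhds 0)"
    using ev
  proof eventually_elim
    case (elim z)
    show ?case
    proof (cases "z = 0")
      case False
      have e: "exp (L * z) - 1 \<noteq> 0" using elim False by (auto simp: u_def)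
      have "v z * inverse (u z) = 1 / (L * z) - exp (a' * z) / (exp (L * z) - 1)"
        using False e L by (simp add: v_def u_def field_simps)
      thus ?thesis using False by (simp add: Rfun_def b_def L_def a'_def)
    qed (use 0 in simp)
  qed
  from tot has_fps_expansion_cong[OF this refl] show ?thesis by (simp add: G)
qed

lemma Kfps_has_expansion:
  assumes l: "l > 0" and q: "0 < norm q" "norm q < 1"
  shows "(\<lambda>z. if z = 0 then fps_nth (Kfps l q a) 0 else Ffun l q a z + 1 / (of_nat l * z)) has_fps_expansion Kfps l q a"
proof -
  note e = expsum_has_fps_expansion[OF geom_bounded_nu[OF q, of l a]]
  have *: "(\<lambda>z. (if z = 0 then fps_nth (Gfps l a) 0 else Rfun l a z + 1 / (of_nat l * z)) + 
           expsum (\<lambda>d. res_ind l a d * nu q d) z) has_fps_expansion Kfps l q a"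
    unfolding Kfps_def by (intro fps_expansion_intros Gfps_has_expansion l e)
  have "(\<lambda>z. (if z = 0 then fps_nth (Gfps l a) 0 else Rfun l a z + 1 / (of_nat l * z)) + 
           expsum (\<lambda>d. res_ind l a d * nu q d) z) = 
        (\<lambda>z. if z = 0 then fps_nth (Kfps l q a) 0 else Ffun l q a z + 1 / (of_nat l * z))"
    using has_fps_expansion_imp_0_eq_fps_nth_0[OF *] by (auto simp: Ffun_def fun_eq_iff)
  with * show ?thesis by simp
qed

lemma Pfps_has_expansion:
  assumes q: "0 < norm q" "norm q < 1"
  shows "Pfun l q a has_fps_expansion Pfps l q a"
  unfolding Pfun_def Pfps_def by (rule expsum_has_fps_expansion[OF geom_bounded_psi[OF q]])

text \<open>Degree 0 is lost on differentiating \<open>F\<close>, so the modularity argument does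
  not reach weight 1. These values are the ones prescribed there by \<open>s_const\<close>.\<close>

lemma Gfps_nth_0:
  assumes l: "l > 0"
  shows "fps_nth (Gfps l a) 0 = (if int l dvd a then 0 else 1 / 2 - of_int (a mod int l) / of_nat l)"
proof -
  have "fact 2 = (2 :: complex)" by (simp add: fact_numeral)
  thus ?thesis using l
    by (auto simp: Gfps_def fps_mult_nth_0 fps_nth_shift_exp_minus_1 dvd_eq_mod_eq_0 field_simps power2_eq_square numeral_2_eq_2[symmetric])
qed

text \<open>The quasimodular constant. For l dividing a the series is 1/x - 1/(exp x - 1) - 1/2 at x
  = l z, and its linear coefficient is -B_2 / 2 with B_2 = 1/6.\<close>

lemma Gfps_nth_1:
  assumes l: "l > 0" and "int l dvd a"
  shows "fps_nth (Gfps l a) 1 = - of_nat l / 12"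
proof -
  define L where "L = (of_nat l :: complex)"
  have L: "L \<noteq> 0" using l by (simp add: L_def)
  define U where "U = fps_shift 1 (fps_exp L - 1)"
  define W where "W = fps_shift 1 (fps_const (1 / L) * U - 1)"
  have U: "fps_nth U n = L ^ Suc n / fact (Suc n)" for n by (simp add: U_def del: fact_Suc)
  have G: "Gfps l a = W * inverse U - fps_const (1 / 2)"
    using assms by (simp add: Gfps_def W_def U_def L_def dvd_eq_mod_eq_0)
  \<comment> \<open>Comparing coefficients after multiplying back by \<open>U\<close> avoids
    computing those of an inverse series.\<close>
  have "(Gfps l a + fps_const (1 / 2)) * U = W * (inverse U * U)" by (simp add: G)
  also have "inverse U * U = 1" by (rule inverse_mult_eq_1) (use L U in simp)
  finally have *: "(Gfps l a + fps_const (1 / 2)) * U = W" by simp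
  have f: "fact 3 = (6 :: complex)" "fact 2 = (2 :: complex)" by (simp_all add: fact_numeral)
  have g0: "fps_nth (Gfps l a) 0 = 0" using Gfps_nth_0[OF l] assms by simp
  have "fps_nth ((Gfps l a + fps_const (1 / 2)) * U) 1 = 1 / 2 * (L\<^sup>2 / 2) + fps_nth (Gfps l a) 1 * L"
    using g0 by (simp add: fps_mult_nth U f numeral_2_eq_2[symmetric] power2_eq_square)
  moreover have "fps_nth W 1 = L\<^sup>2 / 6"
    using L by (simp add: W_def U f eval_nat_numeral fps_one_nth)
  ultimately have "1 / 2 * (L\<^sup>2 / 2) + fps_nth (Gfps l a) 1 * L = L\<^sup>2 / 6" using * by simp
  moreover have "(fps_nth (Gfps l a) 1 + L / 12) * L = (1 / 2 * (L\<^sup>2 / 2) + fps_nth (Gfps l a) 1 * L) - L\<^sup>2 / 6"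
    by (simp add: power2_eq_square field_simps)
  ultimately have "(fps_nth (Gfps l a) 1 + L / 12) * L = 0" by (simp only: diff_self)
  thus ?thesis using L by (simp add: L_def eq_neg_iff_add_eq_0)
qed

text \<open>This is K_(-a)(-z) = - K_a(z). For \<open>Gfps\<close> it is derived from the functions
  near 0, for the remaining part from the oddness of \<open>nu\<close>.\<close>

lemma Kfps_uminus:
  assumes l: "l > 0" and q: "0 < norm q" "norm q < 1"
  shows "fps_nth (Kfps l q (- a)) n = (-1) ^ Suc n * fps_nth (Kfps l q a) n"
proof -
  have G: "fps_compose (Gfps l (- a)) (- fps_X) = - Gfps l a"
  proof (rule fps_expansion_unique_complex)
    let ?f = "\<lambda>a z. if z = 0 then fps_nth (Gfps l a) 0 else Rfun l a z + 1 / (of_nat l * z)"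
    have 1: "(?f (- a) \<circ> uminus) has_fps_expansion fps_compose (Gfps l (- a)) (- fps_X)"
      by (intro fps_expansion_intros Gfps_has_expansion[OF l]) auto
    have ev: "eventually (\<lambda>z. (?f (- a) \<circ> uminus) z = - ?f a z) (nhds 0)"
    proof -
      \<comment> \<open>On this ball |l z| < 1 < 2 pi, so exp (l z) = 1 happens only at z =
        0.\<close>
      have "eventually (\<lambda>z::complex. z \<in> ball 0 (1 / l)) (nhds 0)"
        by (rule eventually_nhds_in_open) (use l in auto)
      thus ?thesis
      proof eventually_elim
        case (elim z)
        show ?case
        proof (cases "z = 0")
          case True
          have "fps_nth (Gfps l (- a)) 0 = - fps_nth (Gfps l a) 0"
          proof (cases "int l dvd a")
            case False
            hence "(- a) mod int l = int l - a mod int l" using l by (simp add: zmod_zminus1_eq_if dvd_eq_mod_eq_0)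
            hence "of_int ((- a) mod int l) = (of_nat l - of_int (a mod int l) :: complex)"
              by (simp only: of_int_diff of_int_of_nat_eq)
            hence eq: "(of_int ((- a) mod int l) :: complex) / of_nat l = 1 - of_int (a mod int l) / of_nat l"
              using l by (simp add: diff_divide_distrib)
            have "\<not> int l dvd - a" using False by simp
            thus ?thesis using False eq by (simp add: Gfps_nth_0[OF l])
          qed (use l in \<open>auto simp: Gfps_nth_0\<close>)
          thus ?thesis using True by simp
        next
          case False
          have "exp (of_nat l * z) \<noteq> 1"
          proof
            assume "exp (of_nat l * z) = 1"
            then obtain n :: int where n: "of_nat l * z = of_int (2 * n) * of_real pi * \<i>"
              using exp_eq_1[of "of_nat l * z"] by (auto simp: complex_eq_iff)
            hence "norm (of_nat l * z) = 2 * \<bar>of_int n\<bar> * pi" by (simp add: norm_mult)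
            moreover have "norm (of_nat l * z) < 1" using elim l by (simp add: norm_mult field_simps)
            moreover have "n \<noteq> 0" using n False l by auto
            hence "1 \<le> \<bar>real_of_int n\<bar>" by linarith
            hence "2 * 1 * pi \<le> 2 * \<bar>of_int n\<bar> * pi" by (intro mult_right_mono mult_left_mono) auto
            ultimately show False using pi_gt3 by linarith
          qed
          from Rfun_uminus[OF l this, of a] show ?thesis using False by simp
        qed
      qed
    qed
    show "(\<lambda>z. - ?f a z) has_fps_expansion fps_compose (Gfps l (- a)) (- fps_X)"
      by (rule iffD1[OF has_fps_expansion_cong[OF ev refl] 1])
    show "(\<lambda>z. - ?f a z) has_fps_expansion - Gfps l a"
      by (intro fps_expansion_intros Gfps_has_expansion[OF l])
  qed
  have "fps_nth (fps_compose (Gfps l (- a)) (fps_const (-1) * fps_X)) n = (-1) ^ n * fps_nth (Gfps l (- a)) n"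
    by (simp only: fps_compose_linear fps_nth_Abs_fps)
  also have "fps_const (-1) * fps_X = (- fps_X :: complex fps)"
    by (simp flip: fps_const_neg)
  finally have 1: "fps_nth (Gfps l (- a)) n = (-1) ^ Suc n * fps_nth (Gfps l a) n"
    unfolding G by (auto simp: minus_one_power_iff split: if_splits)
  have "(\<Sum>\<^sub>\<infinity>d. res_ind l (- a) d * nu q d * of_int d ^ n) = (\<Sum>\<^sub>\<infinity>d. (-1) ^ Suc n * (res_ind l a d * nu q d * of_int d ^ n))"
  proof (rule infsum_reindex_bij_witness[of _ uminus uminus])
    fix d :: int
    have "nu q (- d) = - nu q d"
      using powi_neq_1[OF q, of d] q by (auto simp: nu_def power_int_minus field_simps)
    moreover have "res_ind l (- a) (- d) = res_ind l a d" by (auto simp: res_ind_def cong_minus_minus_iff)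
    ultimately show "(-1) ^ Suc n * (res_ind l a (- d) * nu q (- d) * of_int (- d) ^ n) = res_ind l (- a) d * nu q d * of_int d ^ n"
      by (smt (verit, best) res_ind_def cong_minus_minus_iff minus_minus mult_minus_left mult_minus_right of_int_minus power_Suc power_minus mult.assoc mult.left_commute mult_1 power_mult_distrib)
  qed auto
  also have "\<dots> = (-1) ^ Suc n * (\<Sum>\<^sub>\<infinity>d. (res_ind l a d * nu q d * of_int d ^ n))"
    by (rule infsum_cmult_right')
  finally show ?thesis by (simp add: Kfps_def 1 field_simps)
qed

section \<open>Lambert series\<close>

definition nome :: "complex \<Rightarrow> complex" where
  "nome \<tau> = exp (2 * of_real pi * \<i> * \<tau>)"

lemma norm_nome: "norm (nome \<tau>) = exp (- 2 * pi * Im \<tau>)"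
  by (simp add: nome_def norm_exp_eq_Re)

lemma nome_bounds:
  assumes "\<tau> \<in> upper_half"
  shows "0 < norm (nome \<tau>)" "norm (nome \<tau>) < 1"
  using assms by (auto simp: norm_nome upper_half_def)

text \<open>Half of the decay pays for the polynomial: \<open>\<rho>\<close> is the square of
  \<open>\<sigma>\<close>, one power of \<open>\<sigma>\<close> bounds |d|^p and the other remains
  as the new rate.\<close>

lemma geom_bounded_times_power:
  assumes "geom_bounded \<rho> c"
  obtains \<rho>' where "geom_bounded \<rho>' (\<lambda>d. c d * of_int d ^ p)"
proof -
  obtain C where C: "\<And>d. norm (c d) \<le> C * \<rho> ^ nat \<bar>d\<bar>" and \<rho>: "0 < \<rho>" "\<rho> < 1"
    using assms by (auto simp: geom_bounded_def)
  have C0: "C \<ge> 0" using C[of 0] order_trans[OF norm_ge_zero C[of 0]] by simp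
  define \<sigma> where "\<sigma> = sqrt \<rho>"
  have \<sigma>: "0 < \<sigma>" "\<sigma> < 1" "\<rho> = \<sigma> * \<sigma>" using \<rho> by (auto simp: \<sigma>_def)
  have "Bseq (\<lambda>n. real n ^ p * \<sigma> ^ n)"
  proof (cases "p = 0")
    case True
    have "norm (\<sigma> ^ n) \<le> 1" for n using \<sigma> by (simp add: power_le_one)
    thus ?thesis using True by (intro BseqI'[of _ 1]) simp
  next
    case False
    \<comment> \<open>With t^p = \<open>\<sigma>\<close> the sequence n^p \<open>\<sigma>\<close>^n
      is the p-th power of n t^n, which tends to 0.\<close>
    define t where "t = root p \<sigma>"
    have t: "0 < t" "t < 1" "t ^ p = \<sigma>" using False \<sigma> by (auto simp: t_def)
    have "(\<lambda>n. (real n * t ^ n) ^ p) \<longlonglongrightarrow> 0 ^ p"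
      using t by (intro tendsto_power powser_times_n_limit_0) auto
    also have "(\<lambda>n. (real n * t ^ n) ^ p) = (\<lambda>n. real n ^ p * \<sigma> ^ n)"
      by (simp add: t(3)[symmetric] power_mult_distrib power_mult[symmetric] mult.commute)
    finally show ?thesis by (meson convergentI convergent_imp_Bseq)
  qed
  then obtain K where K: "\<And>n. norm (real n ^ p * \<sigma> ^ n) \<le> K" by (auto simp: Bseq_def)
  have "norm (c d * of_int d ^ p) \<le> (C * K) * \<sigma> ^ nat \<bar>d\<bar>" for d
  proof -
    have "norm (c d * of_int d ^ p) \<le> (C * \<rho> ^ nat \<bar>d\<bar>) * real (nat \<bar>d\<bar>) ^ p"
      using C[of d] by (simp add: norm_mult norm_power mult_right_mono)
    also have "\<dots> = C * (real (nat \<bar>d\<bar>) ^ p * \<sigma> ^ nat \<bar>d\<bar>) * \<sigma> ^ nat \<bar>d\<bar>"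
      using \<sigma>(3) by (simp add: power_mult_distrib)
    also have "\<dots> \<le> C * K * \<sigma> ^ nat \<bar>d\<bar>"
      using K[of "nat \<bar>d\<bar>"] C0 \<sigma> by (intro mult_right_mono mult_left_mono) auto
    finally show ?thesis .
  qed
  hence "geom_bounded \<sigma> (\<lambda>d. c d * of_int d ^ p)"
    using \<sigma> by (auto simp: geom_bounded_def)
  thus ?thesis by (rule that)
qed

lemma has_sum_int_fold:
  fixes h :: "int \<Rightarrow> 'a :: banach"
  assumes h: "(h has_sum S) UNIV" and abs: "(\<lambda>d. norm (h d)) summable_on UNIV" and h0: "h 0 = 0"
  shows "((\<lambda>n::nat. h (int n) + h (- int n)) has_sum S) {1..}"
proof -
  have summ: "h summable_on A" for A
    by (rule abs_summable_summable, rule summable_on_subset[OF abs]) auto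
  have 1: "((\<lambda>n. h (int n)) has_sum infsum h {0<..}) {1..}"
    using has_sum_infsum[OF summ[of "{0<..}"]]
    by (subst has_sum_reindex_bij_witness[where i = nat and j = int and T = "{0<..}"]) auto
  have 2: "((\<lambda>n. h (- int n)) has_sum infsum h {..<0}) {1..}"
    using has_sum_infsum[OF summ[of "{..<0}"]]
    by (subst has_sum_reindex_bij_witness[where i = "\<lambda>d. nat (-d)" and j = "\<lambda>n. - int n" and T = "{..<0}"]) auto
  have "(h has_sum (infsum h {0<..} + infsum h {..<0})) ({0<..} \<union> {..<0})"
    by (intro has_sum_Un_disjoint has_sum_infsum summ) auto
  also have "?this \<longleftrightarrow> (h has_sum (infsum h {0<..} + infsum h {..<0})) UNIV"
    by (rule has_sum_cong_neutral) (use h0 in \<open>auto simp: not_less order_le_less\<close>)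
  finally have "S = infsum h {0<..} + infsum h {..<0}" using h has_sum_unique by blast
  with has_sum_add[OF 1 2] show ?thesis by simp
qed

text \<open>The cases e = 0 and e = 1 belong to the q-series and to its derivative in
  \<open>\<tau>\<close>; the parameter lets the Lambert series lemmas serve both.\<close>

lemma has_sum_power_times_id:
  fixes x :: "'a :: {real_normed_field, banach}"
  assumes x: "norm x < 1" and e: "e \<le> 1"
  shows "((\<lambda>m. of_nat m ^ e * x ^ m) has_sum (x / (1 - x) ^ Suc e)) {1..}"
proof (cases "e = 0")
  case True
  thus ?thesis using has_sum_geometric_from_1[OF x] by simp
next
  case False
  hence e: "e = 1" using e by simp
  have "(\<lambda>n. of_nat (Suc n) * x ^ n) sums (1 / (1 - x)\<^sup>2)" by (rule geometric_deriv_sums[OF x])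
  moreover have "summable (\<lambda>n. norm (of_nat (Suc n) * x ^ n))"
    using sums_summable[OF geometric_deriv_sums[of "norm x"]] x 
    by (simp add: norm_mult norm_power del: of_nat_Suc)
  ultimately have "((\<lambda>n. of_nat (Suc n) * x ^ n) has_sum (1 / (1 - x)\<^sup>2)) UNIV"
    by (intro norm_summable_imp_has_sum)
  from has_sum_cmult_right[OF this, of x]
  have "((\<lambda>n. of_nat (Suc n) * x ^ Suc n) has_sum (x / (1 - x)\<^sup>2)) UNIV"
    by (simp add: mult_ac)
  also have "?this \<longleftrightarrow> ((\<lambda>n. of_nat n * x ^ n) has_sum (x / (1 - x)\<^sup>2)) {1..}"
    by (intro has_sum_reindex_bij_witness[of _ "\<lambda>n. n-1" "\<lambda>n. n+1"]) auto
  finally show ?thesis using e by (simp add: power2_eq_square)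
qed

lemma divisor_regroup_sums:
  fixes g :: "nat \<Rightarrow> nat \<Rightarrow> 'a :: {banach}"
  assumes "((\<lambda>(d, m). g d m) has_sum S) ({1..} \<times> {1..})"
  shows "(\<lambda>n. \<Sum>d | d dvd Suc n. g d (Suc n div d)) sums S"
proof -
  have "((\<lambda>(d, m). g d m) has_sum S) ({1..} \<times> {1..}) \<longleftrightarrow>
        ((\<lambda>(n, d). g d (n div d)) has_sum S) (SIGMA n:{1..}. {d. d dvd n})"
    by (rule has_sum_reindex_bij_witness[of _ "\<lambda>(n, d). (d, n div d)" "\<lambda>(d, m). (d * m, d)"])
       (auto simp: Suc_le_eq dvd_div_eq_0_iff intro: Nat.gr0I)
  with assms have 1: "((\<lambda>(n, d). g d (n div d)) has_sum S) (SIGMA n:{1..}. {d. d dvd n})" by simp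
  have "((\<lambda>n. \<Sum>d | d dvd n. g d (n div d)) has_sum S) {1..}"
    by (rule has_sum_SigmaD[OF 1]) (auto intro!: has_sum_finite simp: Suc_le_eq)
  also have "?this \<longleftrightarrow> ((\<lambda>n. \<Sum>d | d dvd Suc n. g d (Suc n div d)) has_sum S) UNIV"
    by (rule has_sum_reindex_bij_witness[of _ Suc "\<lambda>n. n - 1"]) auto
  finally show ?thesis by (rule has_sum_imp_sums)
qed

text \<open>The fraction with x = q^d is the sum of m^e q^(d m) over m >= 1, and the pairs (d, m)
  are regrouped by n = d m. The polynomial bound on f yields absolute convergence over the
  pairs.\<close>

lemma lambert_sums:
  fixes q :: complex and f :: "nat \<Rightarrow> complex"
  assumes q: "0 < norm q" "norm q < 1" and e: "e \<le> 1" and f: "\<And>d. norm (f d) \<le> C * real d ^ p"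
    and S: "((\<lambda>d. f d * (q ^ d / (1 - q ^ d) ^ Suc e)) has_sum S) {1..}"
  shows "(\<lambda>n. q ^ Suc n * (\<Sum>d | d dvd Suc n. of_nat (Suc n div d) ^ e * f d)) sums S"
proof -
  define r where "r = norm q"
  have r: "0 < r" "r < 1" using q by (auto simp: r_def)
  have C: "C \<ge> 0" using order_trans[OF norm_ge_zero f[of 1]] by simp
  have qd: "norm (x ^ d) < 1" if "d \<ge> 1" "norm x < 1" for d and x :: "'b :: real_normed_field"
    using that by (simp add: norm_power power_less_one_iff)
  have inner: "((\<lambda>m. of_nat m ^ e * f d * q ^ (d * m)) has_sum f d * (q ^ d / (1 - q ^ d) ^ Suc e)) {1..}" 
    if "d \<in> {1..}" for d
  proof -
    have "norm (q ^ d) < 1" using that q by (intro qd) auto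
    from has_sum_cmult_right[OF has_sum_power_times_id[OF this e], of "f d"]
    show ?thesis unfolding power_mult by (simp only: mult_ac)
  qed
  have rinner: "((\<lambda>m. norm (of_nat m ^ e * f d * q ^ (d * m))) has_sum norm (f d) * (r ^ d / (1 - r ^ d) ^ Suc e)) {1..}" 
    if "d \<in> {1..}" for d
  proof -
    have "norm (r ^ d) < 1" using that r by (intro qd) auto
    from has_sum_cmult_right[OF has_sum_power_times_id[OF this e], of "norm (f d)"]
    have "((\<lambda>m. norm (f d) * (real m ^ e * (r ^ d) ^ m)) has_sum norm (f d) * (r ^ d / (1 - r ^ d) ^ Suc e)) {1..}" by simp
    moreover have "norm (of_nat m ^ e * f d * q ^ (d * m)) = norm (f d) * (real m ^ e * (r ^ d) ^ m)" for m
      by (simp add: power_mult norm_mult norm_power r_def)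
    ultimately show ?thesis by (simp only:)
  qed
  have "(\<lambda>d::nat. C / (1 - r) ^ Suc e * (r ^ d * real d ^ p)) summable_on {1..}"
  proof -
    have "geom_bounded r (\<lambda>d. of_real r ^ nat \<bar>d\<bar>)"
      using r by (auto simp: geom_bounded_def norm_power intro!: exI[of _ 1])
    then obtain \<rho>' where "geom_bounded \<rho>' (\<lambda>d. of_real r ^ nat \<bar>d\<bar> * of_int d ^ p)"
      by (rule geom_bounded_times_power)
    from geom_bounded_abs_summable[OF this]
    have "(\<lambda>d::int. r ^ nat \<bar>d\<bar> * real_of_int \<bar>d\<bar> ^ p) summable_on UNIV"
      using r by (simp add: norm_mult norm_power)
    hence "(\<lambda>d::int. r ^ nat \<bar>d\<bar> * real_of_int \<bar>d\<bar> ^ p) summable_on {1..}"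
      by (rule summable_on_subset) auto
    also have "?this \<longleftrightarrow> (\<lambda>d::nat. r ^ d * real d ^ p) summable_on {1..}"
      by (rule summable_on_reindex_bij_witness[of _ int nat]) auto
    finally show ?thesis by (intro summable_on_cmult_right)
  qed
  hence outer: "(\<lambda>d. norm (f d) * (r ^ d / (1 - r ^ d) ^ Suc e)) summable_on {1..}"
  proof (rule summable_on_comparison_test)
    fix d :: nat assume d: "d \<in> {1..}"
    have rd: "r ^ d \<le> r" using d r power_decreasing[of 1 d r] by simp
    show "norm (f d) * (r ^ d / (1 - r ^ d) ^ Suc e) \<le> C / (1 - r) ^ Suc e * (r ^ d * real d ^ p)"
    proof -
      have "norm (f d) * (r ^ d / (1 - r ^ d) ^ Suc e) \<le> (C * real d ^ p) * (r ^ d / (1 - r) ^ Suc e)"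
        using rd r f[of d] C by (intro mult_mono divide_left_mono power_mono mult_pos_pos zero_less_power) auto
      thus ?thesis by (simp only: times_divide_eq_left times_divide_eq_right mult_ac)
    qed
    show "0 \<le> norm (f d) * (r ^ d / (1 - r ^ d) ^ Suc e)" using rd r by simp
  qed
  have "(\<lambda>(d, m). norm (of_nat m ^ e * f d * q ^ (d * m))) summable_on {1..} \<times> {1..}"
    by (rule summable_on_SigmaI[where g = "\<lambda>d. norm (f d) * (r ^ d / (1 - r ^ d) ^ Suc e)"])
       (unfold prod.case, erule rinner, rule outer, rule norm_ge_zero)
  also have "(\<lambda>(d, m). norm (of_nat m ^ e * f d * q ^ (d * m))) = 
        (\<lambda>p. norm (case p of (d, m) \<Rightarrow> of_nat m ^ e * f d * q ^ (d * m)))"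
    by (rule ext) (simp only: case_prod_unfold)
  finally have "(\<lambda>(d, m). of_nat m ^ e * f d * q ^ (d * m)) summable_on {1..} \<times> {1..}"
    by (rule abs_summable_summable)
  from has_sum_SigmaI[OF _ S this] inner
  have "((\<lambda>(d, m). of_nat m ^ e * f d * q ^ (d * m)) has_sum S) ({1..} \<times> {1..})"
    by (simp only: prod.case)
  from divisor_regroup_sums[OF this]
  have "(\<lambda>n. \<Sum>d | d dvd Suc n. of_nat (Suc n div d) ^ e * f d * q ^ (d * (Suc n div d))) sums S" .
  also have "(\<lambda>n. \<Sum>d | d dvd Suc n. of_nat (Suc n div d) ^ e * f d * q ^ (d * (Suc n div d))) =
             (\<lambda>n. q ^ Suc n * (\<Sum>d | d dvd Suc n. of_nat (Suc n div d) ^ e * f d))"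
    by (auto simp: fun_eq_iff sum_distrib_left mult_ac intro!: sum.cong)
  finally show ?thesis .
qed

definition s_coeff :: "nat \<Rightarrow> nat \<Rightarrow> int \<Rightarrow> nat \<Rightarrow> complex" where
  "s_coeff l j a n = (\<Sum>d | d dvd n. of_nat d ^ (j - 1) * (res_ind l a (int d) + (-1) ^ j * res_ind l (- a) (int d)))"

lemma s_series_altdef:
  "\<tau> \<in> upper_half \<Longrightarrow> s_series l j a C \<tau> = C + suminf (\<lambda>n. nome \<tau> ^ Suc n * s_coeff l j a (Suc n))"
  by (simp add: s_series_def s_coeff_def nome_def res_ind_def)

lemma norm_s_coeff_le: "norm (s_coeff l j a n) \<le> 2 * real n ^ j" if "j \<ge> 1" "n \<ge> 1"
proof -
  have "norm (s_coeff l j a n) \<le> (\<Sum>d | d dvd n. real n ^ (j - 1) * 2)"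
    unfolding s_coeff_def
  proof (rule sum_norm_le)
    fix d assume "d \<in> {d. d dvd n}"
    hence "d \<le> n" using that by (auto dest: dvd_imp_le)
    hence "real d ^ (j - 1) \<le> real n ^ (j - 1)" by (intro power_mono) auto
    moreover have "norm (res_ind l a (int d) + (-1) ^ j * res_ind l (- a) (int d)) \<le> 1 + 1"
      by (rule norm_triangle_mono) (auto simp: norm_mult norm_power norm_res_ind_le)
    ultimately show "norm (of_nat d ^ (j - 1) * (res_ind l a (int d) + (-1) ^ j * res_ind l (- a) (int d))) \<le> real n ^ (j - 1) * 2"
      unfolding norm_mult by (intro mult_mono) (auto simp: norm_power)
  qed
  also have "\<dots> = real (card {d. d dvd n}) * (real n ^ (j - 1) * 2)" by simp
  also have "card {d. d dvd n} \<le> card {1..n}"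
    using that by (intro card_mono) (auto dest: dvd_imp_le intro: Nat.gr0I simp: Suc_le_eq)
  hence "real (card {d. d dvd n}) * (real n ^ (j - 1) * 2) \<le> real n * (real n ^ (j - 1) * 2)"
    by (intro mult_right_mono) auto
  also have "real n * (real n ^ (j - 1) * 2) = 2 * real n ^ j"
    using that by (cases j) auto
  finally show ?thesis by simp
qed

text \<open>Folding d with -d turns the two-sided sum into a Lambert series. For e = 0 it is the
  Fourier series without its constant term; for e = 1 each Fourier coefficient carries the factor n
  of the derivative.\<close>

lemma s_coeff_sums:
  assumes q: "0 < norm q" "norm q < 1" and e: "e \<le> 1" and j: "j \<ge> 1"
  shows "(\<lambda>n. q ^ Suc n * (of_nat (Suc n) ^ e * s_coeff l j a (Suc n))) sums
           (\<Sum>\<^sub>\<infinity>d. res_ind l a d * (if e = 0 then nu q d else if d = 0 then 0 else - psi q d) * of_int d ^ (j - 1 + e))"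
proof -
  define v where "v = (\<lambda>d. if e = 0 then nu q d else if d = 0 then 0 else - psi q d)"
  have "geom_bounded (norm q) (\<lambda>d. res_ind l a d * v d)"
  proof (cases "e = 0")
    case True
    thus ?thesis using geom_bounded_nu[OF q, of l a] by (simp add: v_def)
  next
    case False
    obtain C where C: "\<And>d. norm (res_ind l a d * psi q d) \<le> C * norm q ^ nat \<bar>d\<bar>"
      using geom_bounded_psi[OF q, of l a] by (auto simp: geom_bounded_def)
    have "norm (res_ind l a d * v d) \<le> C * norm q ^ nat \<bar>d\<bar>" for d
      using order_trans[OF norm_ge_zero C[of 0]] C[of d] False by (auto simp: v_def)
    thus ?thesis using q by (auto simp: geom_bounded_def)
  qed
  then obtain \<rho>' where \<rho>': "geom_bounded \<rho>' (\<lambda>d. (res_ind l a d * v d) * of_int d ^ (j - 1 + e))"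
    by (rule geom_bounded_times_power)
  define h where "h = (\<lambda>d. res_ind l a d * v d * of_int d ^ (j - 1 + e))"
  have abs: "(\<lambda>d. norm (h d)) summable_on UNIV"
    unfolding h_def by (rule geom_bounded_abs_summable[OF \<rho>'])
  have h0: "h 0 = 0" by (auto simp: h_def v_def nu_def)
  from has_sum_int_fold[OF has_sum_infsum[OF abs_summable_summable[OF abs]] abs h0]
  have *: "((\<lambda>n. h (int n) + h (- int n)) has_sum infsum h UNIV) {1..}" .
  define f where "f = (\<lambda>d::nat. of_nat d ^ (j - 1 + e) * (res_ind l a (int d) + (-1) ^ j * res_ind l (- a) (int d)))"
  have "h (int d) + h (- int d) = f d * (q ^ d / (1 - q ^ d) ^ Suc e)" if "d \<in> {1..}" for d
  proof -
    have d: "d > 0" using that by simp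
    have qd: "q ^ d \<noteq> 1" using powi_neq_1[OF q, of "int d"] d by simp
    have res_ind: "res_ind l a (- int d) = res_ind l (- a) (int d)"
      using cong_minus_minus_iff[of "- int d" a "int l"] by (auto simp: res_ind_def)
    have v1: "v (int d) = q ^ d / (1 - q ^ d) ^ Suc e"
      using e d psi_eq[OF q, of "int d"] by (cases "e = 0") (auto simp: v_def nu_def power2_eq_square le_Suc_eq)
    have v2: "v (- int d) = (-1) ^ Suc e * (q ^ d / (1 - q ^ d) ^ Suc e)"
    proof (cases "e = 0")
      case True
      thus ?thesis using d qd q by (auto simp: v_def nu_def power_int_minus field_simps)
    next
      case False
      thus ?thesis using e d psi_eq[OF q, of "- int d"] by (auto simp: v_def power2_eq_square le_Suc_eq)
    qed
    \<comment> \<open>The function \<open>nu\<close> (e = 0) is odd and \<open>psi\<close> (e = 1)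
      is even; combined with the parity of d^(j-1+e), both give the sign (-1)^j of the divisor
      sum.\<close>
    have s: "(-1) ^ Suc e * (-1) ^ (j - 1 + e) = ((-1) ^ j :: complex)"
      using j e by (cases j) (auto simp: le_Suc_eq)
    have "h (- int d) = ((-1) ^ Suc e * (-1) ^ (j - 1 + e)) * res_ind l (- a) (int d) * (q ^ d / (1 - q ^ d) ^ Suc e) * of_nat d ^ (j - 1 + e)"
      using power_minus[of "of_nat d :: complex" "j - 1 + e"] by (simp add: h_def v2 res_ind mult_ac)
    hence h2: "h (- int d) = (-1) ^ j * res_ind l (- a) (int d) * (q ^ d / (1 - q ^ d) ^ Suc e) * of_nat d ^ (j - 1 + e)"
      by (simp only: s)
    have h1: "h (int d) = res_ind l a (int d) * (q ^ d / (1 - q ^ d) ^ Suc e) * of_nat d ^ (j - 1 + e)"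
      by (simp add: h_def v1)
    show ?thesis unfolding h1 h2 f_def by (simp only: algebra_simps)
  qed
  with * have *: "((\<lambda>d. f d * (q ^ d / (1 - q ^ d) ^ Suc e)) has_sum infsum h UNIV) {1..}"
    using has_sum_cong[of "{1..}" "\<lambda>n. h (int n) + h (- int n)"] by (simp only:)
  have f: "norm (f d) \<le> 2 * real d ^ (j - 1 + e)" for d
  proof -
    have "norm (res_ind l a (int d) + (-1) ^ j * res_ind l (- a) (int d)) \<le> 1 + 1"
      by (rule norm_triangle_mono) (auto simp: norm_mult norm_power norm_res_ind_le)
    hence "norm (f d) \<le> real d ^ (j - 1 + e) * 2"
      unfolding f_def norm_mult by (intro mult_mono) (auto simp: norm_power)
    thus ?thesis by simp
  qed
  from lambert_sums[OF q e f *]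
  have "(\<lambda>n. q ^ Suc n * (\<Sum>d | d dvd Suc n. of_nat (Suc n div d) ^ e * f d)) sums infsum h UNIV" .
  \<comment> \<open>The surplus d^e combines with (n/d)^e to n^e, which leaves the divisor sum with
    exponent j - 1.\<close>
  moreover have "(\<Sum>d | d dvd Suc n. of_nat (Suc n div d) ^ e * f d) = of_nat (Suc n) ^ e * s_coeff l j a (Suc n)" for n
    unfolding s_coeff_def sum_distrib_left
  proof (rule sum.cong)
    fix d assume d: "d \<in> {d. d dvd Suc n}"
    hence "of_nat (Suc n div d) * of_nat d = (of_nat (Suc n) :: complex)"
      by (metis dvd_div_mult_self mem_Collect_eq of_nat_mult)
    hence "of_nat (Suc n div d) ^ e * of_nat d ^ (j - 1 + e) = of_nat (Suc n) ^ e * (of_nat d ^ (j - 1) :: complex)"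
      by (metis power_add power_mult_distrib mult.left_commute mult.commute)
    thus "of_nat (Suc n div d) ^ e * f d = of_nat (Suc n) ^ e * 
       (of_nat d ^ (j - 1) * (res_ind l a (int d) + (- 1) ^ j * res_ind l (- a) (int d)))"
      unfolding f_def by (simp only: mult.assoc[symmetric])
  qed auto
  ultimately show ?thesis by (simp add: h_def v_def)
qed

lemma s_series_eq_infsum:
  assumes "\<tau> \<in> upper_half" "j \<ge> 1"
  shows "s_series l j a C \<tau> = C + (\<Sum>\<^sub>\<infinity>d. res_ind l a d * nu (nome \<tau>) d * of_int d ^ (j - 1))"
  using sums_unique[OF s_coeff_sums[OF nome_bounds[OF assms(1)] _ assms(2), of 0 l a]] 
  by (simp add: s_series_altdef assms)

lemma s_series_eq_Kfps:
  assumes "\<tau> \<in> upper_half" "j \<ge> 1"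
  shows "s_series l j a (fact (j - 1) * fps_nth (Gfps l a) (j - 1)) \<tau> = 
         fact (j - 1) * fps_nth (Kfps l (nome \<tau>) a) (j - 1)"
  by (simp add: s_series_eq_infsum[OF assms] Kfps_def ring_distribs)

lemma midpoint_1_bounds: "k = (x + 1) / 2 \<Longrightarrow> 0 < x \<Longrightarrow> x < 1 \<Longrightarrow> x < k \<and> k < 1 \<and> 0 < (k::real)"
  by simp

text \<open>Differentiating in \<open>\<tau>\<close> multiplies the n-th Fourier coefficient by 2 pi
  i n. Spread over n = d m, the factor n = d m raises d^(j-1) to d^j and gives the sum of m q^(d m),
  which is - psi(d).\<close>

lemma s_series_has_derivative:
  assumes "\<tau> \<in> upper_half" "j \<ge> 1"
  shows "(s_series l j a C has_field_derivative 
           (- 2 * of_real pi * \<i> * fact j * fps_nth (Pfps l (nome \<tau>) a) j)) (at \<tau>)"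
proof -
  note q = nome_bounds[OF assms(1)]
  define c where "c n = (if n = 0 then 0 else s_coeff l j a n)" for n
  define D where "D = suminf (\<lambda>n. diffs c n * nome \<tau> ^ n)"
  have summ: "summable (\<lambda>n. c n * q ^ n)" if "0 < norm q" "norm q < 1" for q
    using sums_summable[OF s_coeff_sums[OF that _ assms(2), of 0 l a]]
    by (subst summable_Suc_iff[symmetric]) (simp add: c_def mult_ac)
  \<comment> \<open>A point of convergence strictly outside the circle through
    \<open>nome \<tau>\<close>, as termwise differentiation requires.\<close>
  define K where "K = (of_real ((norm (nome \<tau>) + 1) / 2) :: complex)"
  have "norm K = (norm (nome \<tau>) + 1) / 2"
    unfolding K_def norm_of_real by (intro abs_of_nonneg divide_nonneg_nonneg add_nonneg_nonneg) auto
  hence "norm (nome \<tau>) < norm K \<and> norm K < 1 \<and> 0 < norm K" using q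
    by (intro midpoint_1_bounds)
  hence K: "norm (nome \<tau>) < norm K" "norm K < 1" "0 < norm K" by blast+
  have 1: "((\<lambda>x. suminf (\<lambda>n. c n * x ^ n)) has_field_derivative D) (at (nome \<tau>))"
    unfolding D_def by (rule termdiffs_strong[OF summ[OF K(3,2)] K(1)])
  have "((\<lambda>t. suminf (\<lambda>n. c n * nome t ^ n)) has_field_derivative D * (2 * of_real pi * \<i> * nome \<tau>)) (at \<tau>)"
  proof (rule DERIV_chain2[where f = "\<lambda>x. suminf (\<lambda>n. c n * x ^ n)" and g = nome, OF 1])
    show "(nome has_field_derivative 2 * of_real pi * \<i> * nome \<tau>) (at \<tau>)"
      unfolding nome_def by (auto intro!: derivative_eq_intros)
  qed
  hence "((\<lambda>t. C + suminf (\<lambda>n. c n * nome t ^ n)) has_field_derivative D * (2 * of_real pi * \<i> * nome \<tau>)) (at \<tau>)"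
    by (auto intro!: derivative_eq_intros)
  note der0 = this
  have "eventually (\<lambda>t. t \<in> upper_half) (nhds \<tau>)"
    by (rule eventually_nhds_in_open) (use assms in \<open>auto simp: upper_half_def open_halfspace_Im_gt\<close>)
  hence ev: "eventually (\<lambda>t. C + suminf (\<lambda>n. c n * nome t ^ n) = s_series l j a C t) (nhds \<tau>)"
  proof eventually_elim
    case (elim t)
    have "suminf (\<lambda>n. c n * nome t ^ n) = suminf (\<lambda>n. c (Suc n) * nome t ^ Suc n)"
      using suminf_split_head[OF summ[OF nome_bounds[OF elim]]] by (simp add: c_def)
    thus ?case by (simp add: s_series_altdef[OF elim] c_def mult_ac)
  qed
  have der: "(s_series l j a C has_field_derivative D * (2 * of_real pi * \<i> * nome \<tau>)) (at \<tau>)"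
    by (rule iffD1[OF DERIV_cong_ev[OF refl ev refl] der0])
  have 3: "(\<lambda>n. nome \<tau> ^ Suc n * (of_nat (Suc n) ^ 1 * s_coeff l j a (Suc n))) sums
           (\<Sum>\<^sub>\<infinity>d. res_ind l a d * (if (1::nat) = 0 then nu (nome \<tau>) d else if d = 0 then 0 else - psi (nome \<tau>) d) * of_int d ^ (j - 1 + 1))"
    by (rule s_coeff_sums[OF q _ assms(2)]) simp
  \<comment> \<open>The term d = 0, where \<open>psi\<close> is 1/12, can be restored because 0^j =
    0 for j >= 1.\<close>
  have 4: "(\<Sum>\<^sub>\<infinity>d. res_ind l a d * (if (1::nat) = 0 then nu (nome \<tau>) d else if d = 0 then 0 else - psi (nome \<tau>) d) * of_int d ^ (j - 1 + 1)) = 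
             (\<Sum>\<^sub>\<infinity>d. (-1) * (res_ind l a d * psi (nome \<tau>) d * of_int d ^ j))"
    by (rule infsum_cong) (use assms(2) in auto)
  have 5: "(\<Sum>\<^sub>\<infinity>d. (-1) * (res_ind l a d * psi (nome \<tau>) d * of_int d ^ j)) = - (fact j * fps_nth (Pfps l (nome \<tau>) a) j)"
    by (subst infsum_cmult_right') (simp add: Pfps_def)
  have 6: "nome \<tau> ^ Suc n * (of_nat (Suc n) ^ 1 * s_coeff l j a (Suc n)) = 
             nome \<tau> * (diffs c n * nome \<tau> ^ n)" for n
    by (simp add: diffs_def c_def)
  have nz: "nome \<tau> \<noteq> 0" by (simp add: nome_def)
  have "(\<lambda>n. nome \<tau> * (diffs c n * nome \<tau> ^ n)) sums - (fact j * fps_nth (Pfps l (nome \<tau>) a) j)"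
    using 3 unfolding 4 5 6 .
  from sums_mult_D[OF this nz]
  have "(\<lambda>n. diffs c n * nome \<tau> ^ n) sums (- (fact j * fps_nth (Pfps l (nome \<tau>) a) j) / nome \<tau>)" .
  hence D: "D = - (fact j * fps_nth (Pfps l (nome \<tau>) a) j) / nome \<tau>"
    unfolding D_def by (rule sums_unique[symmetric])
  have "D * (2 * of_real pi * \<i> * nome \<tau>) = - 2 * of_real pi * \<i> * fact j * fps_nth (Pfps l (nome \<tau>) a) j"
    unfolding D using nz by simp
  from der[unfolded this] show ?thesis .
qed

section \<open>Weak modularity\<close>

definition lat :: "nat \<Rightarrow> complex \<Rightarrow> int \<Rightarrow> int \<Rightarrow> complex" where
  "lat l \<tau> m n = 2 * of_real pi * \<i> * (of_int m * \<tau> + of_int n / of_nat l)"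

definition lattice :: "nat \<Rightarrow> complex \<Rightarrow> complex set" where
  "lattice l \<tau> = {lat l \<tau> m n | m n. True}"

text \<open>
  $F_a'$ is given by the series in the strip \<open>|Re z| < 2\<pi> Im \<tau>\<close> only; a general argument is first
  translated into the strip by a multiple of \<open>2\<pi>i\<tau>\<close>.
\<close>
definition Hfun :: "nat \<Rightarrow> int \<Rightarrow> complex \<Rightarrow> complex \<Rightarrow> complex" where
  "Hfun l a \<tau> z = deriv (Ffun l (nome \<tau>) a) (z + lat l \<tau> \<lfloor>Re z / (2 * pi * Im \<tau>) + 1 / 2\<rfloor> 0)"

lemma lat_add: "lat l \<tau> m n + lat l \<tau> m' n' = lat l \<tau> (m + m') (n + n')"
  by (simp add: lat_def algebra_simps add_divide_distrib)

lemma lat_diff: "lat l \<tau> m n - lat l \<tau> m' n' = lat l \<tau> (m - m') (n - n')"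
  by (simp add: lat_def algebra_simps diff_divide_distrib)

lemma lat_in_lattice [simp]: "lat l \<tau> m n \<in> lattice l \<tau>"
  by (auto simp: lattice_def)

lemma lattice_shift_iff: "z + lat l \<tau> m n \<in> lattice l \<tau> \<longleftrightarrow> z \<in> lattice l \<tau>"
proof
  assume "z + lat l \<tau> m n \<in> lattice l \<tau>"
  then obtain m' n' where "z + lat l \<tau> m n = lat l \<tau> m' n'" by (auto simp: lattice_def)
  hence "z = lat l \<tau> (m' - m) (n' - n)" by (simp add: lat_diff[symmetric] algebra_simps)
  thus "z \<in> lattice l \<tau>" by simp
next
  assume "z \<in> lattice l \<tau>"
  then obtain m' n' where "z = lat l \<tau> m' n'" by (auto simp: lattice_def)
  thus "z + lat l \<tau> m n \<in> lattice l \<tau>" by (simp only: lat_add lat_in_lattice)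
qed

lemma Re_lat: "Re (lat l \<tau> m n) = - of_int m * (2 * pi * Im \<tau>)"
proof -
  have "Im (of_int n / of_nat l :: complex) = 0"
    by (metis Im_complex_of_real of_real_divide of_real_of_int_eq of_real_of_nat_eq)
  thus ?thesis by (simp add: lat_def)
qed

lemma exp_eq_1_iff_lat:
  assumes l: "l > 0"
  shows "exp (of_nat l * z) = 1 \<longleftrightarrow> (\<exists>n. z = lat l \<tau> 0 n)"
proof
  assume "exp (of_nat l * z) = 1"
  then obtain n :: int where n: "of_nat l * z = of_int (2 * n) * of_real pi * \<i>"
    using exp_eq_1[of "of_nat l * z"] by (auto simp: complex_eq_iff)
  hence "z = lat l \<tau> 0 n" using l by (simp add: lat_def field_simps)
  thus "\<exists>n. z = lat l \<tau> 0 n" ..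
next
  assume "\<exists>n. z = lat l \<tau> 0 n"
  then obtain n where n: "z = lat l \<tau> 0 n" by blast
  have "of_nat l * z = of_int n * (2 * of_real pi * \<i>)" using l by (simp add: n lat_def)
  thus "exp (of_nat l * z) = 1" using exp_integer_2pi[of "of_int n"] by (simp add: mult_ac)
qed

lemma ln_norm_nome: "ln (norm (nome \<tau>)) = - (2 * pi * Im \<tau>)"
  by (simp add: norm_nome)

lemma Ffun_analytic:
  assumes l: "l > 0" and \<tau>: "\<tau> \<in> upper_half" and z: "\<bar>Re z\<bar> < 2 * pi * Im \<tau>" "exp (of_nat l * z) \<noteq> 1"
  shows "Ffun l (nome \<tau>) a analytic_on {z}"
proof -
  have "(\<lambda>z. Rfun l a z + expsum (\<lambda>d. res_ind l a d * nu (nome \<tau>) d) z) analytic_on {z}"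
    unfolding Rfun_def
    by (intro analytic_intros expsum_analytic[OF geom_bounded_nu[OF nome_bounds[OF \<tau>]]])
       (use z in \<open>auto simp: ln_norm_nome\<close>)
  thus ?thesis by (simp add: Ffun_def[abs_def])
qed

text \<open>The jump in \<open>Ffun_shift\<close> is constant in z, so it disappears in the
  derivative.\<close>

lemma deriv_Ffun_shift:
  assumes l: "l > 0" and \<tau>: "\<tau> \<in> upper_half" and z: "0 < Re z" "Re z < 2 * pi * Im \<tau>"
  shows "deriv (Ffun l (nome \<tau>) a) (z + lat l \<tau> 1 0) = deriv (Ffun l (nome \<tau>) a) z"
proof -
  let ?F = "Ffun l (nome \<tau>) a"
  let ?w = "lat l \<tau> 1 0"
  have w: "exp ?w = nome \<tau>" by (simp add: lat_def nome_def)
  have Rew: "Re ?w = - (2 * pi * Im \<tau>)" by (simp add: Re_lat)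
  have ne: "exp (of_nat l * u) \<noteq> 1" if "Re u \<noteq> 0" for u
  proof
    assume "exp (of_nat l * u) = 1"
    hence "norm (exp (of_nat l * u)) = 1" by simp
    thus False using l that by (simp add: norm_exp_eq_Re)
  qed
  have "?F analytic_on {z + ?w}"
    by (rule Ffun_analytic[OF l \<tau>]) (use z Rew in \<open>auto intro!: ne\<close>)
  hence "(?F has_field_derivative deriv ?F (z + ?w)) (at (z + ?w))"
    using analytic_on_imp_differentiable_at field_differentiable_derivI by blast
  hence 1: "((\<lambda>u. ?F (u + ?w)) has_field_derivative deriv ?F (z + ?w)) (at z)"
    by (simp add: DERIV_shift)
  have "eventually (\<lambda>u. u \<in> {u. 0 < Re u} \<inter> {u. Re u < 2 * pi * Im \<tau>}) (nhds z)"
    by (intro eventually_nhds_in_open open_Int open_halfspace_Re_gt open_halfspace_Re_lt) (use z in auto)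
  hence "eventually (\<lambda>u. ?F (u + ?w) = ?F u + of_bool (int l dvd a)) (nhds z)"
    by eventually_elim (rule Ffun_shift[OF l w], use nome_bounds[OF \<tau>] in \<open>auto simp: ln_norm_nome\<close>)
  note ev = this
  have "((\<lambda>u. ?F u + of_bool (int l dvd a)) has_field_derivative deriv ?F (z + ?w)) (at z)"
    by (rule iffD1[OF DERIV_cong_ev[OF refl ev refl] 1])
  from DERIV_diff[OF this DERIV_const[of "of_bool (int l dvd a)"]]
  have "(?F has_field_derivative deriv ?F (z + ?w)) (at z)" by simp
  thus ?thesis by (simp add: DERIV_imp_deriv)
qed

text \<open>The strip is wider than one period, so several translates may land in it. The floor in
  \<open>Hfun\<close> places z within half a period of the imaginary axis, hence m differs from it
  by at most 1, and \<open>deriv_Ffun_shift\<close> covers a single step.\<close>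

lemma Hfun_eq:
  assumes l: "l > 0" and \<tau>: "\<tau> \<in> upper_half" and z: "\<bar>Re z - of_int m * (2 * pi * Im \<tau>)\<bar> < 2 * pi * Im \<tau>"
  shows "Hfun l a \<tau> z = deriv (Ffun l (nome \<tau>) a) (z + lat l \<tau> m 0)"
proof -
  define y where "y = 2 * pi * Im \<tau>"
  have y: "y > 0" using \<tau> by (simp add: y_def upper_half_def)
  define k where "k = \<lfloor>Re z / y + 1 / 2\<rfloor>"
  have "of_int k \<le> Re z / y + 1 / 2" "Re z / y + 1 / 2 < of_int k + 1"
    unfolding k_def by linarith+
  hence k: "of_int k * y \<le> Re z + y / 2" "Re z < of_int k * y + y / 2"
    using y by (simp_all add: field_simps)
  have zm: "Re z - of_int m * y < y" "- y < Re z - of_int m * y" using z unfolding y_def[symmetric] by auto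
  have H: "Hfun l a \<tau> z = deriv (Ffun l (nome \<tau>) a) (z + lat l \<tau> k 0)"
    by (simp add: Hfun_def k_def y_def)
  have "of_int m * y < (of_int k + 2) * y" using k zm y by (simp add: algebra_simps)
  hence "m < k + 2" using y by simp
  moreover have "(of_int k - 2) * y < of_int m * y" using k zm y by (simp add: algebra_simps)
  hence "k - 2 < m" using y by simp
  ultimately consider "m = k" | "m = k + 1" | "k = m + 1" by linarith
  thus ?thesis
  proof cases
    case 2
    have "deriv (Ffun l (nome \<tau>) a) (z + lat l \<tau> k 0 + lat l \<tau> 1 0) = deriv (Ffun l (nome \<tau>) a) (z + lat l \<tau> k 0)"
    proof (rule deriv_Ffun_shift[OF l \<tau>])
      have "Re (z + lat l \<tau> k 0) = Re z - of_int k * y" by (simp add: Re_lat y_def)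
      thus "0 < Re (z + lat l \<tau> k 0)" "Re (z + lat l \<tau> k 0) < 2 * pi * Im \<tau>"
        using k zm y 2 unfolding y_def[symmetric] by (simp_all add: algebra_simps)
    qed
    thus ?thesis using H 2 by (simp add: lat_add add.assoc)
  next
    case 3
    have "deriv (Ffun l (nome \<tau>) a) (z + lat l \<tau> m 0 + lat l \<tau> 1 0) = deriv (Ffun l (nome \<tau>) a) (z + lat l \<tau> m 0)"
    proof (rule deriv_Ffun_shift[OF l \<tau>])
      have "Re (z + lat l \<tau> m 0) = Re z - of_int m * y" by (simp add: Re_lat y_def)
      thus "0 < Re (z + lat l \<tau> m 0)" "Re (z + lat l \<tau> m 0) < 2 * pi * Im \<tau>"
        using k zm y 3 unfolding y_def[symmetric] by (simp_all add: algebra_simps)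
    qed
    thus ?thesis using H 3 by (simp add: lat_add add.assoc)
  qed (use H in simp)
qed

lemma Hfun_nearest:
  assumes \<tau>: "\<tau> \<in> upper_half"
  obtains m where "\<bar>Re z - of_int m * (2 * pi * Im \<tau>)\<bar> < 2 * pi * Im \<tau>"
proof -
  define y where "y = 2 * pi * Im \<tau>"
  have y: "y > 0" using \<tau> by (simp add: y_def upper_half_def)
  define k where "k = \<lfloor>Re z / y\<rfloor>"
  have "of_int k \<le> Re z / y" "Re z / y < of_int k + 1"
    unfolding k_def by linarith+
  hence "of_int k * y \<le> Re z" "Re z < of_int k * y + y"
    using y by (simp_all add: field_simps)
  hence "\<bar>Re z - of_int k * y\<bar> < y" by simp
  thus ?thesis using that[of k] by (simp add: y_def)
qed

lemma Hfun_lattice: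
  assumes l: "l > 0" and \<tau>: "\<tau> \<in> upper_half" and z: "z \<notin> lattice l \<tau>"
  shows "Hfun l a \<tau> (z + lat l \<tau> m n) = exp (2 * of_real pi * \<i> * of_int (a * n) / of_nat l) * Hfun l a \<tau> z"
proof -
  let ?F = "Ffun l (nome \<tau>) a"
  let ?e = "exp (2 * of_real pi * \<i> * of_int (a * n) / of_nat l)"
  let ?b = "of_bool (int l dvd a) / 2 :: complex"
  obtain k where k: "\<bar>Re z - of_int k * (2 * pi * Im \<tau>)\<bar> < 2 * pi * Im \<tau>" using Hfun_nearest[OF \<tau>] .
  define z' where "z' = z + lat l \<tau> k 0"
  have z': "\<bar>Re z'\<bar> < 2 * pi * Im \<tau>" using k by (simp add: z'_def Re_lat)
  have z'L: "z' \<notin> lattice l \<tau>" using z by (simp add: z'_def lattice_shift_iff)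
  hence ne: "exp (of_nat l * z') \<noteq> 1" using exp_eq_1_iff_lat[OF l, of z' \<tau>] by auto
  have "?F analytic_on {z'}" by (rule Ffun_analytic[OF l \<tau> z' ne])
  hence der: "(?F has_field_derivative deriv ?F z') (at z')"
    using analytic_on_imp_differentiable_at field_differentiable_derivI by blast
  have H1: "Hfun l a \<tau> z = deriv ?F z'"
    unfolding z'_def by (rule Hfun_eq[OF l \<tau> k])
  have "Hfun l a \<tau> (z + lat l \<tau> m n) = deriv ?F (z + lat l \<tau> m n + lat l \<tau> (k - m) 0)"
    by (rule Hfun_eq[OF l \<tau>]) (use k in \<open>simp add: Re_lat algebra_simps\<close>)
  also have "z + lat l \<tau> m n + lat l \<tau> (k - m) 0 = z' + lat l \<tau> 0 n"
    by (simp add: z'_def lat_add add.assoc)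
  also have "deriv ?F (z' + lat l \<tau> 0 n) = ?e * deriv ?F z'"
  proof (rule DERIV_imp_deriv)
    have per: "?F (u + lat l \<tau> 0 n) = ?e * (?F u + ?b) - ?b" for u
      using Ffun_period[OF l, of "nome \<tau>" a u n] by (simp add: lat_def algebra_simps)
    have "((\<lambda>u. ?e * (?F u + ?b) - ?b) has_field_derivative ?e * (deriv ?F z' + 0) - 0) (at z')"
      by (intro DERIV_diff DERIV_cmult DERIV_add der DERIV_const)
    hence "((\<lambda>u. ?F (u + lat l \<tau> 0 n)) has_field_derivative ?e * deriv ?F z') (at z')"
      by (simp add: per)
    thus "(?F has_field_derivative ?e * deriv ?F z') (at (z' + lat l \<tau> 0 n))"
      by (simp add: DERIV_shift)
  qed
  finally show ?thesis by (simp add: H1)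
qed

lemma Hfun_analytic:
  assumes l: "l > 0" and \<tau>: "\<tau> \<in> upper_half" and z: "z \<notin> lattice l \<tau>"
  shows "Hfun l a \<tau> analytic_on {z}"
proof -
  let ?F = "Ffun l (nome \<tau>) a"
  obtain k where k: "\<bar>Re z - of_int k * (2 * pi * Im \<tau>)\<bar> < 2 * pi * Im \<tau>" using Hfun_nearest[OF \<tau>] .
  define z' where "z' = z + lat l \<tau> k 0"
  have z': "\<bar>Re z'\<bar> < 2 * pi * Im \<tau>" using k by (simp add: z'_def Re_lat)
  have z'L: "z' \<notin> lattice l \<tau>" using z by (simp add: z'_def lattice_shift_iff)
  hence ne: "exp (of_nat l * z') \<noteq> 1" using exp_eq_1_iff_lat[OF l, of z' \<tau>] by auto
  have "?F analytic_on {z'}" by (rule Ffun_analytic[OF l \<tau> z' ne])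
  hence "deriv ?F analytic_on {z'}" by (rule analytic_deriv)
  hence "deriv ?F \<circ> (\<lambda>u. u + lat l \<tau> k 0) analytic_on {z}"
    by (intro analytic_on_compose) (auto intro!: analytic_intros simp: z'_def)
  moreover have "eventually (\<lambda>u. u \<in> Re -` {u. \<bar>u - of_int k * (2 * pi * Im \<tau>)\<bar> < 2 * pi * Im \<tau>}) (nhds z)"
    by (intro eventually_nhds_in_open open_vimage open_Collect_less continuous_intros) (use k in auto)
  hence "eventually (\<lambda>u. (deriv ?F \<circ> (\<lambda>u. u + lat l \<tau> k 0)) u = Hfun l a \<tau> u) (nhds z)"
    by eventually_elim (simp add: Hfun_eq[OF l \<tau>])
  ultimately show ?thesis using analytic_at_cong by blast
qed

lemma eventually_not_lattice:
  assumes l: "l > 0" and \<tau>: "\<tau> \<in> upper_half"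
  shows "eventually (\<lambda>z. z \<notin> lattice l \<tau>) (at 0)"
proof -
  \<comment> \<open>The first bound forces m = 0 through the real part; with m = 0 a lattice point
    has modulus 2 pi |n| / l, and the second bound forces n = 0.\<close>
  define e where "e = min (2 * pi * Im \<tau>) (1 / l)"
  have e: "e > 0" using \<tau> l by (simp add: e_def upper_half_def)
  have "eventually (\<lambda>z. z \<in> ball 0 e - {0}) (at (0 :: complex))"
    by (intro eventually_at_in_open) (use e in auto)
  thus ?thesis
  proof eventually_elim
    case (elim z)
    show ?case
    proof
      assume "z \<in> lattice l \<tau>"
      then obtain m n where z: "z = lat l \<tau> m n" by (auto simp: lattice_def)
      have "\<bar>Re z\<bar> < e" using elim abs_Re_le_cmod[of z] by simp
      hence "\<bar>of_int m\<bar> * (2 * pi * Im \<tau>) < 1 * (2 * pi * Im \<tau>)"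
        unfolding z Re_lat using \<tau> by (simp add: e_def abs_mult upper_half_def)
      hence "\<bar>real_of_int m\<bar> < 1" using \<tau> by (subst (asm) mult_less_cancel_right_pos) (auto simp: upper_half_def)
      hence m: "m = 0" by linarith
      have "norm z = 2 * pi * \<bar>of_int n\<bar> / l" by (simp add: z m lat_def norm_mult norm_divide)
      moreover have "norm z < 1 / l" using elim by (simp add: e_def)
      ultimately have "2 * pi * \<bar>of_int n\<bar> < 1" using l by (simp add: field_simps)
      moreover have "n \<noteq> 0" using z m elim by (auto simp: lat_def)
      hence "1 \<le> \<bar>real_of_int n\<bar>" by linarith
      hence "2 * pi * 1 \<le> 2 * pi * \<bar>of_int n\<bar>" by (intro mult_left_mono) auto
      ultimately show False using pi_gt3 by linarith
    qed
  qed
qed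

text \<open>Differentiating F = K - 1 / (l z) gives this polar part. It is independent of
  \<open>\<tau>\<close> and a, which is why it cancels when two values of \<open>\<tau>\<close> are
  compared.\<close>

lemma Hfun_expansion_at_0:
  assumes l: "l > 0" and \<tau>: "\<tau> \<in> upper_half"
  obtains D where "D has_fps_expansion fps_deriv (Kfps l (nome \<tau>) a)"
    and "eventually (\<lambda>z. Hfun l a \<tau> z = D z + 1 / (of_nat l * z\<^sup>2)) (at 0)"
proof -
  let ?F = "Ffun l (nome \<tau>) a"
  define K where "K = (\<lambda>z. if z = 0 then fps_nth (Kfps l (nome \<tau>) a) 0 else ?F z + 1 / (of_nat l * z))"
  have K: "K has_fps_expansion Kfps l (nome \<tau>) a"
    unfolding K_def by (rule Kfps_has_expansion[OF l nome_bounds[OF \<tau>]])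
  obtain S where S: "open S" "0 \<in> S" "K holomorphic_on S"
    using has_fps_expansion_imp_holomorphic[OF K] by metis
  have "eventually (\<lambda>z. z \<in> S - {0}) (at (0::complex))"
    by (rule eventually_at_in_open) (use S in auto)
  moreover have "eventually (\<lambda>z. z \<in> Re -` {u. \<bar>u\<bar> < 2 * pi * Im \<tau>}) (nhds 0)"
    by (intro eventually_nhds_in_open open_vimage open_Collect_less continuous_intros) (use \<tau> in \<open>auto simp: upper_half_def\<close>)
  hence "eventually (\<lambda>z. z \<in> Re -` {u. \<bar>u\<bar> < 2 * pi * Im \<tau>}) (at (0::complex))"
    by (simp add: eventually_nhds_conv_at)
  ultimately have "eventually (\<lambda>z. Hfun l a \<tau> z = deriv K z + 1 / (of_nat l * z\<^sup>2)) (at 0)"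
  proof eventually_elim
    case (elim z)
    have z: "z \<noteq> 0" using elim by auto
    have H: "Hfun l a \<tau> z = deriv ?F z"
      using Hfun_eq[OF l \<tau>, of z 0 a] elim by (simp add: lat_def)
    have dK: "(K has_field_derivative deriv K z) (at z)"
      using S elim by (intro holomorphic_derivI[of _ S]) auto
    have "((\<lambda>u. K u - inverse (of_nat l * u)) has_field_derivative deriv K z + 1 / (of_nat l * z\<^sup>2)) (at z)"
      using z l by (auto intro!: derivative_eq_intros dK simp: power2_eq_square field_simps)
    moreover have "eventually (\<lambda>u. u \<in> - {0}) (nhds z)"
      by (rule eventually_nhds_in_open) (use z in auto)
    hence "eventually (\<lambda>u. K u - inverse (of_nat l * u) = ?F u) (nhds z)"
      by eventually_elim (auto simp: K_def divide_inverse)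
    ultimately have "(?F has_field_derivative deriv K z + 1 / (of_nat l * z\<^sup>2)) (at z)"
      using DERIV_cong_ev[OF refl _ refl] by metis
    thus ?case using H by (simp add: DERIV_imp_deriv)
  qed
  moreover have "deriv K has_fps_expansion fps_deriv (Kfps l (nome \<tau>) a)"
    by (intro fps_expansion_intros K)
  ultimately show ?thesis using that by blast
qed

section \<open>Transformation of the lattice and Liouville's theorem\<close>

lemma moebius_denom_nonzero:
  assumes "\<tau> \<in> upper_half" "A * D - B * C = 1"
  shows "of_int C * \<tau> + of_int D \<noteq> (0 :: complex)"
proof
  assume *: "of_int C * \<tau> + of_int D = (0 :: complex)"
  hence "Im (of_int C * \<tau> + of_int D) = 0" by simp
  hence "C = 0" using assms by (auto simp: upper_half_def)
  with * have "D = 0" by simp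
  with \<open>C = 0\<close> assms show False by simp
qed

lemma Im_moebius:
  assumes "\<tau> \<in> upper_half" "A * D - B * C = 1"
  shows "Im (moebius A B C D \<tau>) = Im \<tau> / (norm (of_int C * \<tau> + of_int D))\<^sup>2"
proof -
  have *: "real_of_int A * real_of_int D - real_of_int B * real_of_int C = 1"
    using assms(2) by (metis of_int_1 of_int_diff of_int_mult)
  have "Im (moebius A B C D \<tau>) = ((real_of_int A * real_of_int D - real_of_int B * real_of_int C) * Im \<tau>) / (norm (of_int C * \<tau> + of_int D))\<^sup>2"
    unfolding moebius_def Im_divide cmod_power2 by (simp add: algebra_simps)
  thus ?thesis using * by simp
qed

lemma moebius_in_upper_half:
  assumes "\<tau> \<in> upper_half" "A * D - B * C = 1"
  shows "moebius A B C D \<tau> \<in> upper_half"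
  using moebius_denom_nonzero[OF assms] assms(1) Im_moebius[OF assms]
  by (simp add: upper_half_def)

text \<open>Dividing by J changes the lattice basis by an integral matrix precisely because C = l c:
  the denominator l in the second generator absorbs it. The new second coordinate is congruent to A
  n modulo l, so the character is kept when A = 1 modulo l.\<close>

lemma lattice_moebius:
  fixes A B C D :: int
  assumes l: "l > 0" and \<tau>: "\<tau> \<in> upper_half" and det: "A * D - B * C = 1" and C: "C = int l * c"
  defines "J \<equiv> of_int C * \<tau> + of_int D"
  shows "lat l \<tau> m n / J = lat l (moebius A B C D \<tau>) (D * m - c * n) (A * n - int l * B * m)"
    and "z / J \<in> lattice l (moebius A B C D \<tau>) \<longleftrightarrow> z \<in> lattice l \<tau>"
proof -
  have J: "J \<noteq> 0" unfolding J_def by (rule moebius_denom_nonzero[OF \<tau> det])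
  have tr: "J * lat l (moebius A B C D \<tau>) m' n' = lat l \<tau> (A * m' + c * n') (int l * B * m' + D * n')" for m' n'
  proof -
    have JM: "J * moebius A B C D \<tau> = of_int A * \<tau> + of_int B"
      using J by (simp add: moebius_def J_def)
    have "J * (of_int m' * moebius A B C D \<tau> + of_int n' / of_nat l) = 
          of_int m' * (J * moebius A B C D \<tau>) + of_int n' * J / of_nat l"
      by (simp add: algebra_simps)
    also have "\<dots> = of_int m' * (of_int A * \<tau> + of_int B) + of_int n' * (of_int C * \<tau> + of_int D) / of_nat l"
      unfolding JM by (simp add: J_def)
    also have "\<dots> = of_int (A * m' + c * n') * \<tau> + of_int (int l * B * m' + D * n') / of_nat l"
      using l by (simp add: C field_simps)
    finally show ?thesis unfolding lat_def by (metis mult.left_commute)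
  qed
  have 1: "A * (D * m - c * n) + c * (A * n - int l * B * m) = m" for m n
  proof -
    have "A * (D * m - c * n) + c * (A * n - int l * B * m) = (A * D - B * (int l * c)) * m" by (simp add: algebra_simps)
    thus ?thesis using det C by simp
  qed
  have 2: "int l * B * (D * m - c * n) + D * (A * n - int l * B * m) = n" for m n
  proof -
    have "int l * B * (D * m - c * n) + D * (A * n - int l * B * m) = (A * D - B * (int l * c)) * n" by (simp add: algebra_simps)
    thus ?thesis using det C by simp
  qed
  have inv: "lat l \<tau> m n / J = lat l (moebius A B C D \<tau>) (D * m - c * n) (A * n - int l * B * m)" for m n
    using tr[of "D * m - c * n" "A * n - int l * B * m"] J by (simp only: 1 2) (simp add: field_simps)
  show "lat l \<tau> m n / J = lat l (moebius A B C D \<tau>) (D * m - c * n) (A * n - int l * B * m)"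
    by (rule inv)
  show "z / J \<in> lattice l (moebius A B C D \<tau>) \<longleftrightarrow> z \<in> lattice l \<tau>"
  proof
    assume "z / J \<in> lattice l (moebius A B C D \<tau>)"
    then obtain m n where "z / J = lat l (moebius A B C D \<tau>) m n" by (auto simp: lattice_def)
    hence "z = J * lat l (moebius A B C D \<tau>) m n" using J by (simp add: field_simps)
    thus "z \<in> lattice l \<tau>" by (simp only: tr lat_in_lattice)
  next
    assume "z \<in> lattice l \<tau>"
    then obtain m n where "z = lat l \<tau> m n" by (auto simp: lattice_def)
    thus "z / J \<in> lattice l (moebius A B C D \<tau>)" by (simp only: inv lat_in_lattice)
  qed
qed

lemma lattice_fundamental_domain:
  assumes l: "l > 0" and \<tau>: "\<tau> \<in> upper_half"
  obtains m n x t where "z = 2 * of_real pi * \<i> * (of_real x * \<tau> + of_real t / of_nat l) + lat l \<tau> m n"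
    and "x \<in> {0..1}" "t \<in> {0..1}"
proof -
  have pi: "complex_of_real pi \<noteq> 0" by simp
  define z' where "z' = z / (2 * of_real pi * \<i>)"
  define X where "X = Im z' / Im \<tau>"
  define T where "T = real l * (Re z' - X * Re \<tau>)"
  have z': "z' = of_real X * \<tau> + of_real T / of_nat l"
    using l \<tau> by (simp add: complex_eq_iff X_def T_def upper_half_def Re_divide_of_nat Im_divide_of_nat)
  have z: "z = 2 * of_real pi * \<i> * z'" using pi by (simp add: z'_def)
  show ?thesis
  proof (rule that[of "frac X" "frac T" "\<lfloor>X\<rfloor>" "\<lfloor>T\<rfloor>"])
    have X: "complex_of_real X = of_real (frac X) + of_int \<lfloor>X\<rfloor>"
      by (simp add: frac_def)
    have T: "complex_of_real T = of_real (frac T) + of_int \<lfloor>T\<rfloor>"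
      by (simp add: frac_def)
    show "z = 2 * of_real pi * \<i> * (of_real (frac X) * \<tau> + of_real (frac T) / of_nat l) + lat l \<tau> \<lfloor>X\<rfloor> \<lfloor>T\<rfloor>"
      unfolding z z' lat_def X T by (simp add: algebra_simps add_divide_distrib)
  qed (auto simp: frac_lt_1 less_imp_le)
qed

text \<open>Multipliers of modulus 1 make |f| periodic, so a bound on one closed period
  parallelogram bounds f everywhere off the lattice; Liouville applies once the singularities are
  removed.\<close>

lemma twisted_periodic_constant:
  fixes f :: "complex \<Rightarrow> complex"
  assumes l: "l > 0" and \<tau>: "\<tau> \<in> upper_half"
    and ana: "\<And>z. z \<notin> lattice l \<tau> \<Longrightarrow> f analytic_on {z}"
    and per: "\<And>z m n. z \<notin> lattice l \<tau> \<Longrightarrow> f (z + lat l \<tau> m n) = \<zeta> n * f z"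
    and \<zeta>: "\<And>n. norm (\<zeta> n) = 1"
    and D: "D analytic_on {0}" "eventually (\<lambda>z. f z = D z) (at 0)"
  obtains \<kappa> where "\<And>z. z \<notin> lattice l \<tau> \<Longrightarrow> f z = \<kappa>"
proof -
  define E where "E = remove_sings f"
  have Ef: "E z = f z" if "z \<notin> lattice l \<tau>" for z
    unfolding E_def by (rule remove_sings_at_analytic[OF ana[OF that]])
  \<comment> \<open>Removability at 0 is carried to every lattice point by translation.\<close>
  have at_lat: "eventually (\<lambda>u. u \<notin> lattice l \<tau> \<and> f u = \<zeta> n * D (u - lat l \<tau> m n)) (at (lat l \<tau> m n))" for m n
  proof -
    have "eventually (\<lambda>z. z \<notin> lattice l \<tau> \<and> f z = D z) (at 0)"
      using D(2) eventually_not_lattice[OF l \<tau>] by eventually_elim auto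
    hence "eventually (\<lambda>u. u - lat l \<tau> m n \<notin> lattice l \<tau> \<and> f (u - lat l \<tau> m n) = D (u - lat l \<tau> m n)) (at (lat l \<tau> m n))"
      by (subst at_to_0) (simp add: eventually_filtermap)
    thus ?thesis
    proof eventually_elim
      case (elim u)
      thus ?case using per[of "u - lat l \<tau> m n" m n] lattice_shift_iff[of "u - lat l \<tau> m n" l \<tau> m n] by simp
    qed
  qed
  have Eana: "E analytic_on {z}" for z
  proof (cases "z \<in> lattice l \<tau>")
    case False
    thus ?thesis unfolding E_def by (intro remove_sings_analytic_on ana)
  next
    case True
    then obtain m n where z: "z = lat l \<tau> m n" by (auto simp: lattice_def)
    define g where "g = (\<lambda>u. \<zeta> n * D (u - z))"
    have "D \<circ> (\<lambda>u. u - z) analytic_on {z}"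
      using D(1) by (intro analytic_on_compose) (auto intro!: analytic_intros)
    hence g: "g analytic_on {z}" unfolding g_def o_def by (intro analytic_intros)
    have ev: "eventually (\<lambda>u. f u = g u) (at z)"
      using at_lat[of n m] unfolding z[symmetric] by eventually_elim (simp add: g_def)
    have "isolated_singularity_at g z" by (rule isolated_singularity_at_analytic[OF g])
    hence iso: "isolated_singularity_at f z"
      using isolated_singularity_at_cong[OF ev refl] by simp
    have "(g \<longlongrightarrow> g z) (at z)"
      using analytic_at_imp_isCont[OF g] by (simp add: isCont_def)
    hence "(f \<longlongrightarrow> g z) (at z)"
      using tendsto_cong[OF ev] by simp
    thus ?thesis unfolding E_def by (rule remove_sings_analytic_at[OF iso])
  qed
  hence hol: "E holomorphic_on UNIV"
    using analytic_imp_holomorphic analytic_on_analytic_at by blast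
  define P where "P = (\<lambda>(x, t). 2 * of_real pi * \<i> * (of_real x * \<tau> + of_real t / of_nat l)) ` ({0..1::real} \<times> {0..1::real})"
  have "compact P" unfolding P_def case_prod_unfold
    by (intro compact_continuous_image compact_Times continuous_intros compact_Icc) (use l in auto)
  hence "compact (E ` P)"
    by (intro compact_continuous_image continuous_on_subset[OF holomorphic_on_imp_continuous_on[OF hol]]) auto
  then obtain B where B: "\<And>p. p \<in> P \<Longrightarrow> norm (E p) \<le> B"
    using compact_imp_bounded bounded_iff by (metis imageI)
  have bd: "norm (E z) \<le> B" if z: "z \<notin> lattice l \<tau>" for z
  proof -
    obtain m n x t where *: "z = 2 * of_real pi * \<i> * (of_real x * \<tau> + of_real t / of_nat l) + lat l \<tau> m n"
      "x \<in> {0..1}" "t \<in> {0..1}" using lattice_fundamental_domain[OF l \<tau>] by blast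
    define p where "p = 2 * of_real pi * \<i> * (of_real x * \<tau> + of_real t / of_nat l)"
    have p: "p \<in> P" using * by (auto simp: P_def p_def)
    have zp: "z = p + lat l \<tau> m n" using * by (simp add: p_def)
    have pL: "p \<notin> lattice l \<tau>" using z by (simp add: zp lattice_shift_iff)
    have "norm (E z) = norm (E p)"
      using per[OF pL, of m n] Ef[OF z] Ef[OF pL] \<zeta>[of n] by (simp add: zp norm_mult)
    thus ?thesis using B[OF p] by simp
  qed
  \<comment> \<open>At lattice points the bound passes to the limit by continuity of the
    extension.\<close>
  have "norm (E z) \<le> B" for z
  proof (cases "z \<in> lattice l \<tau>")
    case True
    then obtain m n where z: "z = lat l \<tau> m n" by (auto simp: lattice_def)
    have "(E \<longlongrightarrow> E z) (at z)"
      using analytic_at_imp_isCont[OF Eana] by (simp add: isCont_def)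
    moreover have "eventually (\<lambda>u. norm (E u) \<le> B) (at z)"
      using at_lat[of n m] unfolding z[symmetric] by eventually_elim (use bd in auto)
    ultimately show ?thesis by (rule Lim_norm_ubound[OF trivial_limit_at])
  qed (rule bd)
  hence "bounded (range E)" by (auto simp: bounded_iff)
  from Liouville_theorem[OF hol this] obtain \<kappa> where "\<And>z. E z = \<kappa>" by (auto simp: constant_on_def)
  thus ?thesis using that Ef by metis
qed

text \<open>The coefficient j - 1 of K is, up to a factor, the coefficient j - 2 of its derivative.
  The weight j is made up of 2 from the prefactor of modulus |J|^(-2) and j - 2 from rescaling z.
  Degree 0 also contains the Liouville constant, whence the restriction for j = 2.\<close>

lemma Kfps_weak_modularity:
  fixes A B C D :: int
  assumes l: "l > 0" and \<tau>: "\<tau> \<in> upper_half" and det: "A * D - B * C = 1"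
    and A: "[A = 1] (mod int l)" and C: "[C = 0] (mod int l)"
    and j: "j \<ge> 2" "j = 2 \<Longrightarrow> \<not> int l dvd a"
  shows "fps_nth (Kfps l (nome (moebius A B C D \<tau>)) a) (j - 1) = 
           (of_int C * \<tau> + of_int D) ^ j * fps_nth (Kfps l (nome \<tau>) a) (j - 1)"
proof -
  obtain c where c: "C = int l * c" using C by (auto simp: cong_0_iff)
  define J where "J = of_int C * \<tau> + of_int D"
  have J: "J \<noteq> 0" unfolding J_def by (rule moebius_denom_nonzero[OF \<tau> det])
  define \<tau>' where "\<tau>' = moebius A B C D \<tau>"
  have \<tau>': "\<tau>' \<in> upper_half" unfolding \<tau>'_def by (rule moebius_in_upper_half[OF \<tau> det])
  have latJ: "lat l \<tau> m n / J = lat l \<tau>' (D * m - c * n) (A * n - int l * B * m)" for m n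
    unfolding J_def \<tau>'_def by (rule lattice_moebius(1)[OF l \<tau> det c])
  have latticeJ: "z / J \<in> lattice l \<tau>' \<longleftrightarrow> z \<in> lattice l \<tau>" for z
    unfolding J_def \<tau>'_def by (rule lattice_moebius(2)[OF l \<tau> det c])
  define \<zeta> where "\<zeta> n = exp (2 * of_real pi * \<i> * of_int (a * n) / of_nat l)" for n
  have \<zeta>_cong: "\<zeta> n = \<zeta> n'" if "[n = n'] (mod int l)" for n n'
  proof -
    obtain k where k: "n' = n + int l * k" using \<open>[n = n'] (mod int l)\<close> by (metis cong_iff_lin)
    have "2 * of_real pi * \<i> * of_int (a * n') / of_nat l = 
       2 * of_real pi * \<i> * of_int (a * n) / of_nat l + of_int (a * k) * (2 * of_real pi * \<i>)"
      unfolding k using l by (simp add: field_simps)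
    thus ?thesis using exp_integer_2pi[of "of_int (a * k)"] by (simp add: \<zeta>_def exp_add mult_ac)
  qed
  \<comment> \<open>The factor 1/J^2 restores the polar part 1 / (l z^2) after the substitution z /
    J, so the two double poles cancel.\<close>
  define f where "f = (\<lambda>z. Hfun l a \<tau>' (z / J) / J\<^sup>2 - Hfun l a \<tau> z)"
  have per: "f (z + lat l \<tau> m n) = \<zeta> n * f z" if z: "z \<notin> lattice l \<tau>" for z m n
  proof -
    have zJ: "z / J \<notin> lattice l \<tau>'" using z latticeJ by simp
    have "[A * n - int l * B * m = 1 * n - 0] (mod int l)"
      by (intro cong_diff cong_mult A cong_refl) (simp add: cong_0_iff)
    hence "\<zeta> (A * n - int l * B * m) = \<zeta> n" by (intro \<zeta>_cong) simp
    hence "Hfun l a \<tau>' (z / J + lat l \<tau> m n / J) = \<zeta> n * Hfun l a \<tau>' (z / J)"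
      unfolding latJ Hfun_lattice[OF l \<tau>' zJ] by (simp add: \<zeta>_def)
    thus ?thesis using Hfun_lattice[OF l \<tau> z, of a m n]
      by (simp add: f_def add_divide_distrib \<zeta>_def algebra_simps)
  qed
  have ana: "f analytic_on {z}" if z: "z \<notin> lattice l \<tau>" for z
  proof -
    have "Hfun l a \<tau>' \<circ> (\<lambda>z. z / J) analytic_on {z}"
      using J by (intro analytic_on_compose) (auto intro!: analytic_intros Hfun_analytic[OF l \<tau>'] simp: latticeJ z)
    thus ?thesis unfolding f_def o_def
      by (intro analytic_intros Hfun_analytic[OF l \<tau> z]) (use J in auto)
  qed
  obtain D1 where D1: "D1 has_fps_expansion fps_deriv (Kfps l (nome \<tau>) a)"
    "eventually (\<lambda>z. Hfun l a \<tau> z = D1 z + 1 / (of_nat l * z\<^sup>2)) (at 0)"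
    using Hfun_expansion_at_0[OF l \<tau>] .
  obtain D2 where D2: "D2 has_fps_expansion fps_deriv (Kfps l (nome \<tau>') a)"
    "eventually (\<lambda>z. Hfun l a \<tau>' z = D2 z + 1 / (of_nat l * z\<^sup>2)) (at 0)"
    using Hfun_expansion_at_0[OF l \<tau>'] .
  define D0 where "D0 = (\<lambda>z. inverse (J\<^sup>2) * (D2 \<circ> (\<lambda>z. inverse J * z)) z - D1 z)"
  define G where "G = fps_const (inverse (J\<^sup>2)) * fps_compose (fps_deriv (Kfps l (nome \<tau>') a)) (fps_const (inverse J) * fps_X)
                       - fps_deriv (Kfps l (nome \<tau>) a)"
  have D0: "D0 has_fps_expansion G"
    unfolding D0_def G_def by (intro fps_expansion_intros D1 D2) auto
  have "filterlim (\<lambda>z. z / J) (at 0) (at 0)"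
    using J by (auto simp: filterlim_at eventually_at_filter intro!: tendsto_eq_intros)
  from eventually_compose_filterlim[OF D2(2) this]
  have "eventually (\<lambda>z. Hfun l a \<tau>' (z / J) = D2 (z / J) + 1 / (of_nat l * (z / J)\<^sup>2)) (at 0)" .
  with D1(2) have ev: "eventually (\<lambda>z. f z = D0 z) (at 0)"
  proof eventually_elim
    case (elim z)
    show ?case unfolding f_def D0_def elim o_def using J
      by (simp add: field_simps power2_eq_square)
  qed
  obtain \<kappa> where \<kappa>: "\<And>z. z \<notin> lattice l \<tau> \<Longrightarrow> f z = \<kappa>"
    using twisted_periodic_constant[where f = f and \<zeta> = \<zeta>, OF l \<tau> ana per _ has_fps_expansion_imp_analytic_0[OF D0] ev]
    by (auto simp: \<zeta>_def norm_exp_eq_Re Re_divide_of_nat)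
  \<comment> \<open>A shift by 2 pi i / l multiplies the constant by exp (2 pi i a / l), which
    differs from 1.\<close>
  have \<kappa>0: "\<kappa> = 0" if a: "\<not> int l dvd a"
  proof -
    obtain z where z: "z \<notin> lattice l \<tau>"
      using eventually_not_lattice[OF l \<tau>] eventually_happens trivial_limit_at by blast
    have "\<zeta> 1 * \<kappa> = \<kappa>"
      using per[OF z, of 0 1] \<kappa>[OF z] \<kappa>[of "z + lat l \<tau> 0 1"] z by (simp add: lattice_shift_iff)
    moreover have "\<zeta> 1 \<noteq> 1"
    proof
      assume "\<zeta> 1 = 1"
      then obtain k :: int where k: "2 * of_real pi * \<i> * of_int a / of_nat l = of_int (2 * k) * of_real pi * \<i>"
        using exp_eq_1[of "2 * of_real pi * \<i> * of_int a / of_nat l"] 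
        by (auto simp: \<zeta>_def complex_eq_iff Re_divide_of_nat Im_divide_of_nat)
      hence "(of_int a :: complex) = of_int (k * int l)" using l by (simp add: field_simps)
      hence "a = k * int l" by (simp only: of_int_eq_iff)
      thus False using a by simp
    qed
    ultimately show ?thesis by simp
  qed
  have ev': "eventually (\<lambda>z. D0 z = \<kappa>) (at 0)"
    using ev eventually_not_lattice[OF l \<tau>] by eventually_elim (use \<kappa> in auto)
  have "(D0 \<longlongrightarrow> D0 0) (at 0)"
    using has_fps_expansion_imp_continuous[OF D0, of UNIV] by (simp add: isCont_def)
  moreover have "(D0 \<longlongrightarrow> \<kappa>) (at 0)"
    using tendsto_cong[OF ev', of \<kappa>] by simp
  ultimately have "D0 0 = \<kappa>" using tendsto_unique[OF trivial_limit_at] by blast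
  hence ev'': "eventually (\<lambda>z. D0 z = \<kappa>) (nhds 0)"
    using ev' by (simp add: eventually_nhds_conv_at)
  have "(\<lambda>_. \<kappa>) has_fps_expansion G"
    by (rule iffD1[OF has_fps_expansion_cong[OF ev'' refl] D0])
  hence G: "G = fps_const \<kappa>"
    using fps_expansion_unique_complex has_fps_expansion_const by blast
  define n where "n = j - 2"
  have n: "j = n + 2" using j by (simp add: n_def)
  have "fps_nth G n = 0"
  proof (cases "n = 0")
    case True
    hence "\<not> int l dvd a" using j(2) n by simp
    thus ?thesis using \<kappa>0 G by simp
  qed (use G in simp)
  hence "inverse (J\<^sup>2) * (inverse J ^ n * (of_nat (Suc n) * fps_nth (Kfps l (nome \<tau>') a) (Suc n))) = 
         of_nat (Suc n) * fps_nth (Kfps l (nome \<tau>) a) (Suc n)"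
    by (simp add: G_def fps_compose_linear del: of_nat_Suc)
  hence "of_nat (Suc n) * fps_nth (Kfps l (nome \<tau>') a) (Suc n) = 
         of_nat (Suc n) * (J ^ (n + 2) * fps_nth (Kfps l (nome \<tau>) a) (Suc n))"
    using J by (simp add: power_add power_inverse power2_eq_square field_simps del: of_nat_Suc)
  hence "fps_nth (Kfps l (nome \<tau>') a) (Suc n) = J ^ (n + 2) * fps_nth (Kfps l (nome \<tau>) a) (Suc n)"
    by (subst (asm) mult_cancel_left) (auto simp del: of_nat_Suc)
  thus ?thesis by (simp add: n J_def \<tau>'_def)
qed

section \<open>Cusps and constant terms\<close>

lemma open_upper_half: "open upper_half"
  by (simp add: upper_half_def open_halfspace_Im_gt)

lemma power_le_fact_exp:
  fixes x :: real
  assumes "x \<ge> 0"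
  shows "x ^ n \<le> fact n * exp x"
proof -
  have "(\<Sum>i\<in>{n}. x ^ i /\<^sub>R fact i) \<le> suminf (\<lambda>i. x ^ i /\<^sub>R fact i)"
    by (rule sum_le_suminf[OF summable_exp_generic]) (use assms in auto)
  hence "x ^ n / fact n \<le> exp x" by (simp add: exp_def field_simps)
  thus ?thesis by (simp add: field_simps)
qed

text \<open>With y = pi Im \<open>\<tau>\<close> and r = exp (-y), |nome| is r^2. One factor r^(n+1)
  absorbs the coefficient bound through x^j <= j! exp x at x = (n+1) y; the other factors form a
  geometric series of sum r / (1 - r) <= 1/y.\<close>

lemma s_series_growth:
  assumes l: "l > 0" and j: "j \<ge> 1" and \<tau>: "\<tau> \<in> upper_half"
  shows "norm (s_series l j a C \<tau>) \<le> norm C + (2 * fact j / pi ^ Suc j) / Im \<tau> ^ Suc j"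
proof -
  define y where "y = pi * Im \<tau>"
  have y: "y > 0" using \<tau> by (simp add: y_def upper_half_def)
  define r where "r = exp (- y)"
  have r: "0 < r" "r < 1" using y by (auto simp: r_def)
  have bd: "norm (nome \<tau> ^ Suc n * s_coeff l j a (Suc n)) \<le> (2 * fact j / y ^ j * r) * r ^ n" for n
  proof -
    have 1: "norm (nome \<tau> ^ Suc n) = r ^ Suc n * exp (- (real (Suc n) * y))"
    proof -
      have "norm (nome \<tau>) = r * r" by (simp add: norm_nome r_def y_def exp_add[symmetric])
      hence "norm (nome \<tau> ^ Suc n) = r ^ Suc n * r ^ Suc n" by (simp only: norm_power power_mult_distrib)
      moreover have "r ^ Suc n = exp (- (real (Suc n) * y))"
        unfolding r_def exp_of_nat_mult[symmetric] by simp
      ultimately show ?thesis by simp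
    qed
    have "norm (s_coeff l j a (Suc n)) \<le> 2 * real (Suc n) ^ j" by (rule norm_s_coeff_le[OF j]) simp
    also have "real (Suc n) ^ j = (real (Suc n) * y) ^ j / y ^ j" using y by (simp add: power_mult_distrib del: of_nat_Suc)
    also have "\<dots> \<le> fact j * exp (real (Suc n) * y) / y ^ j"
      using y by (intro divide_right_mono power_le_fact_exp) auto
    finally have 2: "norm (s_coeff l j a (Suc n)) \<le> 2 * (fact j * exp (real (Suc n) * y) / y ^ j)" by simp
    have "norm (nome \<tau> ^ Suc n * s_coeff l j a (Suc n)) \<le> 
        (r ^ Suc n * exp (- (real (Suc n) * y))) * (2 * (fact j * exp (real (Suc n) * y) / y ^ j))"
      unfolding norm_mult 1 using 2 r by (intro mult_left_mono) auto
    also have "\<dots> = (2 * fact j / y ^ j * r) * r ^ n * (exp (- (real (Suc n) * y)) * exp (real (Suc n) * y))"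
      by (simp only: power_Suc times_divide_eq_left times_divide_eq_right mult_ac)
    also have "exp (- (real (Suc n) * y)) * exp (real (Suc n) * y) = 1"
      by (simp add: exp_add[symmetric] del: of_nat_Suc)
    finally show ?thesis by simp
  qed
  have geo: "(\<lambda>n. (2 * fact j / y ^ j * r) * r ^ n) sums ((2 * fact j / y ^ j * r) * (1 / (1 - r)))"
    using r by (intro sums_mult geometric_sums) auto
  have "norm (suminf (\<lambda>n. nome \<tau> ^ Suc n * s_coeff l j a (Suc n))) \<le> (2 * fact j / y ^ j * r) * (1 / (1 - r))"
    using norm_suminf_le[OF bd sums_summable[OF geo]] sums_unique[OF geo] by simp
  also have "\<dots> = 2 * fact j / y ^ j * (r / (1 - r))" by simp
  also have "\<dots> \<le> 2 * fact j / y ^ j * (1 / y)"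
  proof (intro mult_left_mono)
    have "1 + y \<le> exp y" by simp
    hence "r * (1 + y) \<le> r * exp y" using r by (intro mult_left_mono) auto
    also have "r * exp y = 1" by (simp add: r_def exp_add[symmetric])
    finally have "r * y \<le> 1 - r" by (simp add: algebra_simps)
    thus "r / (1 - r) \<le> 1 / y" using r y by (simp add: field_simps)
  qed (use y in auto)
  also have "\<dots> = (2 * fact j / pi ^ Suc j) / Im \<tau> ^ Suc j" by (simp add: y_def power_mult_distrib mult_ac)
  finally have "norm (suminf (\<lambda>n. nome \<tau> ^ Suc n * s_coeff l j a (Suc n))) \<le> (2 * fact j / pi ^ Suc j) / Im \<tau> ^ Suc j" .
  moreover have "norm (s_series l j a C \<tau>) \<le> norm C + norm (suminf (\<lambda>n. nome \<tau> ^ Suc n * s_coeff l j a (Suc n)))"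
    unfolding s_series_altdef[OF \<tau>] by (rule norm_triangle_ineq)
  ultimately show ?thesis by linarith
qed

section \<open>From moderate growth to boundedness at the cusps\<close>

lemma periodic_int:
  fixes g :: "complex \<Rightarrow> complex"
  assumes per: "\<And>\<tau>. \<tau> \<in> upper_half \<Longrightarrow> g (\<tau> + of_nat l) = g \<tau>" and \<tau>: "\<tau> \<in> upper_half"
  shows "g (\<tau> + of_int k * of_nat l) = g \<tau>"
proof -
  have U: "\<sigma> + of_nat n * of_nat l \<in> upper_half" if "\<sigma> \<in> upper_half" for \<sigma> and n
    using that by (simp add: upper_half_def)
  have nat: "g (\<sigma> + of_nat n * of_nat l) = g \<sigma>" if "\<sigma> \<in> upper_half" for \<sigma> n
  proof (induction n)
    case (Suc n)
    have "g (\<sigma> + of_nat n * of_nat l + of_nat l) = g (\<sigma> + of_nat n * of_nat l)"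
      by (rule per[OF U[OF that]])
    thus ?case using Suc by (simp add: algebra_simps)
  qed simp
  show ?thesis
  proof (cases "k \<ge> 0")
    case True
    thus ?thesis using nat[OF \<tau>, of "nat k"] by simp
  next
    case False
    have "\<tau> + of_int k * of_nat l \<in> upper_half" using \<tau> by (simp add: upper_half_def)
    from nat[OF this, of "nat (-k)"] show ?thesis using False by simp
  qed
qed

text \<open>
  A periodic function of moderate growth is a function of \<open>exp (2\<pi>i\<tau>/l)\<close> with a
  removable singularity at the origin.
\<close>
lemma periodic_moderate_growth_bounded:
  fixes g :: "complex \<Rightarrow> complex"
  assumes l: "l > 0" and hol: "g holomorphic_on upper_half"
    and per: "\<And>\<tau>. \<tau> \<in> upper_half \<Longrightarrow> g (\<tau> + of_nat l) = g \<tau>"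
    and growth: "\<And>\<tau>. Im \<tau> \<ge> 1 \<Longrightarrow> norm (g \<tau>) \<le> K * Im \<tau> ^ N"
  shows "\<exists>B R. \<forall>\<tau>\<in>upper_half. Im \<tau> \<ge> R \<longrightarrow> norm (g \<tau>) \<le> B"
proof -
  define c where "c = of_nat l / (2 * of_real pi * \<i>)"
  have c: "c \<noteq> 0" using l by (simp add: c_def)
  have Imc: "Im (c * w) = - (real l / (2 * pi)) * Re w" for w
    by (simp add: c_def Im_divide field_simps power2_eq_square)
  have cU: "c * w \<in> upper_half" if "Re w < 0" for w
    unfolding upper_half_def mem_Collect_eq Imc using l that by (simp add: divide_neg_pos mult_pos_neg)
  \<comment> \<open>Here c Ln w is a preimage of w under \<open>\<tau>\<close> -> exp (2 pi i
    \<open>\<tau>\<close> / l). Any other logarithm moves it by a multiple of the period l, so the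
    branch does not matter.\<close>
  define H where "H w = g (c * Ln w)" for w
  have branch: "g (c * u) = H (exp u)" if u: "Re u < 0" for u
  proof -
    have "exp (Ln (exp u)) = exp u" by simp
    then obtain k :: int where k: "Ln (exp u) = u + (of_int (2 * k) * pi) * \<i>"
      using exp_eq by blast
    have "c * Ln (exp u) = c * u + of_int k * of_nat l"
      unfolding k by (simp add: c_def field_simps)
    moreover have "g (c * u + of_int k * of_nat l) = g (c * u)"
      by (rule periodic_int[where g = g and l = l]) (use per cU[OF u] in auto)
    ultimately show ?thesis by (simp add: H_def)
  qed
  have holH: "H holomorphic_on (ball 0 1 - {0})"
  proof -
    have "H analytic_on {w}" if w: "w \<in> ball 0 1 - {0}" for w
    proof -
      \<comment> \<open>A logarithm analytic near w even on the negative axis, where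
        \<open>Ln\<close> jumps: z / w stays near 1.\<close>
      define L where "L = (\<lambda>z. Ln (z / w) + Ln w)"
      have eL: "exp (L z) = z" if "z \<noteq> 0" for z using that w by (simp add: L_def exp_add)
      have L: "L analytic_on {w}" unfolding L_def using w by (auto intro!: analytic_intros)
      have "Re (L w) < 0" using w by (simp add: L_def)
      hence "c * L w \<in> upper_half" by (rule cU)
      hence "g analytic_on {c * L w}"
        using hol analytic_on_open[OF open_upper_half] analytic_on_subset by blast
      hence "g \<circ> (\<lambda>z. c * L z) analytic_on {w}"
        by (intro analytic_on_compose) (auto intro!: analytic_intros L)
      moreover have "eventually (\<lambda>z. z \<in> ball 0 1 - {0}) (nhds w)"
        using w by (intro eventually_nhds_in_open) auto
      hence "eventually (\<lambda>z. (g \<circ> (\<lambda>z. c * L z)) z = H z) (nhds w)"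
      proof eventually_elim
        case (elim z)
        have "Re (L z) = ln (norm z)"
          using eL[of z] elim by (metis DiffD2 Re_Ln insertI1 norm_exp_eq_Re ln_exp)
        hence "Re (L z) < 0" using elim by simp
        from branch[OF this] show ?case using eL[of z] elim by simp
      qed
      ultimately show ?thesis using analytic_at_cong by blast
    qed
    thus ?thesis using analytic_imp_holomorphic analytic_on_analytic_at by blast
  qed
  \<comment> \<open>The growth in Im \<open>\<tau>\<close> becomes a power of log (1/|w|), which the
    factor |w| outweighs; hence the singularity at 0 is removable.\<close>
  have lim: "((\<lambda>w. (w - 0) * H w) \<longlongrightarrow> 0) (at 0)"
  proof (rule Lim_null_comparison)
    define M where "M = K * (real l / (2 * pi)) ^ N"
    have ln_lim: "filterlim (\<lambda>w::complex. - ln (norm w)) at_top (at 0)"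
    proof -
      have "filterlim (\<lambda>w::complex. norm w) (at_right 0) (at 0)"
        by (auto simp: filterlim_at eventually_at_filter intro!: tendsto_eq_intros)
      from filterlim_compose[OF ln_at_0 this] show ?thesis
        by (simp add: filterlim_uminus_at_bot)
    qed
    from filterlim_compose[OF tendsto_power_div_exp_0[of N] ln_lim]
    have "((\<lambda>w::complex. (- ln (norm w)) ^ N / exp (- ln (norm w))) \<longlongrightarrow> 0) (at 0)" .
    from tendsto_mult_right_zero[OF this]
    show "((\<lambda>w::complex. M * ((- ln (norm w)) ^ N / exp (- ln (norm w)))) \<longlongrightarrow> 0) (at 0)" .
    have "eventually (\<lambda>w::complex. - ln (norm w) \<ge> 2 * pi / real l) (at 0)"
      using ln_lim by (simp add: filterlim_at_top)
    moreover have "eventually (\<lambda>w::complex. w \<noteq> 0) (at 0)" by (simp add: eventually_at_filter)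
    ultimately show "eventually (\<lambda>w. norm ((w - 0) * H w) \<le> M * ((- ln (norm w)) ^ N / exp (- ln (norm w)))) (at 0)"
    proof eventually_elim
      case (elim w)
      have Im: "Im (c * Ln w) = real l / (2 * pi) * (- ln (norm w))" unfolding Imc using elim by simp
      have "1 = real l / (2 * pi) * (2 * pi / real l)" using l by simp
      also have "\<dots> \<le> Im (c * Ln w)" unfolding Im using elim by (intro mult_left_mono) auto
      finally have "norm (H w) \<le> K * Im (c * Ln w) ^ N" unfolding H_def by (rule growth)
      hence "norm (H w) \<le> M * (- ln (norm w)) ^ N" unfolding Im M_def by (simp only: power_mult_distrib mult.assoc)
      hence le: "norm w * norm (H w) \<le> norm w * (M * (- ln (norm w)) ^ N)" by (intro mult_left_mono) auto
      define E where "E = exp (- ln (norm w))"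
      have "E = inverse (norm w)" using elim by (simp add: E_def exp_minus)
      hence E: "norm w = 1 / E" by (simp add: inverse_eq_divide)
      have eq: "norm w * x = x / E" for x unfolding E by simp
      have "norm ((w - 0) * H w) \<le> M * (- ln (norm w)) ^ N / E"
        using le unfolding norm_mult diff_zero eq .
      thus ?case by (simp only: E_def times_divide_eq_right)
    qed
  qed
  have "0 \<in> interior (ball 0 1 :: complex set)" by simp
  from holomorphic_on_extend_lim[OF holH this] lim obtain h where h: "h holomorphic_on ball 0 1"
    "\<And>z. z \<in> ball 0 1 - {0} \<Longrightarrow> h z = H z" by blast
  have "compact (h ` cball 0 (1/2))"
    by (intro compact_continuous_image continuous_on_subset[OF holomorphic_on_imp_continuous_on[OF h(1)]]) auto
  then obtain B where B: "\<And>w. w \<in> cball 0 (1/2) \<Longrightarrow> norm (h w) \<le> B"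
    using compact_imp_bounded bounded_iff by (metis imageI)
  have "norm (g \<tau>) \<le> B" if \<tau>: "Im \<tau> \<ge> real l" for \<tau>
  proof -
    define u where "u = \<tau> / c"
    have cu: "c * u = \<tau>" using c by (simp add: u_def)
    have Reu: "Re u = - (2 * pi / real l) * Im \<tau>" using Imc[of u] l unfolding cu by (simp add: field_simps)
    have "2 * pi / real l * real l \<le> 2 * pi / real l * Im \<tau>" using \<tau> by (intro mult_left_mono) auto
    hence Reu': "Re u \<le> - 2 * pi" using Reu l by simp
    have "norm (exp u) = exp (Re u)" by (simp add: norm_exp_eq_Re)
    also have "\<dots> \<le> exp (- 1)" using Reu' pi_gt3 by simp
    also have "\<dots> \<le> 1 / 2"
    proof -
      have "2 \<le> exp (1 :: real)" using exp_ge_add_one_self[of 1] by simp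
      hence "inverse (exp 1) \<le> inverse (2 :: real)" by (intro le_imp_inverse_le) auto
      thus ?thesis by (simp only: exp_minus inverse_eq_divide)
    qed
    finally have n: "norm (exp u) \<le> 1 / 2" .
    have "g \<tau> = H (exp u)" using branch[of u] Reu' pi_gt3 by (simp add: cu)
    also have "\<dots> = h (exp u)" using h(2)[of "exp u"] Reu' pi_gt3 by simp
    finally show ?thesis using B[of "exp u"] n by simp
  qed
  thus ?thesis by blast
qed

text \<open>The cusp condition is traded for polynomial growth towards the real axis. A slashed
  function has period l because conjugates of the translation by l lie in Gamma_1(l), and it
  inherits moderate growth at infinity, so it is bounded there.\<close>

lemma modular_formI:
  assumes l: "l > 0" and hol: "f holomorphic_on upper_half"
    and weak: "\<And>A B C D \<tau>. \<tau> \<in> upper_half \<Longrightarrow> A * D - B * C = 1 \<Longrightarrow> [A = 1] (mod int l) \<Longrightarrow>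
                 [C = 0] (mod int l) \<Longrightarrow> f (moebius A B C D \<tau>) = (of_int C * \<tau> + of_int D) ^ j * f \<tau>"
    and growth: "\<And>\<tau>. \<tau> \<in> upper_half \<Longrightarrow> norm (f \<tau>) \<le> K1 + K2 / Im \<tau> ^ N"
    and K: "K1 \<ge> 0" "K2 \<ge> 0"
  shows "modular_form l j f"
  unfolding modular_form_def
proof (intro conjI allI impI ballI)
  show "f holomorphic_on upper_half" by fact
next
  fix a b c d :: int and \<tau>
  assume "a * d - b * c = 1" "[a = 1] (mod int l)" "[c = 0] (mod int l)" "\<tau> \<in> upper_half"
  thus "slash j a b c d f \<tau> = f \<tau>"
    using weak[of \<tau> a d b c] moebius_denom_nonzero[of \<tau> a d b c] by (simp add: slash_def)
next
  fix a b c d :: int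
  assume det: "a * d - b * c = 1"
  define J where "J \<tau> = of_int c * \<tau> + of_int d" for \<tau> :: complex
  have J: "J \<tau> \<noteq> 0" if "\<tau> \<in> upper_half" for \<tau>
    unfolding J_def by (rule moebius_denom_nonzero[OF that det])
  let ?g = "slash j a b c d f"
  let ?M = "moebius a b c d"
  have holM: "?M holomorphic_on upper_half"
    unfolding moebius_def[abs_def] using J by (auto intro!: holomorphic_intros simp: J_def)
  have "f \<circ> ?M holomorphic_on upper_half"
    by (rule holomorphic_on_compose_gen[OF holM hol]) (use moebius_in_upper_half det in auto)
  hence holg: "?g holomorphic_on upper_half"
    unfolding slash_def[abs_def] o_def using J by (auto intro!: holomorphic_intros simp: J_def)
  have per: "?g (\<tau> + of_nat l) = ?g \<tau>" if \<tau>: "\<tau> \<in> upper_half" for \<tau>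
  proof -
    define \<sigma> where "\<sigma> = ?M \<tau>"
    have \<sigma>: "\<sigma> \<in> upper_half" unfolding \<sigma>_def by (rule moebius_in_upper_half[OF \<tau> det])
    define L where "L = int l"
    have cdet: "of_int a * of_int d - of_int b * of_int c = (1::complex)"
      using det by (metis of_int_1 of_int_diff of_int_mult)
    have J\<sigma>: "J \<tau> * \<sigma> = of_int a * \<tau> + of_int b" using J[OF \<tau>] by (simp add: \<sigma>_def moebius_def J_def)
    \<comment> \<open>The entries of M T M^(-1), where M is the matrix with rows (a, b) and (c, d),
      and T is translation by l.\<close>
    define A where "A = 1 - L * a * c"
    define B where "B = L * a * a"
    define C where "C = - L * c * c"
    define D where "D = 1 + L * a * c"
    have det': "A * D - B * C = 1" by (simp add: A_def B_def C_def D_def algebra_simps)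
    have den: "J \<tau> * (of_int C * \<sigma> + of_int D) = J (\<tau> + of_nat l)"
    proof -
      have "J \<tau> * (of_int C * \<sigma> + of_int D) = of_int C * (J \<tau> * \<sigma>) + of_int D * J \<tau>" by (simp add: algebra_simps)
      also have "\<dots> = of_int c * \<tau> + of_int d + of_nat l * of_int c * (of_int a * of_int d - of_int b * of_int c)"
        unfolding J\<sigma> by (simp add: C_def D_def J_def L_def algebra_simps)
      finally show ?thesis unfolding cdet by (simp add: J_def algebra_simps)
    qed
    have num: "J \<tau> * (of_int A * \<sigma> + of_int B) = of_int a * (\<tau> + of_nat l) + of_int b"
    proof -
      have "J \<tau> * (of_int A * \<sigma> + of_int B) = of_int A * (J \<tau> * \<sigma>) + of_int B * J \<tau>" by (simp add: algebra_simps)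
      also have "\<dots> = of_int a * \<tau> + of_int b + of_nat l * of_int a * (of_int a * of_int d - of_int b * of_int c)"
        unfolding J\<sigma> by (simp add: A_def B_def J_def L_def algebra_simps)
      finally show ?thesis unfolding cdet by (simp add: algebra_simps)
    qed
    have "?M (\<tau> + of_nat l) = (J \<tau> * (of_int A * \<sigma> + of_int B)) / (J \<tau> * (of_int C * \<sigma> + of_int D))"
      unfolding num den by (simp add: moebius_def J_def)
    also have "\<dots> = moebius A B C D \<sigma>" using J[OF \<tau>] by (simp add: moebius_def)
    finally have M: "?M (\<tau> + of_nat l) = moebius A B C D \<sigma>" .
    have "[A = 1] (mod int l)" "[C = 0] (mod int l)"
      by (auto simp: A_def C_def L_def cong_iff_dvd_diff mult.assoc)
    hence "f (moebius A B C D \<sigma>) = (of_int C * \<sigma> + of_int D) ^ j * f \<sigma>"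
      by (intro weak \<sigma> det')
    hence "?g (\<tau> + of_nat l) = (of_int C * \<sigma> + of_int D) ^ j * f \<sigma> / (J \<tau> * (of_int C * \<sigma> + of_int D)) ^ j"
      unfolding den by (simp add: slash_def M J_def)
    also have "\<dots> = f \<sigma> / J \<tau> ^ j"
      using moebius_denom_nonzero[OF \<sigma> det'] by (simp add: power_mult_distrib)
    finally show ?thesis by (simp add: slash_def \<sigma>_def J_def)
  qed
  define M where "M = \<bar>of_int c\<bar> * (real l + 1) + \<bar>of_int d\<bar>"
  have M0: "M \<ge> 0" by (simp add: M_def)
  have gr: "norm (?g \<tau>) \<le> (K1 + K2 * (M\<^sup>2) ^ N) * Im \<tau> ^ N" if \<tau>: "Im \<tau> \<ge> 1" for \<tau>
  proof -
    \<comment> \<open>Periodicity permits 0 <= Re t <= l; only then is |t|, and with it |J t|,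
      bounded by a multiple of Im t.\<close>
    define k where "k = \<lfloor>Re \<tau> / real l\<rfloor>"
    define t where "t = \<tau> + of_int (- k) * of_nat l"
    have U: "\<tau> \<in> upper_half" "t \<in> upper_half" using \<tau> by (auto simp: upper_half_def t_def)
    have gt: "?g t = ?g \<tau>" unfolding t_def using periodic_int[of ?g l \<tau> "- k"] per U by blast
    have Imt: "Im t = Im \<tau>" by (simp add: t_def)
    have "of_int k \<le> Re \<tau> / real l" "Re \<tau> / real l < of_int k + 1" unfolding k_def by linarith+
    hence "0 \<le> Re t" "Re t \<le> real l" using l by (simp_all add: t_def field_simps)
    hence "norm t \<le> real l * 1 + Im t"
      using cmod_le[of t] Imt \<tau> by simp
    also have "\<dots> \<le> (real l + 1) * Im t" using \<tau> Imt l by (simp add: algebra_simps)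
    finally have nt: "norm t \<le> (real l + 1) * Im t" .
    have "norm (J t) \<le> \<bar>of_int c\<bar> * norm t + \<bar>of_int d\<bar> * 1"
      unfolding J_def by (rule order_trans[OF norm_triangle_ineq]) (simp add: norm_mult)
    also have "\<dots> \<le> \<bar>of_int c\<bar> * ((real l + 1) * Im t) + \<bar>of_int d\<bar> * Im t"
      using nt \<tau> Imt by (intro add_mono mult_left_mono) auto
    also have "\<dots> = M * Im t" by (simp add: M_def algebra_simps)
    finally have Jle: "norm (J t) \<le> M * Im t" .
    \<comment> \<open>Needed to discard the division by J^j: either c = 0 and |d| = 1, or |Im (J t)|
      = |c| Im t >= 1.\<close>
    have Jge: "norm (J t) \<ge> 1"
    proof (cases "c = 0")
      case True
      hence "\<bar>d\<bar> = 1" using det by (metis abs_mult abs_one diff_zero mult_zero_right zdvd1_eq dvd_triv_right)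
      hence "\<bar>real_of_int d\<bar> = 1" by (metis of_int_1 of_int_abs)
      thus ?thesis using True by (simp add: J_def)
    next
      case False
      hence "1 \<le> \<bar>real_of_int c\<bar>" by linarith
      hence "1 * 1 \<le> \<bar>real_of_int c\<bar> * Im t" using \<tau> Imt by (intro mult_mono) auto
      also have "\<dots> = \<bar>Im (J t)\<bar>" using \<tau> Imt by (simp add: J_def abs_mult)
      also have "\<dots> \<le> norm (J t)" by (rule abs_Im_le_cmod)
      finally show ?thesis by simp
    qed
    have MU: "?M t \<in> upper_half" by (rule moebius_in_upper_half[OF U(2) det])
    have y: "Im t > 0" using \<tau> Imt by simp
    have "1 / Im (?M t) = (norm (J t))\<^sup>2 / Im t"
      using Im_moebius[OF U(2) det] by (simp add: J_def)
    also have "\<dots> \<le> (M * Im t)\<^sup>2 / Im t" using Jle y by (intro divide_right_mono power_mono) auto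
    also have "\<dots> = M\<^sup>2 * Im t" using y by (simp add: power2_eq_square)
    finally have inv: "1 / Im (?M t) \<le> M\<^sup>2 * Im t" .
    have "norm (f (?M t)) \<le> K1 + K2 * (1 / Im (?M t)) ^ N"
      using growth[OF MU] by (simp add: power_one_over divide_inverse power_inverse)
    also have "\<dots> \<le> K1 * 1 + K2 * (M\<^sup>2 * Im t) ^ N"
      using inv MU K by (intro add_mono mult_left_mono power_mono) (auto simp: upper_half_def)
    also have "\<dots> \<le> K1 * Im t ^ N + K2 * (M\<^sup>2 * Im t) ^ N"
      using \<tau> Imt K by (intro add_mono mult_left_mono one_le_power) auto
    also have "\<dots> = (K1 + K2 * (M\<^sup>2) ^ N) * Im t ^ N" by (simp add: power_mult_distrib algebra_simps)
    finally have fM: "norm (f (?M t)) \<le> (K1 + K2 * (M\<^sup>2) ^ N) * Im t ^ N" .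
    have "norm (?g t) = norm (f (?M t)) / norm (J t) ^ j" by (simp add: slash_def J_def norm_divide norm_power)
    also have "\<dots> \<le> norm (f (?M t)) / 1"
      using Jge by (intro divide_left_mono one_le_power mult_pos_pos zero_less_power) auto
    also have "\<dots> \<le> (K1 + K2 * (M\<^sup>2) ^ N) * Im t ^ N" using fM by simp
    finally show ?thesis by (simp add: gt Imt)
  qed
  show "\<exists>B R. \<forall>\<tau>\<in>upper_half. R \<le> Im \<tau> \<longrightarrow> norm (?g \<tau>) \<le> B"
    by (rule periodic_moderate_growth_bounded[OF l holg per gr])
qed

lemma s_series_modular_form:
  assumes l: "l > 0" and j: "j \<ge> 2" "j = 2 \<Longrightarrow> \<not> int l dvd a"
  shows "modular_form l j (s_series l j a (fact (j - 1) * fps_nth (Gfps l a) (j - 1)))"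
proof (rule modular_formI[OF l])
  show "s_series l j a (fact (j - 1) * fps_nth (Gfps l a) (j - 1)) holomorphic_on upper_half"
    using j by (intro holomorphic_onI) (meson s_series_has_derivative field_differentiable_def field_differentiable_at_within one_le_numeral order_trans)
next
  fix A B C D :: int and \<tau>
  assume *: "\<tau> \<in> upper_half" "A * D - B * C = 1" "[A = 1] (mod int l)" "[C = 0] (mod int l)"
  have "j \<ge> 1" using j by simp
  note eq = s_series_eq_Kfps[OF _ this, of _ l a]
  show "s_series l j a (fact (j - 1) * fps_nth (Gfps l a) (j - 1)) (moebius A B C D \<tau>) = 
        (of_int C * \<tau> + of_int D) ^ j * s_series l j a (fact (j - 1) * fps_nth (Gfps l a) (j - 1)) \<tau>"
    unfolding eq[OF *(1)] eq[OF moebius_in_upper_half[OF *(1,2)]] using Kfps_weak_modularity[OF l * j] by simp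
next
  fix \<tau> assume "\<tau> \<in> upper_half"
  thus "norm (s_series l j a (fact (j - 1) * fps_nth (Gfps l a) (j - 1)) \<tau>) \<le> 
        norm (fact (j - 1) * fps_nth (Gfps l a) (j - 1)) + (2 * fact j / pi ^ Suc j) / Im \<tau> ^ Suc j"
    using j by (intro s_series_growth l) auto
qed auto

text \<open>The two series differ by the constant C - C', which would transform with weight j >= 1.
  The matrix with rows (1, 0) and (l, 1) at the point i rules this out, as |l i + 1| > 1.\<close>

lemma modular_form_s_series_unique:
  assumes l: "l > 0" and j: "j \<ge> 1" and C: "modular_form l j (s_series l j a C)" and C': "modular_form l j (s_series l j a C')"
  shows "C = C'"
proof -
  have i: "\<i> \<in> upper_half" by (simp add: upper_half_def)
  define J where "J = of_int (int l) * \<i> + of_int 1"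
  have eq: "s_series l j a C (moebius 1 0 (int l) 1 \<i>) = J ^ j * s_series l j a C \<i>"
    if "modular_form l j (s_series l j a C)" for C
  proof -
    have "slash j 1 0 (int l) 1 (s_series l j a C) \<i> = s_series l j a C \<i>"
      using that i unfolding modular_form_def by (auto simp: cong_0_iff)
    moreover have "J \<noteq> 0" unfolding J_def using moebius_denom_nonzero[OF i, of 1 1 0 "int l"] by simp
    ultimately show ?thesis by (simp add: slash_def J_def field_simps)
  qed
  have m: "moebius 1 0 (int l) 1 \<i> \<in> upper_half" by (rule moebius_in_upper_half[OF i]) simp
  have "s_series l j a C \<tau> - s_series l j a C' \<tau> = C - C'" if "\<tau> \<in> upper_half" for \<tau>
    by (simp add: s_series_altdef[OF that])
  from this[OF i] this[OF m] have "C - C' = J ^ j * (C - C')"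
    unfolding eq[OF C] eq[OF C'] by (simp add: right_diff_distrib[symmetric])
  hence "(C - C') * (J ^ j - 1) = 0" by (simp add: algebra_simps)
  moreover have "J ^ j \<noteq> 1"
  proof
    assume "J ^ j = 1"
    hence "norm J ^ j = 1" by (metis norm_one norm_power)
    moreover have "norm J > 1"
    proof -
      have "norm J = sqrt (1 + (real l)\<^sup>2)" by (simp add: J_def cmod_def)
      thus ?thesis using l by simp
    qed
    moreover have "1 < norm J ^ j" using \<open>norm J > 1\<close> j by (intro one_less_power) auto
    ultimately show False by simp
  qed
  ultimately show ?thesis by simp
qed

text \<open>The prescribed constants in weight 1 and in the quasimodular case, and the definite
  description elsewhere, all become Taylor coefficients of the same elementary function.\<close>

lemma s_const_eq:
  assumes l: "l > 0" and j: "j \<ge> 1"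
  shows "s_const l j a = fact (j - 1) * fps_nth (Gfps l a) (j - 1)"
proof (cases "j = 1 \<or> j = 2 \<and> int l dvd a")
  case True
  thus ?thesis using Gfps_nth_0[OF l, of a] Gfps_nth_1[OF l, of a] by (auto simp: s_const_def)
next
  case False
  have "(THE C. modular_form l j (s_series l j a C)) = fact (j - 1) * fps_nth (Gfps l a) (j - 1)"
  proof (rule the_equality)
    show m: "modular_form l j (s_series l j a (fact (j - 1) * fps_nth (Gfps l a) (j - 1)))"
      using False j by (intro s_series_modular_form l) auto
    show "C = fact (j - 1) * fps_nth (Gfps l a) (j - 1)" if "modular_form l j (s_series l j a C)" for C
      using modular_form_s_series_unique[OF l j that m] .
  qed
  thus ?thesis using False by (auto simp: s_const_def)
qed

lemma s_tilde_eq_Kfps: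
  assumes "l > 0" "j \<ge> 1" "\<tau> \<in> upper_half"
  shows "s_tilde l j a \<tau> = fact (j - 1) * fps_nth (Kfps l (nome \<tau>) a) (j - 1)"
  unfolding s_tilde_def s_const_eq[OF assms(1,2)] by (rule s_series_eq_Kfps[OF assms(3,2)])

lemma deriv_upper_s_tilde:
  assumes "j \<ge> 1" "\<tau> \<in> upper_half"
  shows "deriv_upper (s_tilde l j a) \<tau> = - 2 * of_real pi * \<i> * fact j * fps_nth (Pfps l (nome \<tau>) a) j"
  using DERIV_imp_deriv[OF s_series_has_derivative[OF assms(2,1)]] assms(2)
  by (simp add: deriv_upper_def s_tilde_def)

section \<open>The three-term relation\<close>

lemma has_sum_product_complex:
  fixes f g :: "_ \<Rightarrow> complex"
  assumes f: "(f has_sum a) A" and g: "(g has_sum b) B"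
  shows "((\<lambda>(x, y). f x * g y) has_sum (a * b)) (A \<times> B)"
proof -
  have abs: "(\<lambda>x. norm (h x)) summable_on C" if "(h has_sum c) C" for h :: "'z \<Rightarrow> complex" and c C
    using has_sum_imp_summable[OF that] summable_on_iff_abs_summable_on_complex by blast
  have "(\<lambda>p. norm (case p of (x, y) \<Rightarrow> f x * g y)) summable_on A \<times> B"
  proof (rule summable_on_SigmaI)
    show "((\<lambda>y. norm (case (x, y) of (x, y) \<Rightarrow> f x * g y)) has_sum norm (f x) * infsum (\<lambda>y. norm (g y)) B) B" for x
      using has_sum_cmult_right[OF has_sum_infsum[OF abs[OF g]], of "norm (f x)"] by (simp add: norm_mult)
    show "(\<lambda>x. norm (f x) * infsum (\<lambda>y. norm (g y)) B) summable_on A"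
      by (rule summable_on_cmult_left[OF abs[OF f]])
  qed auto
  hence summ: "(\<lambda>(x, y). f x * g y) summable_on A \<times> B" by (rule abs_summable_summable)
  have inner: "((\<lambda>y. case (x, y) of (x, y) \<Rightarrow> f x * g y) has_sum f x * b) B" for x
    using has_sum_cmult_right[OF g, of "f x"] by simp
  show ?thesis
    by (rule has_sum_SigmaI[OF inner has_sum_cmult_left[OF f] summ])
qed

text \<open>On a degenerate line the left side collapses; d = e ~= 0 gives phi(d) (1/2 + 1/2) -
  phi(d)^2 = phi(d) phi(-d). All three lines meet at the origin, where 1/4 = 3/12.\<close>

lemma phi_three_term:
  assumes q: "0 < norm q" "norm q < 1"
  shows "phi q e * phi q (d - e) + phi q d * phi q (e - d) - phi q d * phi q e = 
         of_bool (d = e) * psi q d + of_bool (e = 0) * psi q d + of_bool (d = 0) * psi q e"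
proof -
  have u: "phi q (- x) = 1 - phi q x" if "x \<noteq> 0" for x by (rule phi_uminus[OF q that])
  consider "d = 0" "e = 0" | "d = 0" "e \<noteq> 0" | "d \<noteq> 0" "e = 0" | "d = e" "d \<noteq> 0" | "d \<noteq> 0" "e \<noteq> 0" "d \<noteq> e" by auto
  thus ?thesis
  proof cases
    case 5
    define x where "x = q powi d"
    define y where "y = q powi e"
    have q0: "q \<noteq> 0" using q by auto
    have xy: "x \<noteq> 0" "y \<noteq> 0" "1 - x \<noteq> 0" "1 - y \<noteq> 0" 
      using powi_neq_1[OF q, of d] powi_neq_1[OF q, of e] 5 q0 by (auto simp: x_def y_def)
    have p: "q powi (d - e) = x / y" "q powi (e - d) = y / x"
      using q0 by (simp_all add: x_def y_def power_int_diff)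
    have "x \<noteq> y" using powi_neq_1[OF q, of "d - e"] 5 xy p by auto
    hence ne: "y - x \<noteq> 0" "x - y \<noteq> 0" by auto
    have "phi q (d - e) = 1 / (1 - x / y)" "phi q (e - d) = 1 / (1 - y / x)"
      using 5 by (simp_all add: phi_def p)
    moreover have "1 / (1 - x / y) = y / (y - x)" "1 / (1 - y / x) = x / (x - y)"
      using xy ne by (simp_all add: field_simps)
    moreover have "phi q d = 1 / (1 - x)" "phi q e = 1 / (1 - y)" using 5 by (simp_all add: phi_def x_def y_def)
    moreover have "1 / (1 - y) * (y / (y - x)) + 1 / (1 - x) * (x / (x - y)) - 1 / (1 - x) * (1 / (1 - y)) = 0"
    proof -
      have "x / (x - y) = - x / (y - x)" using minus_divide_right[of x "y - x"] by simp
      hence "1 / (1 - y) * (y / (y - x)) + 1 / (1 - x) * (x / (x - y)) - 1 / (1 - x) * (1 / (1 - y)) =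
         (y * (1 - x) - x * (1 - y) - (y - x)) / ((1 - x) * (1 - y) * (y - x))"
        using xy ne by (simp add: divide_simps) (simp add: algebra_simps)
      thus ?thesis by (simp add: algebra_simps)
    qed
    ultimately show ?thesis using 5 by simp
  qed (auto simp: psi_def u phi_def[of q 0] algebra_simps)
qed

lemma res_ind_mult_shift: "res_ind l b e * res_ind l (A - b) (d - e) = res_ind l A d * res_ind l b e"
proof -
  have "[d - e = A - b] (mod int l) \<longleftrightarrow> [d = A] (mod int l)" if "[e = b] (mod int l)"
    using cong_diff[OF _ that, of d A] cong_add[OF _ that, of "d - e" "A - b"] by auto
  thus ?thesis by (auto simp: res_ind_def)
qed

text \<open>The three products are reindexed to the common weight exp (d \<open>\<eta>\<close> + e
  \<open>\<xi>\<close>) over d congruent to A and e congruent to b; then only the coefficients from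
  \<open>phi_three_term\<close> have to be compared.\<close>

lemma Ffun_three_term:
  assumes l: "l > 0" and q: "0 < norm q" "norm q < 1"
    and z: "Re \<xi> < 0" "Re \<eta> < 0" "ln (norm q) < Re (\<xi> + \<eta>)"
  shows "Ffun l q b (\<xi> + \<eta>) * Ffun l q (A - b) \<eta> + Ffun l q A (\<xi> + \<eta>) * Ffun l q (b - A) \<xi> - Ffun l q A \<eta> * Ffun l q b \<xi> =
         of_bool ([A = b] (mod int l)) * Pfun l q A (\<xi> + \<eta>) + of_bool (int l dvd b) * Pfun l q A \<eta> + of_bool (int l dvd A) * Pfun l q b \<xi>"
proof -
  define t where "t a z d = res_ind l a d * phi q d * exp (of_int d * z)" for a z d
  define p where "p a z d = res_ind l a d * psi q d * exp (of_int d * z)" for a z d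
  have F: "(t a z has_sum Ffun l q a z) UNIV" if "ln (norm q) < Re z" "Re z < 0" for a z
    using Ffun_has_sum[OF l q that] by (simp add: t_def[abs_def])
  have P: "(p a z has_sum Pfun l q a z) UNIV" if "ln (norm q) < Re z" "Re z < 0" for a z
    unfolding Pfun_def p_def[abs_def] by (rule expsum_has_sum[OF geom_bounded_psi[OF q]]) (use that in auto)
  have z': "ln (norm q) < Re \<xi>" "ln (norm q) < Re \<eta>" "Re (\<xi> + \<eta>) < 0" using z by auto
  note F' = F[OF z(3) z'(3)] F[OF z'(2) z(2)] F[OF z'(1) z(1)]
  note P' = P[OF z(3) z'(3)] P[OF z'(2) z(2)] P[OF z'(1) z(1)]
  define w where "w d e = res_ind l A d * res_ind l b e * exp (of_int d * \<eta> + of_int e * \<xi>)" for d e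
  have 1: "((\<lambda>(d, e). w d e * (phi q e * phi q (d - e))) has_sum (Ffun l q b (\<xi> + \<eta>) * Ffun l q (A - b) \<eta>)) (UNIV \<times> UNIV)"
  proof -
    have "((\<lambda>(e, f). t b (\<xi> + \<eta>) e * t (A - b) \<eta> f) has_sum (Ffun l q b (\<xi> + \<eta>) * Ffun l q (A - b) \<eta>)) (UNIV \<times> UNIV)"
      by (rule has_sum_product_complex[OF F'(1,2)])
    also have "?this \<longleftrightarrow> ?thesis"
    proof (rule has_sum_reindex_bij_witness[of _ "\<lambda>(d, e). (e, d - e)" "\<lambda>(e, f). (e + f, e)"])
      fix x :: "int \<times> int" assume "x \<in> UNIV \<times> UNIV"
      obtain e f where x: "x = (e, f)" by (cases x)
      have "t b (\<xi> + \<eta>) e * t (A - b) \<eta> f = 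
         (res_ind l b e * res_ind l (A - b) (e + f - e)) * (phi q e * phi q f) * (exp (of_int e * (\<xi> + \<eta>)) * exp (of_int f * \<eta>))"
        by (simp add: t_def)
      also have "exp (of_int e * (\<xi> + \<eta>)) * exp (of_int f * \<eta>) = exp (of_int (e + f) * \<eta> + of_int e * \<xi>)"
        by (simp add: exp_add[symmetric] algebra_simps)
      finally show "(case (case x of (e, f) \<Rightarrow> (e + f, e)) of (d, e) \<Rightarrow> w d e * (phi q e * phi q (d - e))) = 
                    (case x of (e, f) \<Rightarrow> t b (\<xi> + \<eta>) e * t (A - b) \<eta> f)"
        unfolding res_ind_mult_shift by (simp add: x w_def)
    qed auto
    finally show ?thesis .
  qed
  have 2: "((\<lambda>(d, e). w d e * (phi q d * phi q (e - d))) has_sum (Ffun l q A (\<xi> + \<eta>) * Ffun l q (b - A) \<xi>)) (UNIV \<times> UNIV)"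
  proof -
    have "((\<lambda>(d, f). t A (\<xi> + \<eta>) d * t (b - A) \<xi> f) has_sum (Ffun l q A (\<xi> + \<eta>) * Ffun l q (b - A) \<xi>)) (UNIV \<times> UNIV)"
      by (rule has_sum_product_complex[OF F'(1,3)])
    also have "?this \<longleftrightarrow> ?thesis"
    proof (rule has_sum_reindex_bij_witness[of _ "\<lambda>(d, e). (d, e - d)" "\<lambda>(d, f). (d, d + f)"])
      fix x :: "int \<times> int" assume "x \<in> UNIV \<times> UNIV"
      obtain d f where x: "x = (d, f)" by (cases x)
      have "t A (\<xi> + \<eta>) d * t (b - A) \<xi> f = 
         (res_ind l A d * res_ind l (b - A) (d + f - d)) * (phi q d * phi q f) * (exp (of_int d * (\<xi> + \<eta>)) * exp (of_int f * \<xi>))"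
        by (simp add: t_def)
      also have "exp (of_int d * (\<xi> + \<eta>)) * exp (of_int f * \<xi>) = exp (of_int d * \<eta> + of_int (d + f) * \<xi>)"
        by (simp add: exp_add[symmetric] algebra_simps)
      finally show "(case (case x of (d, f) \<Rightarrow> (d, d + f)) of (d, e) \<Rightarrow> w d e * (phi q d * phi q (e - d))) = 
                    (case x of (d, f) \<Rightarrow> t A (\<xi> + \<eta>) d * t (b - A) \<xi> f)"
        unfolding res_ind_mult_shift by (simp add: x w_def mult_ac)
    qed auto
    finally show ?thesis .
  qed
  have 3: "((\<lambda>(d, e). w d e * (phi q d * phi q e)) has_sum (Ffun l q A \<eta> * Ffun l q b \<xi>)) (UNIV \<times> UNIV)"
  proof -
    have "((\<lambda>(d, e). t A \<eta> d * t b \<xi> e) has_sum (Ffun l q A \<eta> * Ffun l q b \<xi>)) (UNIV \<times> UNIV)"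
      by (rule has_sum_product_complex[OF F'(2,3)])
    also have "(\<lambda>(d, e). t A \<eta> d * t b \<xi> e) = (\<lambda>(d, e). w d e * (phi q d * phi q e))"
      by (auto simp: t_def w_def exp_add fun_eq_iff)
    finally show ?thesis .
  qed
  \<comment> \<open>Sums supported on a line are pulled back to one integer parameter through its
    parametrisation h.\<close>
  have line: "((\<lambda>(d, e). w d e * (of_bool (Q d e) * psi q (k d e))) has_sum S) (UNIV \<times> UNIV)"
    if h: "((\<lambda>x. w (fst (h x)) (snd (h x)) * psi q (k (fst (h x)) (snd (h x)))) has_sum S) UNIV" and inj: "inj h" 
      and Q: "\<And>d e. Q d e \<longleftrightarrow> (d, e) \<in> range h" 
    for Q k S and h :: "int \<Rightarrow> int \<times> int"
  proof -
    have "((\<lambda>p. w (fst p) (snd p) * psi q (k (fst p) (snd p))) has_sum S) (range h)"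
      using h by (subst has_sum_reindex[OF inj]) (simp add: o_def)
    also have "?this \<longleftrightarrow> ?thesis"
      by (rule has_sum_cong_neutral) (auto simp: case_prod_unfold Q)
    finally show ?thesis .
  qed
  have 4: "((\<lambda>(d, e). w d e * (of_bool (d = e) * psi q d)) has_sum (of_bool ([A = b] (mod int l)) * Pfun l q A (\<xi> + \<eta>))) (UNIV \<times> UNIV)"
  proof (rule line[of "\<lambda>x. (x, x)"])
    have ii: "res_ind l A d * res_ind l b d = of_bool ([A = b] (mod int l)) * res_ind l A d" for d
      by (auto simp: res_ind_def cong_def)
    have "w d d * psi q d = (res_ind l A d * res_ind l b d) * (psi q d * exp (of_int d * (\<xi> + \<eta>)))" for d
      by (simp add: w_def distrib_left add.commute mult_ac)
    hence "w d d * psi q d = of_bool ([A = b] (mod int l)) * p A (\<xi> + \<eta>) d" for d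
      unfolding ii by (simp only: p_def mult.assoc)
    thus "((\<lambda>x. w (fst (x, x)) (snd (x, x)) * psi q (fst (x, x))) has_sum (of_bool ([A = b] (mod int l)) * Pfun l q A (\<xi> + \<eta>))) UNIV"
      using has_sum_cmult_right[OF P'(1)] by simp
  qed (auto simp: inj_on_def)
  have 5: "((\<lambda>(d, e). w d e * (of_bool (e = 0) * psi q d)) has_sum (of_bool (int l dvd b) * Pfun l q A \<eta>)) (UNIV \<times> UNIV)"
  proof (rule line[of "\<lambda>x. (x, 0)"])
    have "res_ind l b 0 = of_bool (int l dvd b)" by (auto simp: res_ind_def cong_def dvd_eq_mod_eq_0)
    hence "w d 0 * psi q d = of_bool (int l dvd b) * p A \<eta> d" for d
      by (simp add: w_def p_def)
    thus "((\<lambda>x. w (fst (x, 0)) (snd (x, 0)) * psi q (fst (x, 0::int))) has_sum (of_bool (int l dvd b) * Pfun l q A \<eta>)) UNIV"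
      using has_sum_cmult_right[OF P'(2)] by simp
  qed (auto simp: inj_on_def)
  have 6: "((\<lambda>(d, e). w d e * (of_bool (d = 0) * psi q e)) has_sum (of_bool (int l dvd A) * Pfun l q b \<xi>)) (UNIV \<times> UNIV)"
  proof (rule line[of "\<lambda>x. (0, x)"])
    have "res_ind l A 0 = of_bool (int l dvd A)" by (auto simp: res_ind_def cong_def dvd_eq_mod_eq_0)
    hence "w 0 e * psi q e = of_bool (int l dvd A) * p b \<xi> e" for e
      by (simp add: w_def p_def)
    thus "((\<lambda>x. w (fst (0, x)) (snd (0, x)) * psi q (snd (0::int, x))) has_sum (of_bool (int l dvd A) * Pfun l q b \<xi>)) UNIV"
      using has_sum_cmult_right[OF P'(3)] by simp
  qed (auto simp: inj_on_def)
  have L: "((\<lambda>(d, e). w d e * (phi q e * phi q (d - e) + phi q d * phi q (e - d) - phi q d * phi q e)) has_sum 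
     (Ffun l q b (\<xi> + \<eta>) * Ffun l q (A - b) \<eta> + Ffun l q A (\<xi> + \<eta>) * Ffun l q (b - A) \<xi> - Ffun l q A \<eta> * Ffun l q b \<xi>)) (UNIV \<times> UNIV)"
    using has_sum_add[OF has_sum_add[OF 1 2] has_sum_cmult_right[OF 3, of "-1"]]
    by (simp add: case_prod_unfold algebra_simps)
  have R: "((\<lambda>(d, e). w d e * (of_bool (d = e) * psi q d + of_bool (e = 0) * psi q d + of_bool (d = 0) * psi q e)) has_sum 
     (of_bool ([A = b] (mod int l)) * Pfun l q A (\<xi> + \<eta>) + of_bool (int l dvd b) * Pfun l q A \<eta> + of_bool (int l dvd A) * Pfun l q b \<xi>)) (UNIV \<times> UNIV)"
    using has_sum_add[OF has_sum_add[OF 4 5] 6] by (simp add: case_prod_unfold distrib_left)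
  show ?thesis using L R unfolding phi_three_term[OF q] by (rule has_sum_unique)
qed

text \<open>The three-term identity is only available for small negative t, where all series
  converge; such a segment accumulates at 0, so the identity theorem applies.\<close>

lemma has_fps_expansion_eq_0:
  assumes f: "f has_fps_expansion G" and \<epsilon>: "\<epsilon> > 0"
    and zero: "\<And>t::real. - \<epsilon> < t \<Longrightarrow> t < 0 \<Longrightarrow> f (of_real t) = 0"
  shows "G = (0 :: complex fps)"
proof -
  obtain S where S: "open S" "0 \<in> S" "f holomorphic_on S"
    using has_fps_expansion_imp_holomorphic[OF f] by metis
  then obtain r where r: "r > 0" "ball 0 r \<subseteq> S" using openE by blast
  define m where "m = min \<epsilon> r"
  have m: "m > 0" "m \<le> \<epsilon>" "m \<le> r" using \<epsilon> r by (auto simp: m_def)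
  define U where "U = complex_of_real ` {-m<..<0}"
  have "(0 :: complex) islimpt U" unfolding islimpt_approachable
  proof (intro allI impI)
    fix e :: real assume e: "e > 0"
    have "- (min m e / 2) \<in> {-m<..<0}" using m e by (auto simp: min_def)
    hence "complex_of_real (- (min m e / 2)) \<in> U" unfolding U_def by (rule imageI)
    moreover have "complex_of_real (- (min m e / 2)) \<noteq> 0" using m e by (auto simp: min_def)
    moreover have "dist (complex_of_real (- (min m e / 2))) 0 < e"
      unfolding dist_complex_def diff_zero norm_of_real using m e by (auto simp: min_def)
    ultimately show "\<exists>x'\<in>U. x' \<noteq> 0 \<and> dist x' 0 < e" by blast
  qed
  moreover have "U \<subseteq> ball 0 r" using m by (auto simp: U_def)
  moreover have "f z = 0" if "z \<in> U" for z using that zero m by (auto simp: U_def)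
  ultimately have "f w = 0" if "w \<in> ball 0 r" for w
    using analytic_continuation[of f "ball 0 r" U 0 w] S(3) r that holomorphic_on_subset by auto
  moreover have "eventually (\<lambda>w. w \<in> ball (0::complex) r) (nhds 0)"
    using r by (intro eventually_nhds_in_open) auto
  ultimately have "eventually (\<lambda>w. f w = 0) (nhds 0)" by (auto elim: eventually_mono)
  hence "f has_fps_expansion 0" by (simp add: has_fps_expansion_0_iff)
  thus ?thesis using f fps_expansion_unique_complex by blast
qed

text \<open>Evaluation at c t as an operation on series: it puts the arguments \<open>\<xi>\<close>,
  \<open>\<eta>\<close> and \<open>\<xi> + \<eta>\<close> on one line with parameter t.\<close>

definition dilate :: "complex \<Rightarrow> complex fps \<Rightarrow> complex fps" where
  "dilate c F = fps_compose F (fps_const c * fps_X)"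

lemma dilate_nth: "fps_nth (dilate c F) n = c ^ n * fps_nth F n"
  by (simp add: dilate_def fps_compose_linear)

lemma has_fps_expansion_dilate:
  fixes f :: "complex \<Rightarrow> complex"
  assumes "f has_fps_expansion F"
  shows "(\<lambda>t. f (c * t)) has_fps_expansion dilate c F"
proof -
  have "(f \<circ> (\<lambda>t. c * t)) has_fps_expansion dilate c F"
    unfolding dilate_def by (intro fps_expansion_intros assms) auto
  thus ?thesis by (simp add: o_def)
qed

text \<open>This is \<open>Ffun_three_term\<close> at \<open>\<xi>\<close> = t and
  \<open>\<eta>\<close> = \<open>\<upsilon>\<close> t, with F = K - 1 / (l z). Multiplication by t
  clears the simple poles left by the cross terms.\<close>

lemma Kfps_three_term:
  assumes l: "l > 0" and q: "0 < norm q" "norm q < 1" and y: "(y::real) > 0"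
  defines "K \<equiv> \<lambda>c a. dilate c (Kfps l q a)" and "P \<equiv> \<lambda>c a. dilate c (Pfps l q a)"
    and "\<upsilon> \<equiv> complex_of_real y"
  shows "fps_X * (K (1 + \<upsilon>) b * K \<upsilon> (A - b) + K (1 + \<upsilon>) A * K 1 (b - A) - K \<upsilon> A * K 1 b) = 
         fps_const (1 / of_nat l) * (fps_const (1 / \<upsilon>) * (K (1 + \<upsilon>) b - K 1 b) + (K (1 + \<upsilon>) A - K \<upsilon> A) + 
            fps_const (1 / (1 + \<upsilon>)) * (K \<upsilon> (A - b) + K 1 (b - A))) + 
         fps_X * (fps_const (of_bool ([A = b] (mod int l))) * P (1 + \<upsilon>) A + fps_const (of_bool (int l dvd b)) * P \<upsilon> A 
            + fps_const (of_bool (int l dvd A)) * P 1 b)"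
    (is "?L = ?R")
proof -
  define k where "k = (\<lambda>a z. if z = 0 then fps_nth (Kfps l q a) 0 else Ffun l q a z + 1 / (of_nat l * z))"
  have k: "(\<lambda>t. k a (c * t)) has_fps_expansion K c a" for a c
    unfolding K_def k_def by (rule has_fps_expansion_dilate[OF Kfps_has_expansion[OF l q]])
  have p: "(\<lambda>t. Pfun l q a (c * t)) has_fps_expansion P c a" for a c
    unfolding P_def by (rule has_fps_expansion_dilate[OF Pfps_has_expansion[OF q]])
  \<comment> \<open>Chosen so that t > - \<open>\<epsilon>\<close> keeps
    \<open>\<xi> + \<eta>\<close>, of real part (1 + y) t, inside the strip.\<close>
  define \<epsilon> where "\<epsilon> = - ln (norm q) / (1 + y)"
  have \<epsilon>: "\<epsilon> > 0" using q y by (simp add: \<epsilon>_def divide_neg_pos)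
  have exp: "(\<lambda>t. t * (k b ((1 + \<upsilon>) * t) * k (A - b) (\<upsilon> * t) + k A ((1 + \<upsilon>) * t) * k (b - A) (1 * t) - k A (\<upsilon> * t) * k b (1 * t))
      - (1 / of_nat l * (1 / \<upsilon> * (k b ((1 + \<upsilon>) * t) - k b (1 * t)) + (k A ((1 + \<upsilon>) * t) - k A (\<upsilon> * t)) + 
            1 / (1 + \<upsilon>) * (k (A - b) (\<upsilon> * t) + k (b - A) (1 * t))) + 
         t * (of_bool ([A = b] (mod int l)) * Pfun l q A ((1 + \<upsilon>) * t) + of_bool (int l dvd b) * Pfun l q A (\<upsilon> * t) 
            + of_bool (int l dvd A) * Pfun l q b (1 * t)))) has_fps_expansion (?L - ?R)"
    by (intro fps_expansion_intros k p)
  have "?L - ?R = 0"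
  proof (rule has_fps_expansion_eq_0[OF exp \<epsilon>])
    fix t :: real assume t: "- \<epsilon> < t" "t < 0"
    define \<xi> where "\<xi> = complex_of_real t"
    define \<eta> where "\<eta> = \<upsilon> * \<xi>"
    have yt: "y * t < 0" using y t by (simp add: mult_pos_neg)
    have r1: "Re \<xi> < 0" using t by (simp add: \<xi>_def)
    have r2: "Re \<eta> < 0" using yt by (simp add: \<eta>_def \<xi>_def \<upsilon>_def)
    have "(- ln (norm q)) > (1 + y) * (- t)" using t y by (simp add: \<epsilon>_def field_simps)
    hence r3: "ln (norm q) < Re (\<xi> + \<eta>)" by (simp add: \<eta>_def \<xi>_def \<upsilon>_def algebra_simps)
    note F = Ffun_three_term[OF l q r1 r2 r3, of b A]
    have nz: "\<xi> \<noteq> 0" "\<eta> \<noteq> 0" "\<xi> + \<eta> \<noteq> 0" using r1 r2 by (auto simp: complex_eq_iff)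
    have \<upsilon>nz: "\<upsilon> \<noteq> 0" "1 + \<upsilon> \<noteq> 0" using y by (auto simp: \<upsilon>_def complex_eq_iff)
    define L where "L = (of_nat l :: complex)"
    have L: "L \<noteq> 0" using l by (simp add: L_def)
    have Fk: "Ffun l q a z = k a z - 1 / (L * z)" if "z \<noteq> 0" for a z
      using that by (simp add: k_def L_def)
    have e1: "(1 + \<upsilon>) * \<xi> = \<xi> + \<eta>" by (simp add: \<eta>_def algebra_simps)
    have alg: "\<xi> * (kb * ka' + kA * kb' - kA2 * kb2) - 
        (1 / L * (1 / \<upsilon> * (kb - kb2) + (kA - kA2) + 1 / (1 + \<upsilon>) * (ka' + kb')) + \<xi> * R) = 0"
      if "(kb - 1 / (L * (\<xi> + \<eta>))) * (ka' - 1 / (L * \<eta>)) + (kA - 1 / (L * (\<xi> + \<eta>))) * (kb' - 1 / (L * \<xi>)) 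
           - (kA2 - 1 / (L * \<eta>)) * (kb2 - 1 / (L * \<xi>)) = R" for kb ka' kA kb' kA2 kb2 R
    proof -
      define u where "u = 1 / \<xi>"
      define v where "v = 1 / \<upsilon>"
      define w where "w = 1 / (1 + \<upsilon>)"
      define i where "i = 1 / L"
      have 0: "1 / (L * (\<xi> + \<eta>)) = i * u * w"
        unfolding e1[symmetric] by (simp add: u_def w_def i_def mult_ac)
      have 1: "1 / (L * \<eta>) = i * u * v" "1 / (L * \<xi>) = i * u"
        by (simp_all add: u_def v_def i_def \<eta>_def mult_ac)
      \<comment> \<open>The second identity cancels the double poles; it is 1 /
        ((\<open>\<xi>\<close> + \<open>\<eta>\<close>) \<open>\<eta>\<close>) + 1 /
        ((\<open>\<xi>\<close> + \<open>\<eta>\<close>) \<open>\<xi>\<close>) = 1 /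
        (\<open>\<xi>\<close> \<open>\<eta>\<close>) in scaled form.\<close>
      have 2: "\<xi> * u = 1" "w * v + w - v = 0" using nz \<upsilon>nz by (simp_all add: u_def v_def w_def field_simps)
      have "R = kb * ka' + kA * kb' - kA2 * kb2 - i * u * (v * (kb - kb2) + (kA - kA2) + w * (ka' + kb')) + i * i * u * u * (w * v + w - v)"
        unfolding that[symmetric] 0 1 by (simp add: algebra_simps)
      hence R: "R = kb * ka' + kA * kb' - kA2 * kb2 - i * u * (v * (kb - kb2) + (kA - kA2) + w * (ka' + kb'))"
        by (simp only: 2) simp
      have "\<xi> * R = \<xi> * (kb * ka' + kA * kb' - kA2 * kb2) - (\<xi> * u) * (i * (v * (kb - kb2) + (kA - kA2) + w * (ka' + kb')))"
        unfolding R by (simp add: algebra_simps)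
      thus ?thesis unfolding 2 by (simp add: i_def[symmetric] v_def[symmetric] w_def[symmetric])
    qed
    show "complex_of_real t * (k b ((1 + \<upsilon>) * of_real t) * k (A - b) (\<upsilon> * of_real t) + k A ((1 + \<upsilon>) * of_real t) * k (b - A) (1 * of_real t) - k A (\<upsilon> * of_real t) * k b (1 * of_real t))
      - (1 / of_nat l * (1 / \<upsilon> * (k b ((1 + \<upsilon>) * of_real t) - k b (1 * of_real t)) + (k A ((1 + \<upsilon>) * of_real t) - k A (\<upsilon> * of_real t)) + 
            1 / (1 + \<upsilon>) * (k (A - b) (\<upsilon> * of_real t) + k (b - A) (1 * of_real t))) + 
         of_real t * (of_bool ([A = b] (mod int l)) * Pfun l q A ((1 + \<upsilon>) * of_real t) + of_bool (int l dvd b) * Pfun l q A (\<upsilon> * of_real t) 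
            + of_bool (int l dvd A) * Pfun l q b (1 * of_real t))) = 0"
      unfolding \<xi>_def[symmetric] e1 \<eta>_def[symmetric] mult_1 L_def[symmetric]
      by (rule alg) (use F in \<open>simp only: Fk[OF nz(1)] Fk[OF nz(2)] Fk[OF nz(3)]\<close>)
  qed
  thus ?thesis by simp
qed

text \<open>For a polynomial P with vector coefficients, P(2 y) - 2^(n+1) P(y) has no term of degree
  n + 1 and multiplies the others by nonzero scalars, so induction on the degree applies. The map
  \<open>\<phi>\<close> embeds the reals multiplicatively into the scalars.\<close>

lemma (in vector_space) subspace_polynomial_coeffs:
  fixes M :: "nat \<Rightarrow> 'b" and \<phi> :: "real \<Rightarrow> 'a"
  assumes W: "subspace W" and \<phi>: "\<phi> 1 = 1" "\<And>x y. \<phi> (x * y) = \<phi> x * \<phi> y" "inj \<phi>"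
    and M: "\<And>y::real. y > 0 \<Longrightarrow> (\<Sum>s\<le>n. scale (\<phi> y ^ s) (M s)) \<in> W" and s: "s \<le> n"
  shows "M s \<in> W"
proof -
  have \<phi>_pow: "\<phi> (x ^ i) = \<phi> x ^ i" for x i by (induction i) (auto simp: \<phi>)
  have "\<forall>s\<le>n. M s \<in> W" using M
  proof (induction n arbitrary: M)
    case 0
    thus ?case using 0[of 1] \<phi> by simp
  next
    case (Suc n)
    have lower: "M s \<in> W" if s: "s \<le> n" for s
    proof -
      define c where "c s = \<phi> 2 ^ s - \<phi> 2 ^ Suc n" for s
      have "(\<Sum>s\<le>n. scale (\<phi> y ^ s) (scale (c s) (M s))) \<in> W" if y: "y > 0" for y
      proof -
        have "(\<Sum>s\<le>Suc n. scale (\<phi> (2 * y) ^ s) (M s)) - scale (\<phi> 2 ^ Suc n) (\<Sum>s\<le>Suc n. scale (\<phi> y ^ s) (M s)) \<in> W"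
          using Suc.prems[of "2 * y"] Suc.prems[of y] y by (intro subspace_diff subspace_scale W) auto
        also have "(\<Sum>s\<le>Suc n. scale (\<phi> (2 * y) ^ s) (M s)) - scale (\<phi> 2 ^ Suc n) (\<Sum>s\<le>Suc n. scale (\<phi> y ^ s) (M s)) = 
              (\<Sum>s\<le>Suc n. scale (\<phi> y ^ s) (scale (c s) (M s)))"
          unfolding scale_sum_right sum_subtractf[symmetric] scale_scale scale_left_diff_distrib[symmetric]
          by (intro sum.cong refl arg_cong2[where f = scale]) (simp add: \<phi> c_def power_mult_distrib algebra_simps)
        also have "\<dots> = (\<Sum>s\<le>n. scale (\<phi> y ^ s) (scale (c s) (M s)))" by (simp add: c_def)
        finally show ?thesis .
      qed
      from Suc.IH[OF this] have "scale (c s) (M s) \<in> W" using s by blast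
      hence "scale (inverse (c s)) (scale (c s) (M s)) \<in> W" by (rule subspace_scale[OF W])
      moreover have "c s \<noteq> 0"
      proof
        assume "c s = 0"
        hence "\<phi> (2 ^ s) = \<phi> (2 ^ Suc n)" by (simp only: c_def \<phi>_pow) simp
        hence "(2::real) ^ s = 2 ^ Suc n" using \<phi>(3) by (simp only: inj_eq)
        thus False using s power_inject_exp[of "2::real" s "Suc n"] by simp
      qed
      ultimately show ?thesis by simp
    qed
    \<comment> \<open>At y = 1 all powers are 1, so subtracting the lower coefficients leaves the
      top one.\<close>
    have "(\<Sum>s\<le>Suc n. scale (\<phi> 1 ^ s) (M s)) - (\<Sum>s\<le>n. M s) \<in> W"
    proof (rule subspace_diff[OF W])
      show "(\<Sum>s\<le>Suc n. scale (\<phi> 1 ^ s) (M s)) \<in> W" by (rule Suc.prems) simp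
      show "(\<Sum>s\<le>n. M s) \<in> W" by (rule subspace_sum[OF W]) (use lower in auto)
    qed
    hence "M (Suc n) \<in> W" by (simp add: \<phi>)
    thus ?case using lower le_Suc_eq by auto
  qed
  thus ?thesis using s by blast
qed

section \<open>Modular symbols\<close>

lemma s_tilde_cong:
  assumes "[a = b] (mod int l)"
  shows "s_tilde l j a = s_tilde l j b"
proof -
  have "[- a = - b] (mod int l)" using assms by (simp add: cong_minus_minus_iff)
  hence *: "([x = a] (mod int l)) = ([x = b] (mod int l))" "([x = - a] (mod int l)) = ([x = - b] (mod int l))" for x
    using assms by (auto simp: cong_def)
  have "s_series l j a = s_series l j b" by (simp add: s_series_def * fun_eq_iff)
  moreover from this have "s_const l j a = s_const l j b"
    using assms by (simp add: s_const_def cong_def dvd_eq_mod_eq_0)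
  ultimately show ?thesis by (simp add: s_tilde_def)
qed

text \<open>The value of mu on P(x, y) w at a single \<open>\<tau>\<close>, as a linear functional
  of P; this allows ring identities between polynomials, such as the binomial theorem, to be used
  before evaluation.\<close>

definition sval :: "nat \<Rightarrow> complex \<Rightarrow> int \<times> int \<Rightarrow> poly2 \<Rightarrow> complex" where
  "sval l \<tau> w P = (\<Sum>m\<in>Poly_Mapping.keys P. Poly_Mapping.lookup P m * mu_basis l (m, w) \<tau>)"

lemma sval_superset:
  assumes "finite S" "Poly_Mapping.keys P \<subseteq> S"
  shows "sval l \<tau> w P = (\<Sum>m\<in>S. Poly_Mapping.lookup P m * mu_basis l (m, w) \<tau>)"
  unfolding sval_def using assms by (intro sum.mono_neutral_left) (auto simp: in_keys_iff)

lemma sval_add: "sval l \<tau> w (P + Q) = sval l \<tau> w P + sval l \<tau> w Q"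
proof -
  let ?S = "Poly_Mapping.keys P \<union> Poly_Mapping.keys Q"
  have "sval l \<tau> w R = (\<Sum>m\<in>?S. Poly_Mapping.lookup R m * mu_basis l (m, w) \<tau>)" if "R \<in> {P, Q, P + Q}" for R
    using that keys_add[of P Q] by (intro sval_superset) auto
  thus ?thesis by (simp add: lookup_add distrib_right sum.distrib)
qed

lemma sval_0: "sval l \<tau> w 0 = 0"
  by (simp add: sval_def)

lemma sval_sum: "sval l \<tau> w (\<Sum>x\<in>A. f x) = (\<Sum>x\<in>A. sval l \<tau> w (f x))"
  by (induction A rule: infinite_finite_induct) (auto simp: sval_0 sval_add)

abbreviation pconst :: "complex \<Rightarrow> poly2" where
  "pconst \<equiv> Poly_Mapping.single 0"

lemma sval_cmult: "sval l \<tau> w (pconst c * P) = c * sval l \<tau> w P"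
proof -
  have "Poly_Mapping.lookup (pconst c * P) m = c * Poly_Mapping.lookup P m" for m
    unfolding mult_map_scale_conv_mult[symmetric] by (simp add: map.rep_eq when_def)
  note lookup = this
  hence "Poly_Mapping.keys (pconst c * P) \<subseteq> Poly_Mapping.keys P"
    by (auto simp: in_keys_iff)
  from sval_superset[OF finite_keys this] show ?thesis
    by (simp add: lookup sval_def[of _ _ _ P] sum_distrib_left mult.assoc)
qed

lemma X_power_Y_power: "X ^ i * Y ^ j = Poly_Mapping.single (i, j) 1"
proof -
  have "X ^ i = Poly_Mapping.single (i, 0) 1"
    by (induction i) (auto simp: X_def mult_single zero_prod_def[symmetric])
  moreover have "Y ^ j = Poly_Mapping.single (0, j) 1"
    by (induction j) (auto simp: Y_def mult_single zero_prod_def[symmetric])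
  ultimately show ?thesis by (simp add: mult_single)
qed

lemma sval_monomial: "sval l \<tau> w (X ^ i * Y ^ j) = mu_basis l ((i, j), w) \<tau>"
  by (simp add: X_power_Y_power sval_def)

lemma pconst_mult: "pconst (c * d) = pconst c * pconst d"
  by (simp add: mult_single)

lemma pconst_1: "pconst 1 = 1"
  by simp

lemma pconst_power: "pconst (c ^ n) = pconst c ^ n"
  by (induction n) (auto simp: pconst_mult)

lemma pconst_of_nat: "pconst (of_nat n) = of_nat n"
  by (induction n) (auto simp: single_add)

lemma mu_symbol: "mu l (symbol l P (u, v)) \<tau> = sval l \<tau> (u mod int l, v mod int l) P"
proof -
  have mu_single': "mu l (Poly_Mapping.single p c) \<tau> = c * mu_basis l p \<tau>" for p c
    by (cases "c = 0") (auto simp: mu_def fscale_def)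
  have "mu l (\<Sum>m\<in>A. f m) \<tau> = (\<Sum>m\<in>A. mu l (f m) \<tau>)" for A :: "(nat \<times> nat) set" and f
    by (induction A rule: infinite_finite_induct) (auto simp: mu_add mu_def[of l 0])
  thus ?thesis by (simp add: symbol_def mu_single' sval_def)
qed

text \<open>The factorials in \<open>s_tilde_eq_Kfps\<close> cancel the binomial coefficients,
  leaving a Cauchy product. The exponent of X belongs to v and that of Y to u; the sign (-1)^s of mu
  turns \<open>\<beta>\<close> into - \<open>\<beta>\<close>.\<close>

lemma sval_binomial:
  assumes l: "l > 0" and \<tau>: "\<tau> \<in> upper_half"
  shows "sval l \<tau> (u mod int l, v mod int l) (pconst (1 / fact n) * (pconst \<alpha> * X + pconst \<beta> * Y) ^ n) = 
         fps_nth (dilate \<alpha> (Kfps l (nome \<tau>) v) * dilate (- \<beta>) (Kfps l (nome \<tau>) u)) n"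
proof -
  let ?K = "\<lambda>a. fps_nth (Kfps l (nome \<tau>) a)"
  have mb: "mu_basis l ((i, j), (u mod int l, v mod int l)) \<tau> = (-1) ^ j * (fact j * ?K u j) * (fact i * ?K v i)" for i j
  proof -
    have s: "s_tilde l j (a mod int l) = s_tilde l j a" for j a by (rule s_tilde_cong) (simp add: cong_def)
    show ?thesis by (simp add: mu_basis_def s s_tilde_eq_Kfps[OF l _ \<tau>])
  qed
  have "pconst (1 / fact n) * (pconst \<alpha> * X + pconst \<beta> * Y) ^ n = 
        (\<Sum>i\<le>n. pconst (1 / fact n * (of_nat (n choose i) * (\<alpha> ^ i * \<beta> ^ (n - i)))) * (X ^ i * Y ^ (n - i)))"
    unfolding binomial_ring sum_distrib_left
    by (intro sum.cong refl) (simp only: pconst_mult pconst_power pconst_of_nat power_mult_distrib mult_ac)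
  hence "sval l \<tau> (u mod int l, v mod int l) (pconst (1 / fact n) * (pconst \<alpha> * X + pconst \<beta> * Y) ^ n) = 
        (\<Sum>i\<le>n. (1 / fact n * (of_nat (n choose i) * (\<alpha> ^ i * \<beta> ^ (n - i)))) * 
           ((-1) ^ (n - i) * (fact (n - i) * ?K u (n - i)) * (fact i * ?K v i)))"
    by (simp only: sval_sum sval_cmult sval_monomial mb)
  also have "\<dots> = (\<Sum>i\<le>n. (\<alpha> ^ i * ?K v i) * ((- \<beta>) ^ (n - i) * ?K u (n - i)))"
  proof (intro sum.cong refl)
    fix i assume "i \<in> {..n}"
    hence b: "of_nat (n choose i) * fact i * fact (n - i) = (fact n :: complex)"
      by (simp add: binomial_fact)
    have "(1 / fact n * (of_nat (n choose i) * (\<alpha> ^ i * \<beta> ^ (n - i)))) * 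
           ((-1) ^ (n - i) * (fact (n - i) * ?K u (n - i)) * (fact i * ?K v i)) = 
          (of_nat (n choose i) * fact i * fact (n - i)) / fact n * ((\<alpha> ^ i * ?K v i) * (((-1) ^ (n - i) * \<beta> ^ (n - i)) * ?K u (n - i)))"
      by (simp only: times_divide_eq_left times_divide_eq_right mult_1 mult_ac)
    also have "\<dots> = (\<alpha> ^ i * ?K v i) * ((- \<beta>) ^ (n - i) * ?K u (n - i))"
      unfolding b by (simp add: power_mult_distrib[symmetric])
    finally show "(1 / fact n * (of_nat (n choose i) * (\<alpha> ^ i * \<beta> ^ (n - i)))) * 
           ((-1) ^ (n - i) * (fact (n - i) * ?K u (n - i)) * (fact i * ?K v i)) = 
          (\<alpha> ^ i * ?K v i) * ((- \<beta>) ^ (n - i) * ?K u (n - i))" .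
  qed
  also have "\<dots> = fps_nth (dilate \<alpha> (Kfps l (nome \<tau>) v) * dilate (- \<beta>) (Kfps l (nome \<tau>) u)) n"
    by (simp add: fps_mult_nth dilate_nth atMost_atLeast0)
  finally show ?thesis .
qed

definition three_term :: "nat \<Rightarrow> int \<Rightarrow> int \<Rightarrow> nat \<Rightarrow> nat \<Rightarrow> symbols" where
  "three_term l a b r s = symbol l (X ^ r * Y ^ s) (a, b)
            + symbol l ((-1) ^ r * Y ^ r * (X - Y) ^ s) (b, - a - b)
            + symbol l ((-1) ^ s * (Y - X) ^ r * X ^ s) (- a - b, a)"

text \<open>With the weights \<open>\<upsilon>\<close>^s / ((n-s)! s!) each of the three terms sums
  to the n-th power of a linear form over n!. The signs (-1)^r and (-1)^s are moved into (-Y)^r and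
  (-X)^s beforehand.\<close>

lemma three_term_generating_function:
  fixes y :: real
  assumes l: "l > 0" and \<tau>: "\<tau> \<in> upper_half"
  defines "K \<equiv> \<lambda>c a. dilate c (Kfps l (nome \<tau>) a)" and "\<upsilon> \<equiv> complex_of_real y"
  shows "(\<Sum>s\<le>n. \<upsilon> ^ s * (1 / (fact (n - s) * fact s) * mu l (three_term l a b (n - s) s) \<tau>)) = 
         fps_nth (K (1 + \<upsilon>) b * K \<upsilon> (- a - b) + K (1 + \<upsilon>) (- a) * K 1 (b - (- a)) - K \<upsilon> (- a) * K 1 b) n"
proof -
  let ?c = "\<lambda>s. \<upsilon> ^ s * (1 / (fact (n - s) * fact s))"
  have bin: "(\<Sum>s\<le>n. pconst (?c s) * (P ^ (n - s) * Q ^ s)) = pconst (1 / fact n) * (pconst \<upsilon> * Q + P) ^ n" for P Q :: poly2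
    unfolding binomial_ring sum_distrib_left
  proof (intro sum.cong refl)
    fix s assume "s \<in> {..n}"
    hence "?c s = 1 / fact n * (of_nat (n choose s) * \<upsilon> ^ s)" by (simp add: binomial_fact)
    thus "pconst (?c s) * (P ^ (n - s) * Q ^ s) = pconst (1 / fact n) * (of_nat (n choose s) * (pconst \<upsilon> * Q) ^ s * P ^ (n - s))"
      by (simp only: pconst_mult pconst_power pconst_of_nat power_mult_distrib mult_ac)
  qed
  have ev: "(\<Sum>s\<le>n. ?c s * sval l \<tau> w (P ^ (n - s) * Q ^ s)) = sval l \<tau> w (pconst (1 / fact n) * (pconst \<upsilon> * Q + P) ^ n)" for w P Q
    unfolding bin[symmetric] by (simp only: sval_sum sval_cmult)
  have pm1: "pconst (- c) = - pconst c" for c by (rule poly_mapping_eqI) (simp add: lookup_single when_def)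
  have 1: "pconst \<upsilon> * Y + X = pconst 1 * X + pconst \<upsilon> * Y" by simp
  have 2: "pconst \<upsilon> * (X - Y) + - Y = pconst \<upsilon> * X + pconst (- (1 + \<upsilon>)) * Y"
    unfolding pm1 single_add pconst_1 by (simp add: algebra_simps)
  have 3: "pconst \<upsilon> * (- X) + (Y - X) = pconst (- (1 + \<upsilon>)) * X + pconst 1 * Y"
    unfolding pm1 single_add pconst_1 by (simp add: algebra_simps)
  have el: "mu l (three_term l a b r s) \<tau> = sval l \<tau> (a mod int l, b mod int l) (X ^ r * Y ^ s) + 
     sval l \<tau> (b mod int l, (- a - b) mod int l) ((- Y) ^ r * (X - Y) ^ s) + 
     sval l \<tau> ((- a - b) mod int l, a mod int l) ((Y - X) ^ r * (- X) ^ s)" for r s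
    unfolding three_term_def mu_add plus_fun_apply mu_symbol power_minus[of Y r] power_minus[of X s] by (simp only: mult_ac)
  \<comment> \<open>Parity removes the negative dilations and replaces a by -a, which is the A of
    the three-term identity.\<close>
  have par: "K (- c) (- d) = - K c d" for c d
  proof (rule fps_ext)
    fix m
    have "(- c) ^ m * (-1) ^ m = c ^ m" unfolding power_mult_distrib[symmetric] by simp
    hence "(- c) ^ m * ((-1) ^ m * x) = c ^ m * x" for x by (simp only: mult.assoc[symmetric])
    thus "fps_nth (K (- c) (- d)) m = fps_nth (- K c d) m"
      by (simp add: K_def dilate_nth Kfps_uminus[OF l nome_bounds[OF \<tau>]])
  qed
  have "(\<Sum>s\<le>n. \<upsilon> ^ s * (1 / (fact (n - s) * fact s) * mu l (three_term l a b (n - s) s) \<tau>)) = 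
        (\<Sum>s\<le>n. ?c s * sval l \<tau> (a mod int l, b mod int l) (X ^ (n - s) * Y ^ s)) + 
        (\<Sum>s\<le>n. ?c s * sval l \<tau> (b mod int l, (- a - b) mod int l) ((- Y) ^ (n - s) * (X - Y) ^ s)) + 
        (\<Sum>s\<le>n. ?c s * sval l \<tau> ((- a - b) mod int l, a mod int l) ((Y - X) ^ (n - s) * (- X) ^ s))"
    unfolding el by (simp only: distrib_left sum.distrib mult.assoc)
  also have "\<dots> = fps_nth (K 1 b * K (- \<upsilon>) a) n + fps_nth (K \<upsilon> (- a - b) * K (- (- (1 + \<upsilon>))) b) n 
       + fps_nth (K (- (1 + \<upsilon>)) a * K (- 1) (- a - b)) n"
    unfolding ev 1 2 3 sval_binomial[OF l \<tau>] K_def by simp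
  also have "K (- \<upsilon>) a = - K \<upsilon> (- a)" using par[of \<upsilon> "- a"] by simp
  also have "K (- (1 + \<upsilon>)) a = - K (1 + \<upsilon>) (- a)" using par[of "1 + \<upsilon>" "- a"] by simp
  also have "K (- 1) (- a - b) = - K 1 (b - (- a))" using par[of 1 "a + b"] by (simp add: algebra_simps)
  finally show ?thesis by (simp add: algebra_simps)
qed

text \<open>Coefficients of degree n + 1 are compared in \<open>Kfps_three_term\<close>. The factor
  t takes the products and the P terms from degree n; the single K terms have index n + 1. These are
  mu of the combination, derivatives of weight n and forms of weight n + 2, respectively.\<close>

lemma three_term_combination_in_span:
  fixes y :: real
  assumes l: "l > 0" and n: "n \<ge> 1" and y: "y > 0"
  shows "(\<Sum>s\<le>n. fscale (of_real y ^ s) (fscale (1 / (fact (n - s) * fact s)) (mu l (three_term l a b (n - s) s))))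
         \<in> module.span fscale
             ({s_tilde l (n + 2) c | c. c \<in> {0..<int l}} \<union> {deriv_upper (s_tilde l n c) | c. c \<in> {0..<int l}})"
proof -
  interpret vs: vector_space fscale by (rule vector_space_fscale)
  let ?B = "{s_tilde l (n + 2) c | c. c \<in> {0..<int l}} \<union> {deriv_upper (s_tilde l n c) | c. c \<in> {0..<int l}}"
  have s: "s_tilde l j c = s_tilde l j (c mod int l)" for j c by (rule s_tilde_cong) (simp add: cong_def)
  have cm: "c mod int l \<in> {0..<int l}" for c using l by simp
  have S: "s_tilde l (n + 2) c \<in> vs.span ?B" for c
    by (subst s, rule vs.span_base) (use cm in blast)
  have D: "deriv_upper (s_tilde l n c) \<in> vs.span ?B" for c
    by (subst s, rule vs.span_base) (use cm in blast)
  define \<upsilon> where "\<upsilon> = complex_of_real y"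
  have \<upsilon>: "\<upsilon> \<noteq> 0" "1 + \<upsilon> \<noteq> 0" using y by (auto simp: \<upsilon>_def complex_eq_iff)
  define A where "A = - a"
  define i where "i = 1 / (of_nat l :: complex)"
  define j where "j = 1 / (fact (n + 1) :: complex)"
  define v where "v = 1 / \<upsilon>"
  define w where "w = 1 / (1 + \<upsilon>)"
  define g where "g = 1 / (- 2 * of_real pi * \<i> * fact n)"
  \<comment> \<open>The powers of \<open>\<upsilon>\<close> and 1 + \<open>\<upsilon>\<close> come
    from the dilations, exponent n + 1 for K and n for P; j and g convert Taylor coefficients into
    forms and derivatives.\<close>
  define R where "R = fscale (i * j * (v * ((1 + \<upsilon>) ^ (n + 1) - 1))) (s_tilde l (n + 2) b) + 
     fscale (i * j * ((1 + \<upsilon>) ^ (n + 1) - \<upsilon> ^ (n + 1))) (s_tilde l (n + 2) A) + 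
     fscale (i * j * (w * \<upsilon> ^ (n + 1))) (s_tilde l (n + 2) (A - b)) + 
     fscale (i * j * w) (s_tilde l (n + 2) (b - A)) + 
     fscale (g * (of_bool ([A = b] (mod int l)) * (1 + \<upsilon>) ^ n + of_bool (int l dvd b) * \<upsilon> ^ n)) (deriv_upper (s_tilde l n A)) + 
     fscale (g * of_bool (int l dvd A)) (deriv_upper (s_tilde l n b))"
  have "R \<in> vs.span ?B"
    unfolding R_def by (intro vs.span_add vs.span_scale S D)
  moreover have "(\<Sum>s\<le>n. fscale (of_real y ^ s) (fscale (1 / (fact (n - s) * fact s)) (mu l (three_term l a b (n - s) s)))) = R"
    (is "?L = R")
  proof
    fix \<tau>
    have sum_app: "(\<Sum>s\<in>C. h s) \<tau> = (\<Sum>s\<in>C. h s \<tau>)" for h :: "nat \<Rightarrow> complex \<Rightarrow> complex" and C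
      by (induction C rule: infinite_finite_induct) auto
    have L: "?L \<tau> = (\<Sum>s\<le>n. \<upsilon> ^ s * (1 / (fact (n - s) * fact s) * mu l (three_term l a b (n - s) s) \<tau>))"
      unfolding sum_app by (simp add: fscale_def \<upsilon>_def)
    show "?L \<tau> = R \<tau>"
    proof (cases "\<tau> \<in> upper_half")
      \<comment> \<open>Functions are extended by zero outside the upper half-plane, so both sides
        must vanish there.\<close>
      case False
      have z: "s_tilde l j c \<tau> = 0" for j c using False by (simp add: s_tilde_def s_series_def)
      hence "sval l \<tau> w P = 0" for w P by (auto simp: sval_def mu_basis_def case_prod_unfold)
      hence "mu l (three_term l a b r s) \<tau> = 0" for r s
        by (simp add: three_term_def mu_add mu_symbol)
      thus ?thesis using False unfolding L by (simp add: R_def fscale_def z deriv_upper_def)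
    next
      case True
      note q = nome_bounds[OF True]
      let ?K = "\<lambda>c. fps_nth (Kfps l (nome \<tau>) c) (n + 1)"
      let ?P = "\<lambda>c. fps_nth (Pfps l (nome \<tau>) c) n"
      have K: "?K c = j * s_tilde l (n + 2) c \<tau>" for c
        using s_tilde_eq_Kfps[OF l _ True, of "n + 2" c] by (simp add: j_def del: fact_Suc)
      have P: "?P c = g * deriv_upper (s_tilde l n c) \<tau>" for c
        using deriv_upper_s_tilde[OF n True, of l c] by (simp add: g_def)
      note three = arg_cong[OF Kfps_three_term[OF l q y, of b A], where f = "\<lambda>F. fps_nth F (n + 1)", folded \<upsilon>_def]
      define E where "E = (1 + \<upsilon>) ^ (n + 1)"
      define U where "U = \<upsilon> ^ (n + 1)"
      have "?L \<tau> = i * (v * (E * ?K b - ?K b) + (E * ?K A - U * ?K A) + w * (U * ?K (A - b) + ?K (b - A))) + 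
         (of_bool ([A = b] (mod int l)) * ((1 + \<upsilon>) ^ n * ?P A) + of_bool (int l dvd b) * (\<upsilon> ^ n * ?P A) + of_bool (int l dvd A) * ?P b)"
        using three unfolding L three_term_generating_function[OF l True, of y, folded \<upsilon>_def] A_def[symmetric] E_def U_def
        by (simp add: dilate_nth i_def v_def w_def del: power_Suc)
      also have "\<dots> = R \<tau>"
        unfolding K P R_def fscale_def plus_fun_apply E_def[symmetric] U_def[symmetric]
        by (simp add: algebra_simps)
      finally show ?thesis .
    qed
  qed
  ultimately show ?thesis by simp
qed

theorem theorem6p2:
  fixes l k r s :: nat and a b :: int
  assumes "l \<ge> 1" and "k > 2" and "r + s = k - 2" and "(a, b) \<in> E_set l"
  shows "mu l
           (symbol l (X ^ r * Y ^ s) (a, b)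
            + symbol l ((-1) ^ r * Y ^ r * (X - Y) ^ s) (b, - a - b)
            + symbol l ((-1) ^ s * (Y - X) ^ r * X ^ s) (- a - b, a))
         \<in> module.span fscale
             ({s_tilde l k c | c. c \<in> {0..<int l}}
              \<union> {deriv_upper (s_tilde l (k - 2) c) | c. c \<in> {0..<int l}})"
proof -
  interpret vs: vector_space fscale by (rule vector_space_fscale)
  define n where "n = k - 2"
  have n: "n \<ge> 1" "n + 2 = k" "r = n - s" "s \<le> n" using assms by (auto simp: n_def)
  let ?W = "vs.span ({s_tilde l (n + 2) c | c. c \<in> {0..<int l}} \<union> {deriv_upper (s_tilde l n c) | c. c \<in> {0..<int l}})"
  have "fscale (1 / (fact (n - s) * fact s)) (mu l (three_term l a b (n - s) s)) \<in> ?W"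
  \<comment> \<open>The combination is a polynomial in y lying in the span for every y > 0; its
    coefficient at y^s is the desired element divided by (n - s)! s!.\<close>
  proof (rule vs.subspace_polynomial_coeffs[where \<phi> = complex_of_real and n = n and s = s and 
           M = "\<lambda>s. fscale (1 / (fact (n - s) * fact s)) (mu l (three_term l a b (n - s) s))"])
    show "vs.subspace ?W" by (rule vs.subspace_span)
    show "inj complex_of_real" by (rule inj_of_real)
  qed (use three_term_combination_in_span[of l n] assms n in auto)
  hence "fscale (fact (n - s) * fact s) (fscale (1 / (fact (n - s) * fact s)) (mu l (three_term l a b (n - s) s))) \<in> ?W"
    by (rule vs.span_scale)
  hence "mu l (three_term l a b (n - s) s) \<in> ?W" by (simp add: fscale_def)
  thus ?thesis unfolding three_term_def n(2) n(3)[symmetric] n_def[symmetric] .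
qed

end
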